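(* For positive integers $d,s$, let $W_{d^2,s}$ be a Wishart matrix of parameters $(d^2,s)$, let $R_{d^2,s}=(W_{d^2,s})^R$ be its realignment, and let $$Q=Q_{d^2,s}=\frac{1}{d\sqrt{s}}\left(R_{d^2,s}-ds\,E\right).$$ Then, for every integer $p\ge 1$, as $d$ and $s$ both tend to infinity (with no assumption on their relative growth), $$\lim_{d,s\to\infty}\mathbf{E}\,\frac{1}{d^2}\mathrm{Tr}\left[(QQ^* )^p\right]=\mathrm{Cat}_p,\qquad \lim_{d,s\to\infty}\mathbf{Var}\,\frac{1}{d^2}\mathrm{Tr}\left[(QQ^* )^p\right]=0.$$
   Context: Wishart matrix of parameters $(d^2,s)$: $W=XX^*$, where $X$ is a $d^2\times s$ random matrix with i.i.d. standard complex Gaussian entries $\mathcal{N}_{\mathbf{C}}(0,1)$ (so $\mathbf{E}|X_{ij}|^2=1$). It is viewed as an operator on $\mathbf{C}^d\otimes\mathbf{C}^d$. Realignment: let $\{e_i\}_{i=1}^d$ and $\{f_j\}_{j=1}^d$ denote the canonical bases of the first and second factor of $\mathbf{C}^d\otimes\mathbf{C}^d$. For an operator $A=\sum_{i,j,k,l=1}^d A_{ij,kl}\,|e_i\otimes f_j\rangle\langle e_k\otimes f_l|$, its realignment is the $d^2\times d^2$ matrix $A^R=\sum_{i,j,k,l=1}^d A_{ij,kl}\,|e_i\otimes e_k\rangle\langle f_j\otimes f_l|$. $E=E_d=|\psi\rangle\langle\psi|$ is the maximally entangled state, with $|\psi\rangle=\frac{1}{\sqrt d}\sum_{i=1}^d|e_i\otimes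 e_i\rangle$ (all canonical bases of $\mathbf{C}^d$ being identified). $\mathrm{Cat}_p=\frac{1}{p+1}\binom{2p}{p}$ is the $p$th Catalan number. $\mathbf{E}$ and $\mathbf{Var}$ denote expectation and variance. *)

theory Defs
  imports "HOL-Probability.Probability" "Jordan_Normal_Form.Schur_Decomposition"
begin

text \<open>The law $\mathcal{N}_{\mathbf C}(0,1)$: independent real and imaginary parts, each a centred
  real Gaussian of variance $1/2$ (the last argument of \<^const>\<open>normal_density\<close> is the standard
  deviation).\<close>

definition std_complex_gaussian :: "'w measure \<Rightarrow> ('w \<Rightarrow> complex) \<Rightarrow> bool" where
  "std_complex_gaussian M Z \<longleftrightarrow>
     distributed M lborel (\<lambda>w. Re (Z w)) (\<lambda>x. ennreal (normal_density 0 (1 / sqrt 2) x)) \<and>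
     distributed M lborel (\<lambda>w. Im (Z w)) (\<lambda>x. ennreal (normal_density 0 (1 / sqrt 2) x)) \<and>
     prob_space.indep_var M borel (\<lambda>w. Re (Z w)) borel (\<lambda>w. Im (Z w))"

definition complex_gaussian_matrix ::
    "'w measure \<Rightarrow> nat \<Rightarrow> nat \<Rightarrow> ('w \<Rightarrow> complex mat) \<Rightarrow> bool" where
  "complex_gaussian_matrix M n m X \<longleftrightarrow>
     prob_space M \<and>
     (\<forall>w\<in>space M. X w \<in> carrier_mat n m) \<and>
     prob_space.indep_vars M (\<lambda>_. borel) (\<lambda>(i, j) w. X w $$ (i, j)) ({..<n} \<times> {..<m}) \<and>
     (\<forall>i<n. \<forall>j<m. std_complex_gaussian M (\<lambda>w. X w $$ (i, j)))"

definition wishart_matrix ::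
    "'w measure \<Rightarrow> nat \<Rightarrow> nat \<Rightarrow> ('w \<Rightarrow> complex mat) \<Rightarrow> bool" where
  "wishart_matrix M n s W \<longleftrightarrow>
     (\<exists>X. complex_gaussian_matrix M n s X \<and> (\<forall>w\<in>space M. W w = X w * mat_adjoint (X w)))"

text \<open>Indices are 0-based, and $e_i \otimes f_j$ is the standard basis vector of $\mathbf C^{d^2}$
  with index $i \cdot d + j$.\<close>

definition tensor_index :: "nat \<Rightarrow> nat \<Rightarrow> nat \<Rightarrow> nat" where
  "tensor_index d i j = i * d + j"

text \<open>Row $a$ stands for $e_i \otimes e_k$ with $i = a \mathbin{div} d$, $k = a \mathbin{mod} d$, and
  column $b$ for $f_j \otimes f_l$ with $j = b \mathbin{div} d$, $l = b \mathbin{mod} d$; see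
  \<open>realign_index\<close> below.\<close>

definition realign :: "nat \<Rightarrow> 'a mat \<Rightarrow> 'a mat" where
  "realign d A = Matrix.mat (d\<^sup>2) (d\<^sup>2)
     (\<lambda>(a, b). A $$ (tensor_index d (a div d) (b div d), tensor_index d (a mod d) (b mod d)))"

lemma tensor_index_less:
  assumes "i < d" "j < d"
  shows "tensor_index d i j < d\<^sup>2"
proof -
  have "i * d + j < (i + 1) * d" using assms by simp
  also have "\<dots> \<le> d * d" using assms by (intro mult_right_mono) auto
  finally show ?thesis by (simp add: tensor_index_def power2_eq_square)
qed

lemma tensor_index_div_mod:
  assumes "j < d"
  shows "tensor_index d i j div d = i" "tensor_index d i j mod d = j"
  using assms by (simp_all add: tensor_index_def)

lemma realign_index:
  assumes "i < d" "j < d" "k < d" "l < d"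
  shows "realign d A $$ (tensor_index d i k, tensor_index d j l)
       = A $$ (tensor_index d i j, tensor_index d k l)"
  using assms by (simp add: realign_def tensor_index_less tensor_index_div_mod)

definition max_entangled_vec :: "nat \<Rightarrow> complex Matrix.vec" where
  "max_entangled_vec d = complex_of_real (1 / sqrt (real d)) \<cdot>\<^sub>v
     Matrix.vec (d\<^sup>2) (\<lambda>a. \<Sum>i<d. vec_index (unit_vec (d\<^sup>2) (tensor_index d i i)) a)"

definition max_entangled_state :: "nat \<Rightarrow> complex mat" where
  "max_entangled_state d = Matrix.mat (d\<^sup>2) (d\<^sup>2)
     (\<lambda>(a, b). vec_index (max_entangled_vec d) a * cnj (vec_index (max_entangled_vec d) b))"

text \<open>\<open>Q_matrix d s W\<close> is $Q_{d^2,s}$ for the value \<open>W\<close> of the Wishart matrix.\<close>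

definition Q_matrix :: "nat \<Rightarrow> nat \<Rightarrow> complex mat \<Rightarrow> complex mat" where
  "Q_matrix d s W = complex_of_real (1 / (real d * sqrt (real s))) \<cdot>\<^sub>m
     (realign d W - (of_nat d * of_nat s) \<cdot>\<^sub>m max_entangled_state d)"

definition mat_trace :: "'a :: comm_monoid_add mat \<Rightarrow> 'a" where
  "mat_trace A = (\<Sum>i<dim_row A. A $$ (i, i))"

text \<open>The trace below is real (\<open>Im_mat_trace_moment\<close>), so taking the real part only changes its
  type.\<close>

definition normalized_moment :: "nat \<Rightarrow> nat \<Rightarrow> complex mat \<Rightarrow> real" where
  "normalized_moment d p A = Re (mat_trace ((A * mat_adjoint A) ^\<^sub>m p)) / (real d)\<^sup>2"

lemma mat_adjoint_index:
  assumes "i < dim_col A" "j < dim_row A"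
  shows "mat_adjoint A $$ (i, j) = conjugate (A $$ (j, i))"
  using assms by (simp add: mat_adjoint_def mat_of_rows_index)

lemma dim_mat_adjoint: "dim_row (mat_adjoint A) = dim_col A" "dim_col (mat_adjoint A) = dim_row A"
  by (simp_all add: mat_adjoint_def)

lemma Im_mat_trace_moment:
  fixes A :: "complex mat"
  shows "Im (mat_trace ((A * mat_adjoint A) ^\<^sub>m p)) = 0"
proof -
  define n where "n = dim_row A"
  define H where "H = A * mat_adjoint A"
  have H: "H \<in> carrier_mat n n"
    by (rule carrier_matI) (simp_all add: H_def n_def dim_mat_adjoint)
  have herm: "cnj (H $$ (i, j)) = H $$ (j, i)" if "i < n" "j < n" for i j
    using that by (simp add: H_def n_def scalar_prod_def mat_adjoint_index dim_mat_adjoint mult.commute)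
  have P: "H ^\<^sub>m q \<in> carrier_mat n n" for q using H by (rule pow_carrier_mat)
  have comm: "H ^\<^sub>m q * H = H * H ^\<^sub>m q" for q
  proof (induction q)
    case (Suc q)
    then show ?case
      using assoc_mult_mat[OF H P[of q] H] by simp
  qed (use H in simp)
  have pow: "cnj ((H ^\<^sub>m q) $$ (i, j)) = (H ^\<^sub>m q) $$ (j, i)" if "i < n" "j < n" for i j q
    using that
  proof (induction q arbitrary: i j)
    case 0
    then show ?case using H by simp
  next
    case (Suc q)
    have "cnj ((H ^\<^sub>m q * H) $$ (i, j)) = (\<Sum>k<n. cnj ((H ^\<^sub>m q) $$ (i, k)) * cnj (H $$ (k, j)))"
      using H P[of q] Suc.prems by (simp add: scalar_prod_def atLeast0LessThan)
    also have "\<dots> = (\<Sum>k<n. H $$ (j, k) * (H ^\<^sub>m q) $$ (k, i))"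
      using Suc herm by (intro sum.cong) auto
    also have "\<dots> = (H * H ^\<^sub>m q) $$ (j, i)"
      using H P[of q] Suc.prems by (simp add: scalar_prod_def atLeast0LessThan)
    finally show ?case by (simp add: comm)
  qed
  have "cnj (mat_trace (H ^\<^sub>m p)) = mat_trace (H ^\<^sub>m p)"
    using P[of p] by (auto simp: mat_trace_def pow)
  then show ?thesis by (simp add: H_def complex_eq_iff)
qed

definition catalan :: "nat \<Rightarrow> real" where
  "catalan p = real ((2 * p) choose p) / real (p + 1)"

end

theory Submission
  imports Defs
begin

text \<open>Let \<open>G c\<close> be the \<open>d \<times> d\<close> matrix whose entry \<open>(i, j)\<close> is entry
  \<open>(i * d + j, c)\<close> of \<open>X\<close>, the \<open>c\<close>-th slice of \<open>X\<close>.  Realigning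
  turns \<open>X X\<^sup>*\<close> into the sum over \<open>c\<close> of the tensor products of \<open>G c\<close> with its entrywise
  conjugate, and \<open>d s E\<close> is the mean of this sum.  So \<open>d \<surd>s Q\<close> is a sum of \<open>s\<close> independent
  centred terms, and the moments of its singular values can be found from Wick's formula.

  Expand the \<open>N\<close>-th power of \<open>Tr ((Q Q\<^sup>*)\<^sup>p)\<close> over \<open>n = 2pN\<close> positions; \<open>N = 1\<close>
  gives the mean and \<open>N = 2\<close> the second moment.  In suitable coordinates position \<open>a\<close> carries the
  entry of \<open>G (c a)\<close> in row \<open>u a\<close> and column \<open>t a\<close>, times the conjugate of its entry in row
  \<open>u (\<rho> a)\<close> and column \<open>t (\<kappa> a)\<close>, minus the mean of this product.  Here
  \<open>\<rho>\<close> and \<open>\<kappa>\<close> are two fixed perfect matchings of the positions (\<open>row_partner\<close>,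
  \<open>col_partner\<close>).  Wick's formula pairs the entry at \<open>a\<close> with the conjugate at \<open>\<sigma> a\<close>
  for a permutation \<open>\<sigma>\<close>, and centring removes precisely the \<open>\<sigma>\<close> with a fixed point
  (\<open>gaussian_wick_centred\<close>).  With \<open>F k \<pi>\<close> for the number of \<open>k\<close>-colourings of the
  positions that are invariant under \<open>\<pi>\<close>, the expectation is therefore
  \<open>(d \<surd>s)\<^sup>-\<^sup>n\<close> times the sum over derangements \<open>\<sigma>\<close> of
  \<open>F s \<sigma> * F d (\<rho> \<circ> \<sigma>) * F d (\<kappa> \<circ> \<sigma>)\<close> (\<open>trace_moment\<close>).

  The exponents of \<open>s\<close> and of \<open>d\<close> are maximal separately, which is why the two limits do not
  compete.  A derangement has at most \<open>n/2\<close> cycles, so \<open>F s \<sigma>\<close> is at most \<open>s\<close> to the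
  power \<open>n/2\<close>, and a factor \<open>s\<close> is lost unless \<open>\<sigma>\<close> is an involution.  The other two
  factors count colourings of the vertices of the surface that \<open>\<sigma>\<close> glues from \<open>2N\<close>
  polygons, namely the two tensor legs of each trace; by Euler's bound their product is at most
  \<open>d\<close> to the power \<open>n + 2N\<close>.  A factor \<open>d\<close> is lost if an involution \<open>\<sigma>\<close> joins
  different polygons or has two crossing pairs in one polygon.  The bounds in \<open>d\<close> come from comparing
  numbers of invariant colourings before and after multiplication by a transposition.

  What remains are the noncrossing perfect matchings of each block of \<open>2p\<close> positions.  Their number
  satisfies the Catalan recursion, and for \<open>N = 1\<close> each of them attains both maxima
  (\<open>gluing_weight_nc_matching\<close>).  Hence the mean differs from the Catalan number by
  \<open>O(1 / min d s)\<close>, and the second moment exceeds its square by at most \<open>O(1 / min d s)\<close>;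
  since variances are nonnegative, the variance tends to \<open>0\<close>.\<close>

section \<open>Colourings invariant under a permutation\<close>

text \<open>The number of these colourings is \<open>d\<close> to the number of cycles of \<open>\<pi>\<close> on \<open>H\<close>.  Cycle
  counts enter only through this number, so that sums over indices need no translation.\<close>

definition invariant_colourings :: "'a set \<Rightarrow> nat \<Rightarrow> ('a \<Rightarrow> 'a) \<Rightarrow> ('a \<Rightarrow> nat) set" where
  "invariant_colourings H d \<pi> = {v \<in> H \<rightarrow>\<^sub>E {..<d}. \<forall>x\<in>H. v (\<pi> x) = v x}"

lemma finite_invariant_colourings:
  assumes "finite H"
  shows "finite (invariant_colourings H d \<pi>)"
  using assms unfolding invariant_colourings_def by (simp add: finite_PiE)

text \<open>Rotating the colours on a union \<open>S\<close> of cycles preserves invariance.  This is how colourings for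
  \<open>\<pi>\<close> and for \<open>\<pi>\<close> times a transposition are compared.\<close>

definition shift_on :: "'a set \<Rightarrow> nat \<Rightarrow> nat \<Rightarrow> ('a \<Rightarrow> nat) \<Rightarrow> 'a \<Rightarrow> nat" where
  "shift_on S d k v = (\<lambda>x. if x \<in> S then (v x + k) mod d else v x)"

lemma shift_on_invariant:
  assumes "v \<in> invariant_colourings H d \<pi>" "S \<subseteq> H" "\<And>x. x \<in> H \<Longrightarrow> \<pi> x \<in> S \<longleftrightarrow> x \<in> S" "d \<ge> 1"
  shows "shift_on S d k v \<in> invariant_colourings H d \<pi>"
  using assms by (auto simp: invariant_colourings_def shift_on_def PiE_def extensional_def Pi_def subset_iff)

lemma add_mod_cancel:
  fixes x y k d :: nat
  assumes "x < d" "y < d" "(x + k) mod d = (y + k) mod d"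
  shows "x = y"
proof -
  have "(int x + int k) mod int d = (int y + int k) mod int d"
    using assms(3) by (metis of_nat_add of_nat_mod)
  hence "int d dvd (int x + int k) - (int y + int k)"
    by (simp only: mod_eq_dvd_iff)
  hence "int d dvd int x - int y" by simp
  thus ?thesis using assms(1,2)
    by (metis mod_eq_dvd_iff mod_less nat_int_comparison(1) of_nat_mod)
qed

lemma shift_on_cancel:
  assumes "v \<in> H \<rightarrow>\<^sub>E {..<d}" "v' \<in> H \<rightarrow>\<^sub>E {..<d}" "S \<subseteq> H" "shift_on S d k v = shift_on S d k v'"
  shows "v = v'"
proof
  fix x
  have *: "shift_on S d k v x = shift_on S d k v' x" using assms(4) by simp
  show "v x = v' x"
  proof (cases "x \<in> S")
    case True
    hence "v x < d" "v' x < d" using assms(1-3) by auto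
    then show ?thesis using * True add_mod_cancel by (auto simp: shift_on_def)
  next
    case False
    then show ?thesis using * by (simp add: shift_on_def)
  qed
qed

lemma invariant_colourings_transpose_eq:
  assumes "a \<in> H" "b \<in> H" "v a = v b"
  shows "v \<in> invariant_colourings H d (\<pi> \<circ> Transposition.transpose a b) \<longleftrightarrow> v \<in> invariant_colourings H d \<pi>"
proof -
  let ?t = "Transposition.transpose a b"
  have vt: "v (?t x) = v x" for x using assms(3) by (cases "x = a"; cases "x = b") simp_all
  have tH: "?t x \<in> H" if "x \<in> H" for x
    using that assms(1,2) by (cases "x = a"; cases "x = b") simp_all
  have "(\<forall>x\<in>H. v (\<pi> (?t x)) = v x) \<longleftrightarrow> (\<forall>x\<in>H. v (\<pi> x) = v x)"
  proof (intro iffI ballI)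
    fix x assume L: "\<forall>x\<in>H. v (\<pi> (?t x)) = v x" and "x \<in> H"
    show "v (\<pi> x) = v x" using bspec[OF L tH[OF \<open>x \<in> H\<close>]] vt[of x] by simp
  next
    fix x assume R: "\<forall>x\<in>H. v (\<pi> x) = v x" and "x \<in> H"
    show "v (\<pi> (?t x)) = v x" using bspec[OF R tH[OF \<open>x \<in> H\<close>]] vt[of x] by simp
  qed
  then show ?thesis by (simp add: invariant_colourings_def)
qed

text \<open>A transposition changes the number of cycles by at most one.  If some invariant colouring separates \<open>a\<close> from
  \<open>b\<close>, its level set through \<open>a\<close> is a union of cycles; rotating the colours there makes
  \<open>a\<close> and \<open>b\<close> agree, and only the amount of the rotation is lost.\<close>

lemma card_invariant_colourings_transpose_le:
  assumes H: "finite H" and ab: "a \<in> H" "b \<in> H" and d: "d \<ge> 1" and \<pi>: "\<pi> permutes H"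
  shows "card (invariant_colourings H d \<pi>) \<le> d * card (invariant_colourings H d (\<pi> \<circ> Transposition.transpose a b))"
proof (cases "\<forall>v\<in>invariant_colourings H d \<pi>. v a = v b")
  case True
  then have "invariant_colourings H d \<pi> \<subseteq> invariant_colourings H d (\<pi> \<circ> Transposition.transpose a b)"
    using invariant_colourings_transpose_eq[OF ab] by blast
  then have "card (invariant_colourings H d \<pi>) \<le> card (invariant_colourings H d (\<pi> \<circ> Transposition.transpose a b))"
    by (intro card_mono finite_invariant_colourings H)
  also have "\<dots> \<le> d * \<dots>" using d by simp
  finally show ?thesis .
next
  case False
  then obtain v0 where v0: "v0 \<in> invariant_colourings H d \<pi>" "v0 a \<noteq> v0 b" by blast
  define S where "S = {x\<in>H. v0 x = v0 a}"
  have S: "S \<subseteq> H" "a \<in> S" "b \<notin> S" using ab v0(2) by (auto simp: S_def)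
  have inv: "\<pi> x \<in> S \<longleftrightarrow> x \<in> S" if "x \<in> H" for x
    using that v0(1) \<pi> by (auto simp: S_def invariant_colourings_def permutes_in_image)
  \<comment> \<open>the rotation that takes the colour of \<open>a\<close> to that of \<open>b\<close>; adding \<open>d\<close> keeps it a natural number\<close>
  define k where "k v = (v b + (d - v a)) mod d" for v :: "'a \<Rightarrow> nat"
  define f where "f v = (shift_on S d (k v) v, k v)" for v
  have "inj_on f (invariant_colourings H d \<pi>)"
  proof (rule inj_onI)
    fix v v' assume "v \<in> invariant_colourings H d \<pi>" "v' \<in> invariant_colourings H d \<pi>" "f v = f v'"
    then show "v = v'" using shift_on_cancel[OF _ _ S(1), of v d v' "k v"]
      by (auto simp: f_def invariant_colourings_def)
  qed
  moreover have "f ` invariant_colourings H d \<pi> \<subseteq> invariant_colourings H d (\<pi> \<circ> Transposition.transpose a b) \<times> {..<d}"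
  proof
    fix y assume "y \<in> f ` invariant_colourings H d \<pi>"
    then obtain v where v: "v \<in> invariant_colourings H d \<pi>" "y = f v" by blast
    let ?w = "shift_on S d (k v) v"
    have vd: "v a < d" "v b < d" using v(1) ab by (auto simp: invariant_colourings_def)
    have w: "?w \<in> invariant_colourings H d \<pi>" by (rule shift_on_invariant[OF v(1) S(1) inv d])
    have "?w a = (v a + k v) mod d" using S by (simp add: shift_on_def)
    also have "\<dots> = (v b + d) mod d" unfolding k_def using vd by (simp add: mod_add_right_eq)
    also have "\<dots> = ?w b" using S vd by (simp add: shift_on_def)
    finally have "?w \<in> invariant_colourings H d (\<pi> \<circ> Transposition.transpose a b)"
      using invariant_colourings_transpose_eq[OF ab] w by blast
    then show "y \<in> invariant_colourings H d (\<pi> \<circ> Transposition.transpose a b) \<times> {..<d}"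
      using v d by (simp add: f_def k_def)
  qed
  ultimately have "card (invariant_colourings H d \<pi>) \<le>
      card (invariant_colourings H d (\<pi> \<circ> Transposition.transpose a b) \<times> {..<d})"
    by (intro card_inj_on_le finite_cartesian_product finite_invariant_colourings H finite_lessThan)
  then show ?thesis by (simp add: card_cartesian_product mult.commute)
qed

text \<open>If an invariant set separates \<open>a\<close> from \<open>b\<close>, the transposition merges their cycles.  Indeed
  \<open>\<pi>\<close> permutes \<open>S\<close>, so the colours summed over \<open>S\<close> before and after \<open>\<pi>\<close>
  agree; all summands but the one at \<open>a\<close> cancel and leave \<open>v a = v b\<close>.\<close>

lemma card_invariant_colourings_merge:
  assumes H: "finite H" and \<pi>: "\<pi> permutes H" and S: "S \<subseteq> H" "\<pi> ` S \<subseteq> S"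
    and ab: "a \<in> S" "b \<in> H" "b \<notin> S" and d: "d \<ge> 1"
  shows "d * card (invariant_colourings H d (\<pi> \<circ> Transposition.transpose a b)) \<le> card (invariant_colourings H d \<pi>)"
proof -
  let ?t = "Transposition.transpose a b"
  have a: "a \<in> H" using ab S by blast
  have finS: "finite S" using H S finite_subset by blast
  have inj: "inj \<pi>" using \<pi> by (rule permutes_inj)
  have SS: "\<pi> ` S = S"
    by (rule endo_inj_surj[OF finS S(2)]) (use inj in \<open>auto intro: inj_on_subset\<close>)
  have inv: "\<pi> x \<in> S \<longleftrightarrow> x \<in> S" for x
    using inj_image_mem_iff[OF inj, of x S] by (simp add: SS)
  have eq: "v a = v b" if v: "v \<in> invariant_colourings H d (\<pi> \<circ> ?t)" for v
  proof -
    have v': "v (\<pi> x) = v x" if "x \<in> S" "x \<noteq> a" for x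
    proof -
      have "x \<in> H" "x \<noteq> b" using that ab S by auto
      then show ?thesis using v that(2) by (auto simp: invariant_colourings_def dest: bspec[of _ _ x])
    qed
    have va: "v (\<pi> a) = v b" 
      using v ab by (auto simp: invariant_colourings_def dest: bspec[of _ _ b])
    have "(\<Sum>x\<in>S. v (\<pi> x)) = (\<Sum>x\<in>\<pi> ` S. v x)"
      using inj by (subst sum.reindex) (auto intro: inj_on_subset)
    then have "(\<Sum>x\<in>S. v (\<pi> x)) = (\<Sum>x\<in>S. v x)" by (simp add: SS)
    then have "v (\<pi> a) + (\<Sum>x\<in>S-{a}. v (\<pi> x)) = v a + (\<Sum>x\<in>S-{a}. v x)"
      using finS ab by (simp add: sum.remove)
    moreover have "(\<Sum>x\<in>S-{a}. v (\<pi> x)) = (\<Sum>x\<in>S-{a}. v x)"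
      using v' by (intro sum.cong) auto
    ultimately show ?thesis using va by simp
  qed
  define f where "f = (\<lambda>(v, k). shift_on S d k v)"
  have "inj_on f (invariant_colourings H d (\<pi> \<circ> ?t) \<times> {..<d})"
  proof (rule inj_onI, clarify)
    fix v k v' k'
    assume v: "v \<in> invariant_colourings H d (\<pi> \<circ> ?t)" and v': "v' \<in> invariant_colourings H d (\<pi> \<circ> ?t)"
      and k: "k < d" "k' < d" and "f (v, k) = f (v', k')"
    then have f: "shift_on S d k v = shift_on S d k' v'" by (simp add: f_def)
    have "v b = v' b" using fun_cong[OF f, of b] ab by (simp add: shift_on_def)
    then have va: "v a = v' a" using eq[OF v] eq[OF v'] by simp
    have "(v a + k) mod d = (v' a + k') mod d" using fun_cong[OF f, of a] ab by (simp add: shift_on_def)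
    then have "k = k'" using add_mod_cancel[OF k, of "v a"] va by (simp add: add.commute)
    moreover then have "v = v'" 
      using shift_on_cancel[OF _ _ S(1), of v d v' k] v v' f by (auto simp: invariant_colourings_def)
    ultimately show "v = v' \<and> k = k'" by simp
  qed
  moreover have "f ` (invariant_colourings H d (\<pi> \<circ> ?t) \<times> {..<d}) \<subseteq> invariant_colourings H d \<pi>"
  proof clarify
    fix v k assume v: "v \<in> invariant_colourings H d (\<pi> \<circ> ?t)"
    then have "v \<in> invariant_colourings H d \<pi>"
      using invariant_colourings_transpose_eq[of a H b v d \<pi>] a ab eq by blast
    then show "f (v, k) \<in> invariant_colourings H d \<pi>"
      unfolding f_def using shift_on_invariant[OF _ S(1) inv d] by simp
  qed
  ultimately have "card (invariant_colourings H d (\<pi> \<circ> ?t) \<times> {..<d}) \<le> card (invariant_colourings H d \<pi>)"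
    by (intro card_inj_on_le finite_invariant_colourings H)
  then show ?thesis by (simp add: card_cartesian_product mult.commute)
qed

definition drop_pair :: "('a \<Rightarrow> 'a) \<Rightarrow> 'a \<Rightarrow> 'a \<Rightarrow> 'a" where
  "drop_pair \<tau> h = (\<lambda>x. if x = h \<or> x = \<tau> h then x else \<tau> x)"

lemma drop_pair:
  assumes "\<tau> permutes H" "\<And>x. \<tau> (\<tau> x) = x" "\<tau> h \<noteq> h" "finite H"
  shows "drop_pair \<tau> h permutes H" "drop_pair \<tau> h (drop_pair \<tau> h x) = x"
    "Transposition.transpose h (\<tau> h) \<circ> drop_pair \<tau> h = \<tau>" "drop_pair \<tau> h \<circ> Transposition.transpose h (\<tau> h) = \<tau>"
    "card {x. drop_pair \<tau> h x \<noteq> x} = card {x. \<tau> x \<noteq> x} - 2" "h \<in> H" "\<tau> h \<in> H"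
proof -
  let ?t = "Transposition.transpose h (\<tau> h)"
  show aH: "h \<in> H" "\<tau> h \<in> H" using assms by (metis permutes_not_in, metis permutes_in_image permutes_not_in)
  have tau_eq: "\<tau> x = h \<longleftrightarrow> x = \<tau> h" "\<tau> x = \<tau> h \<longleftrightarrow> x = h" for x
    using assms(2) by metis+
  have t: "\<tau> \<circ> ?t = drop_pair \<tau> h"
    using assms(2) by (auto simp: drop_pair_def transpose_def fun_eq_iff)
  show "drop_pair \<tau> h permutes H" unfolding t[symmetric]
    by (intro permutes_compose permutes_swap_id aH assms)
  show "drop_pair \<tau> h (drop_pair \<tau> h x) = x"
    using assms(2) by (auto simp: drop_pair_def tau_eq)
  show "drop_pair \<tau> h \<circ> ?t = \<tau>" unfolding t[symmetric] comp_assoc by simp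
  show "?t \<circ> drop_pair \<tau> h = \<tau>"
  proof
    fix x show "(?t \<circ> drop_pair \<tau> h) x = \<tau> x"
      using assms(2) by (cases "x = h"; cases "x = \<tau> h") (auto simp: drop_pair_def tau_eq transpose_def)
  qed
  have fin: "finite {x. \<tau> x \<noteq> x}"
    using finite_subset[OF _ assms(4)] assms(1)
    by (metis (mono_tags, lifting) mem_Collect_eq permutes_not_in subsetI)
  have "{x. drop_pair \<tau> h x \<noteq> x} = {x. \<tau> x \<noteq> x} - {h, \<tau> h}" by (auto simp: drop_pair_def)
  moreover have "{h, \<tau> h} \<subseteq> {x. \<tau> x \<noteq> x}" using assms(2,3) by auto
  ultimately show "card {x. drop_pair \<tau> h x \<noteq> x} = card {x. \<tau> x \<noteq> x} - 2"
    using assms(3) fin by (simp add: card_Diff_subset)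
qed

text \<open>An involution moving at most \<open>2 * m\<close> points is a product of at most \<open>m\<close> transpositions.\<close>

lemma card_invariant_colourings_involution_le:
  assumes "finite H" "d \<ge> 1" "\<phi> permutes H" "\<tau> permutes H" "\<And>x. \<tau> (\<tau> x) = x"
    and "card {x. \<tau> x \<noteq> x} \<le> 2 * m"
  shows "card (invariant_colourings H d (\<phi> \<circ> \<tau>)) \<le> d ^ m * card (invariant_colourings H d \<phi>)"
  using assms(4-)
proof (induction m arbitrary: \<tau>)
  case 0
  have "finite {x. \<tau> x \<noteq> x}"
    using finite_subset[OF _ assms(1)] 0(1) by (metis (mono_tags, lifting) mem_Collect_eq permutes_not_in subsetI)
  then have "\<tau> = id" using 0 by auto
  then show ?case by simp
next
  case (Suc m)
  show ?case
  proof (cases "\<tau> = id")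
    case True
    have "1 \<le> d ^ Suc m" using assms(2) by simp
    then show ?thesis using True by simp
  next
    case False
    then obtain a where a: "\<tau> a \<noteq> a" by (auto simp: fun_eq_iff)
    let ?t = "Transposition.transpose a (\<tau> a)" and ?\<tau>' = "drop_pair \<tau> a"
    note \<tau>' = drop_pair[OF Suc(2,3) a assms(1)]
    have "card {x. ?\<tau>' x \<noteq> x} \<le> 2 * m" using Suc(4) \<tau>'(5) by simp
    note IH = Suc.IH[OF \<tau>'(1,2) this]
    have "\<phi> \<circ> \<tau> \<circ> ?t = \<phi> \<circ> (?\<tau>' \<circ> ?t) \<circ> ?t" by (simp only: \<tau>'(4))
    also have "\<dots> = \<phi> \<circ> ?\<tau>'" by (simp add: comp_assoc)
    finally have "card (invariant_colourings H d (\<phi> \<circ> \<tau>)) \<le> d * card (invariant_colourings H d (\<phi> \<circ> ?\<tau>'))"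
      using card_invariant_colourings_transpose_le[OF assms(1) \<tau>'(6,7) assms(2), of "\<phi> \<circ> \<tau>"]
        permutes_compose[OF Suc(2) assms(3)] by simp
    also have "\<dots> \<le> d * (d ^ m * card (invariant_colourings H d \<phi>))" by (intro mult_left_mono IH) simp
    finally show ?thesis by (simp only: power_Suc mult.assoc)
  qed
qed

lemma card_invariant_colourings_le_determining:
  assumes "finite R" "\<And>v v'. v \<in> invariant_colourings A k \<sigma> \<Longrightarrow> v' \<in> invariant_colourings A k \<sigma> \<Longrightarrow>
      (\<forall>x\<in>R. v x = v' x) \<Longrightarrow> v = v'" "R \<subseteq> A"
  shows "card (invariant_colourings A k \<sigma>) \<le> k ^ card R"
proof -
  have "inj_on (\<lambda>v. restrict v R) (invariant_colourings A k \<sigma>)"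
    by (rule inj_onI) (metis assms(2) restrict_apply')
  moreover have "(\<lambda>v. restrict v R) ` invariant_colourings A k \<sigma> \<subseteq> R \<rightarrow>\<^sub>E {..<k}"
    using assms(3) by (auto simp: invariant_colourings_def)
  ultimately have "card (invariant_colourings A k \<sigma>) \<le> card (R \<rightarrow>\<^sub>E {..<k})"
    using assms(1) by (intro card_inj_on_le) (auto simp: finite_PiE)
  then show ?thesis using assms(1) by (simp add: card_PiE)
qed

text \<open>\<open>R\<close> plays the role of a set of representatives of the cycles: it is a smallest set of points whose
  colours determine an invariant colouring.  Minimality makes \<open>R\<close> and \<open>\<sigma> ` R\<close> disjoint.  If
  they fill \<open>A\<close>, then \<open>\<sigma> \<circ> \<sigma>\<close> maps \<open>R\<close> into itself, and by minimality again it
  fixes \<open>R\<close> pointwise.\<close>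

lemma card_invariant_colourings_derangement_le:
  assumes A: "finite A" and \<sigma>: "\<sigma> permutes A" and ne: "\<And>a. a \<in> A \<Longrightarrow> \<sigma> a \<noteq> a"
  obtains R where "R \<subseteq> A" "2 * card R \<le> card A" "card (invariant_colourings A k \<sigma>) \<le> k ^ card R"
    "2 * card R = card A \<Longrightarrow> \<forall>a\<in>A. \<sigma> (\<sigma> a) = a"
proof -
  define det where "det R \<longleftrightarrow> R \<subseteq> A \<and> (\<forall>v\<in>invariant_colourings A k \<sigma>. \<forall>v'\<in>invariant_colourings A k \<sigma>.
      (\<forall>x\<in>R. v x = v' x) \<longrightarrow> v = v')" for R
  have "det A"
    unfolding det_def
  proof (intro conjI ballI impI)
    fix v v' assume "v \<in> invariant_colourings A k \<sigma>" "v' \<in> invariant_colourings A k \<sigma>" "\<forall>x\<in>A. v x = v' x"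
    then show "v = v'"
      by (intro PiE_ext[of v A "\<lambda>_. {..<k}"]) (auto simp: invariant_colourings_def)
  qed simp
  then obtain R where R: "det R" and minR: "\<And>R'. det R' \<Longrightarrow> card R \<le> card R'"
    using arg_min_natI[of det A card] arg_min_nat_le[of det _ card] by metis
  have RA: "R \<subseteq> A" using R by (simp add: det_def)
  have finR: "finite R" using RA A finite_subset by blast
  have img: "\<sigma> x \<in> A" if "x \<in> A" for x using that \<sigma> by (simp add: permutes_in_image)
  \<comment> \<open>a point of \<open>R\<close> whose colour is always that of another point of \<open>R\<close> would be superfluous\<close>
  have drop: "y = x" if x: "x \<in> R" and y: "y \<in> R"
    and eq: "\<And>v. v \<in> invariant_colourings A k \<sigma> \<Longrightarrow> v y = v x" for x y
  proof (rule ccontr)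
    assume "y \<noteq> x"
    have "det (R - {y})" unfolding det_def
    proof (intro conjI ballI impI)
      fix v v' assume v: "v \<in> invariant_colourings A k \<sigma>" "v' \<in> invariant_colourings A k \<sigma>"
        and "\<forall>x\<in>R - {y}. v x = v' x"
      then have "\<forall>x\<in>R. v x = v' x" using eq[OF v(1)] eq[OF v(2)] x \<open>y \<noteq> x\<close> by (metis Diff_iff singletonD)
      then show "v = v'" using R v by (simp add: det_def)
    qed (use RA in auto)
    then have "card R \<le> card (R - {y})" by (rule minR)
    then show False using y finR by (meson card_Diff1_less not_le)
  qed
  have inv1: "v (\<sigma> x) = v x" if "v \<in> invariant_colourings A k \<sigma>" "x \<in> A" for v x
    using that by (simp add: invariant_colourings_def)
  have disj: "R \<inter> \<sigma> ` R = {}"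
  proof (rule ccontr)
    assume "R \<inter> \<sigma> ` R \<noteq> {}"
    then obtain x where x: "x \<in> R" "\<sigma> x \<in> R" by blast
    then have "\<sigma> x = x" using drop[of x "\<sigma> x"] inv1 RA by blast
    then show False using ne x RA by blast
  qed
  have cardim: "card (\<sigma> ` R) = card R" using \<sigma> permutes_inj_on card_image by blast
  have sub: "R \<union> \<sigma> ` R \<subseteq> A" using RA img by auto
  have cu: "card (R \<union> \<sigma> ` R) = 2 * card R"
    using card_Un_disjoint[OF finR _ disj] finR cardim by simp
  have le: "2 * card R \<le> card A" using card_mono[OF A sub] cu by simp
  have "\<sigma> (\<sigma> a) = a" if full: "2 * card R = card A" and a: "a \<in> A" for a
  proof -
    have un: "R \<union> \<sigma> ` R = A" using card_subset_eq[OF A sub] full cu by simp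
    have RR: "\<sigma> (\<sigma> x) = x" if x: "x \<in> R" for x
    proof -
      have "\<sigma> (\<sigma> x) \<notin> \<sigma> ` R"
      proof
        assume "\<sigma> (\<sigma> x) \<in> \<sigma> ` R"
        then have "\<sigma> x \<in> R" using permutes_inj[OF \<sigma>] by (meson inj_image_mem_iff)
        then show False using disj x by blast
      qed
      then have "\<sigma> (\<sigma> x) \<in> R" using un img x RA by blast
      then show ?thesis using drop[of x "\<sigma> (\<sigma> x)"] inv1 img x RA by (metis subsetD)
    qed
    have "a \<in> R \<union> \<sigma> ` R" using a un by simp
    then show ?thesis using RR by auto
  qed
  moreover have "card (invariant_colourings A k \<sigma>) \<le> k ^ card R"
    using R RA finR by (intro card_invariant_colourings_le_determining) (auto simp: det_def)
  ultimately show thesis using le RA by (intro that[of R]) simp_all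
qed

section \<open>Positions of a product of traces\<close>

text \<open>The \<open>N\<close> traces occupy consecutive blocks of \<open>2 * p\<close> positions, with \<open>Q\<close> at the even and
  \<open>Q\<^sup>*\<close> at the odd ones.  Neighbouring factors share a pair of summation indices.  Each component
  of the pair belongs to the unconjugated entry of one neighbour and to the conjugated entry of the
  other.  Rows are shared across the boundaries after odd positions, columns across those after even
  positions.\<close>

definition row_partner :: "nat \<Rightarrow> nat \<Rightarrow> nat" where
  "row_partner p a = (if even a then (if a mod (2*p) = 0 then a + (2*p - 1) else a - 1)
                else (if a mod (2*p) = 2*p - 1 then a - (2*p - 1) else Suc a))"

definition col_partner :: "nat \<Rightarrow> nat" where
  "col_partner a = (if even a then Suc a else a - 1)"

definition cyclic_next :: "nat \<Rightarrow> nat \<Rightarrow> nat" where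
  "cyclic_next p a = (if even a then col_partner a else row_partner p a)"

lemma row_partner_block:
  assumes "r < 2 * p"
  shows "row_partner p (q * (2*p) + r) = q * (2*p) +
    (if even r then (if r = 0 then 2*p - 1 else r - 1) else (if r = 2*p - 1 then 0 else Suc r))"
proof -
  have "(q * (2*p) + r) mod (2*p) = r" using assms by simp
  moreover have "even (q * (2*p) + r) \<longleftrightarrow> even r" by simp
  moreover have "r \<noteq> 0" if "odd r" using that by (cases r) auto
  ultimately show ?thesis using assms unfolding row_partner_def by auto
qed

lemma col_partner_block:
  assumes "r < 2 * p"
  shows "col_partner (q * (2*p) + r) = q * (2*p) + (if even r then Suc r else r - 1)"
proof -
  have "r \<noteq> 0" if "odd r" using that by (cases r) auto
  then show ?thesis unfolding col_partner_def by auto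
qed

lemma block_cases:
  fixes a p :: nat
  assumes "p \<ge> 1"
  obtains q r where "a = q * (2*p) + r" "r < 2*p" "a div (2*p) = q" "even a \<longleftrightarrow> even r"
proof (rule that[of "a div (2*p)" "a mod (2*p)"])
  show "even a \<longleftrightarrow> even (a mod (2*p))" by (simp add: dvd_mod_iff)
  show "a = a div (2*p) * (2*p) + a mod (2*p)" by (rule div_mult_mod_eq[symmetric])
qed (use assms in auto)

lemma partner_properties:
  assumes "p \<ge> 1"
  shows "row_partner p (row_partner p a) = a" "row_partner p a div (2*p) = a div (2*p)" "even (row_partner p a) \<longleftrightarrow> odd a"
    "col_partner (col_partner a) = a" "col_partner a div (2*p) = a div (2*p)" "even (col_partner a) \<longleftrightarrow> odd a"
proof -
  obtain q r where a: "a = q * (2*p) + r" "r < 2*p" "a div (2*p) = q" "even a \<longleftrightarrow> even r"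
    using block_cases[OF assms] .
  define r' where "r' = (if even r then (if r = 0 then 2*p - 1 else r - 1) else (if r = 2*p - 1 then 0 else Suc r))"
  define r'' where "r'' = (if even r then Suc r else r - 1)"
  have r0: "r \<noteq> 0" if "odd r" using that by (cases r) auto
  have r': "r' < 2*p" "even r' \<longleftrightarrow> odd r" using a(2) r0 assms by (auto simp: r'_def)
  have "Suc r \<noteq> 2*p" if "even r" using that by (metis even_Suc dvd_triv_left)
  then have r'': "r'' < 2*p" "even r'' \<longleftrightarrow> odd r" using a(2) r0 by (auto simp: r''_def)
  have al: "row_partner p a = q * (2*p) + r'" unfolding a(1) r'_def by (rule row_partner_block[OF a(2)])
  have be: "col_partner a = q * (2*p) + r''" unfolding a(1) r''_def by (rule col_partner_block[OF a(2)])
  show "even (row_partner p a) \<longleftrightarrow> odd a" "even (col_partner a) \<longleftrightarrow> odd a" using al be r' r'' a(4) by simp_all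
  show "row_partner p a div (2*p) = a div (2*p)" "col_partner a div (2*p) = a div (2*p)"
    using al be r' r'' a(3) by simp_all
  have "row_partner p (row_partner p a) = q * (2*p) +
     (if even r' then (if r' = 0 then 2*p - 1 else r' - 1) else (if r' = 2*p - 1 then 0 else Suc r'))"
    unfolding al by (rule row_partner_block[OF r'(1)])
  also have "\<dots> = a" using a(1,2) r' r0 by (auto simp: r'_def)
  finally show "row_partner p (row_partner p a) = a" .
  have "col_partner (col_partner a) = q * (2*p) + (if even r'' then Suc r'' else r'' - 1)"
    unfolding be by (rule col_partner_block[OF r''(1)])
  also have "\<dots> = a" using a(1,2) r'' r0 by (auto simp: r''_def)
  finally show "col_partner (col_partner a) = a" .
qed

lemma block_lt_iff:
  fixes a p N :: nat
  assumes "p \<ge> 1"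
  shows "a < 2*p*N \<longleftrightarrow> a div (2*p) < N"
  using assms by (simp add: div_less_iff_less_mult mult.commute)

lemma row_partner_less: "p \<ge> 1 \<Longrightarrow> row_partner p a < 2*p*N \<longleftrightarrow> a < 2*p*N"
  and col_partner_less: "p \<ge> 1 \<Longrightarrow> col_partner a < 2*p*N \<longleftrightarrow> a < 2*p*N"
  by (simp_all add: block_lt_iff partner_properties)

lemma involution_permutes:
  assumes "\<And>x. f (f x) = x" "\<And>x. x \<notin> A \<Longrightarrow> f x = x"
  shows "f permutes A"
  unfolding permutes_def using assms by metis

abbreviation card_row_col :: "nat \<Rightarrow> nat \<Rightarrow> nat \<Rightarrow> (nat \<Rightarrow> nat) \<Rightarrow> nat" where
  "card_row_col p N d \<sigma> \<equiv> card (invariant_colourings {..<2*p*N} d (row_partner p \<circ> \<sigma>)) *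
     card (invariant_colourings {..<2*p*N} d (col_partner \<circ> \<sigma>))"

section \<open>Gluing the legs of the traces\<close>

text \<open>Position \<open>a\<close> contributes the half edge \<open>(True, a)\<close> for its unconjugated entry and
  \<open>(False, a)\<close> for its conjugated one.  The cycles of \<open>boundary\<close> are the tensor legs of the
  traces: the first leg runs forwards through the \<open>(even a, a)\<close>, the second backwards through the
  \<open>(odd a, a)\<close>.  The involution \<open>gluing\<close> is the Wick pairing, and the cycles of
  \<open>boundary \<circ> gluing\<close> are the vertices of the glued surface.\<close>

definition half_edges :: "nat \<Rightarrow> nat \<Rightarrow> (bool \<times> nat) set" where
  "half_edges p N = UNIV \<times> {..<2*p*N}"

definition boundary :: "nat \<Rightarrow> nat \<Rightarrow> bool \<times> nat \<Rightarrow> bool \<times> nat" where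
  "boundary p N = (\<lambda>(b, a). if a < 2*p*N then (\<not> b, if b then col_partner a else row_partner p a) else (b, a))"

definition gluing :: "nat \<Rightarrow> nat \<Rightarrow> (nat \<Rightarrow> nat) \<Rightarrow> bool \<times> nat \<Rightarrow> bool \<times> nat" where
  "gluing p N \<sigma> = (\<lambda>(b, a). if a < 2*p*N then (\<not> b, if b then \<sigma> a else inv_into UNIV \<sigma> a) else (b, a))"

lemma finite_half_edges: "finite (half_edges p N)"
  by (simp add: half_edges_def)

lemma card_half_edges: "card (half_edges p N) = 2 * (2*p*N)"
  by (simp add: half_edges_def card_cartesian_product)

lemma boundary_permutes:
  assumes "p \<ge> 1"
  shows "boundary p N permutes half_edges p N"
proof -
  define g where "g = (\<lambda>(b, a). if a < 2*p*N then (\<not> b, if b then row_partner p a else col_partner a) else (b, a))"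
  have "boundary p N (g x) = x" "g (boundary p N x) = x" for x
    using assms by (cases x; simp add: boundary_def g_def row_partner_less col_partner_less partner_properties)+
  then have "\<exists>!x. boundary p N x = y" for y by metis
  moreover have "boundary p N x = x" if "x \<notin> half_edges p N" for x
    using that by (cases x) (auto simp: boundary_def half_edges_def)
  ultimately show ?thesis unfolding permutes_def by blast
qed

lemma gluing_properties:
  assumes "\<sigma> permutes {..<2*p*N}"
  shows "gluing p N \<sigma> permutes half_edges p N" "gluing p N \<sigma> (gluing p N \<sigma> x) = x"
    "gluing p N \<sigma> (b, a) \<noteq> (b, a) \<longleftrightarrow> (b, a) \<in> half_edges p N"
    "card {x. gluing p N \<sigma> x \<noteq> x} = 2 * (2*p*N)"
proof -
  have s: "\<sigma> a < 2*p*N \<longleftrightarrow> a < 2*p*N" "inv_into UNIV \<sigma> a < 2*p*N \<longleftrightarrow> a < 2*p*N" for a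
    using permutes_in_image[OF assms] permutes_in_image[OF permutes_inv[OF assms]] by simp_all
  show inv: "gluing p N \<sigma> (gluing p N \<sigma> x) = x" for x
    using permutes_inverses[OF assms] by (cases x) (simp add: gluing_def s)
  show ne: "gluing p N \<sigma> (b, a) \<noteq> (b, a) \<longleftrightarrow> (b, a) \<in> half_edges p N" for a b
    by (auto simp: gluing_def half_edges_def)
  show "gluing p N \<sigma> permutes half_edges p N"
    by (rule involution_permutes) (use inv ne in auto)
  have "{x. gluing p N \<sigma> x \<noteq> x} = half_edges p N" using ne by auto
  then show "card {x. gluing p N \<sigma> x \<noteq> x} = 2 * (2*p*N)" by (simp add: card_half_edges)
qed

text \<open>On \<open>(True, a)\<close> and \<open>(False, a)\<close> the map \<open>boundary \<circ> gluing\<close> acts as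
  \<open>row_partner \<circ> \<sigma>\<close> and \<open>col_partner \<circ> inv \<sigma>\<close>.  Reading the column colours at the
  partner turns invariance under the latter into invariance under \<open>col_partner \<circ> \<sigma>\<close>.\<close>

lemma card_row_col_le_gluing:
  assumes p: "p \<ge> 1" and \<sigma>: "\<sigma> permutes {..<2*p*N}"
  shows "card_row_col p N d \<sigma>
    \<le> card (invariant_colourings (half_edges p N) d (boundary p N \<circ> gluing p N \<sigma>))"
proof -
  let ?A = "{..<2*p*N}"
  define f where "f = (\<lambda>(u, t) (b, a). if a < 2*p*N then (if b then u a else t (col_partner a)) else undefined :: nat)"
  have s: "\<sigma> a < 2*p*N \<longleftrightarrow> a < 2*p*N" "inv_into UNIV \<sigma> a < 2*p*N \<longleftrightarrow> a < 2*p*N" for a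
    using permutes_in_image[OF \<sigma>] permutes_in_image[OF permutes_inv[OF \<sigma>]] by simp_all
  have "inj_on f (invariant_colourings ?A d (row_partner p \<circ> \<sigma>) \<times> invariant_colourings ?A d (col_partner \<circ> \<sigma>))"
  proof (rule inj_onI, clarify)
    fix u t u' t'
    assume u: "u \<in> invariant_colourings ?A d (row_partner p \<circ> \<sigma>)" "u' \<in> invariant_colourings ?A d (row_partner p \<circ> \<sigma>)"
      and t: "t \<in> invariant_colourings ?A d (col_partner \<circ> \<sigma>)" "t' \<in> invariant_colourings ?A d (col_partner \<circ> \<sigma>)"
      and eq: "f (u, t) = f (u', t')"
    have "u a = u' a" if "a < 2*p*N" for a using fun_cong[OF eq, of "(True, a)"] that by (simp add: f_def)
    then have "u = u'" using u by (intro PiE_ext[of u ?A "\<lambda>_. {..<d}"]) (auto simp: invariant_colourings_def)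
    moreover have "t a = t' a" if "a < 2*p*N" for a
      using fun_cong[OF eq, of "(False, col_partner a)"] that by (simp add: f_def col_partner_less[OF p] partner_properties[OF p])
    then have "t = t'" using t by (intro PiE_ext[of t ?A "\<lambda>_. {..<d}"]) (auto simp: invariant_colourings_def)
    ultimately show "u = u' \<and> t = t'" by simp
  qed
  moreover have "f ` (invariant_colourings ?A d (row_partner p \<circ> \<sigma>) \<times> invariant_colourings ?A d (col_partner \<circ> \<sigma>))
    \<subseteq> invariant_colourings (half_edges p N) d (boundary p N \<circ> gluing p N \<sigma>)"
  proof clarify
    fix u t
    assume u: "u \<in> invariant_colourings ?A d (row_partner p \<circ> \<sigma>)" and t: "t \<in> invariant_colourings ?A d (col_partner \<circ> \<sigma>)"
    have u': "u a < d" "u (row_partner p (\<sigma> a)) = u a" if "a < 2*p*N" for a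
      using u that by (auto simp: invariant_colourings_def)
    have t': "t a < d" "t (col_partner (\<sigma> a)) = t a" if "a < 2*p*N" for a
      using t that by (auto simp: invariant_colourings_def)
    have "f (u, t) ((boundary p N \<circ> gluing p N \<sigma>) (b, a)) = f (u, t) (b, a)" if "a < 2*p*N" for a b
      using that u'(2)[of a] t'(2)[of "inv_into UNIV \<sigma> a"] permutes_inverses(1)[OF \<sigma>]
      by (cases b) (simp_all add: f_def boundary_def gluing_def s row_partner_less[OF p] col_partner_less[OF p] partner_properties[OF p])
    moreover have "f (u, t) \<in> half_edges p N \<rightarrow>\<^sub>E {..<d}"
      using u'(1) t'(1) by (auto simp: f_def half_edges_def PiE_def extensional_def col_partner_less[OF p])
    ultimately show "f (u, t) \<in> invariant_colourings (half_edges p N) d (boundary p N \<circ> gluing p N \<sigma>)"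
      by (auto simp: invariant_colourings_def half_edges_def)
  qed
  ultimately have "card (invariant_colourings ?A d (row_partner p \<circ> \<sigma>) \<times> invariant_colourings ?A d (col_partner \<circ> \<sigma>))
    \<le> card (invariant_colourings (half_edges p N) d (boundary p N \<circ> gluing p N \<sigma>))"
    by (intro card_inj_on_le finite_invariant_colourings finite_half_edges)
  then show ?thesis by (simp add: card_cartesian_product)
qed

lemma boundary_legs:
  assumes "p \<ge> 1" "Suc r < 2*p" "q < N"
  shows "boundary p N (even r, q * (2*p) + r) = (even (Suc r), q * (2*p) + Suc r)"
    and "boundary p N (odd (Suc r), q * (2*p) + Suc r) = (odd r, q * (2*p) + r)"
proof -
  have lt: "q * (2*p) + x < 2*p*N" if "x < 2*p" for x
    using that assms by (simp add: block_lt_iff)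
  show "boundary p N (even r, q * (2*p) + r) = (even (Suc r), q * (2*p) + Suc r)"
    using lt[of r] assms by (auto simp: boundary_def row_partner_block col_partner_block)
  show "boundary p N (odd (Suc r), q * (2*p) + Suc r) = (odd r, q * (2*p) + r)"
    using lt[of "Suc r"] assms row_partner_block[of "Suc r" p q] col_partner_block[of "Suc r" p q]
    by (auto simp: boundary_def)
qed

text \<open>A colouring is constant on each leg, so the two half edges at the start of each block determine it.\<close>

lemma card_boundary_colourings_le:
  assumes p: "p \<ge> 1"
  shows "card (invariant_colourings (half_edges p N) d (boundary p N)) \<le> d ^ (2 * N)"
proof -
  let ?R = "(UNIV :: bool set) \<times> (\<lambda>q. q * (2*p)) ` {..<N}"
  have "card ((\<lambda>q. q * (2*p)) ` {..<N}) = N"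
    using p by (subst card_image) (auto intro: inj_onI)
  then have "card ?R = 2 * N" by (simp add: card_cartesian_product)
  moreover have "card (invariant_colourings (half_edges p N) d (boundary p N)) \<le> d ^ card ?R"
  proof (rule card_invariant_colourings_le_determining)
    show "?R \<subseteq> half_edges p N" using p by (auto simp: half_edges_def block_lt_iff)
    fix v v' assume v: "v \<in> invariant_colourings (half_edges p N) d (boundary p N)"
      "v' \<in> invariant_colourings (half_edges p N) d (boundary p N)" and R: "\<forall>x\<in>?R. v x = v' x"
    have legs: "w (even r, q * (2*p) + r) = w (True, q * (2*p)) \<and> w (odd r, q * (2*p) + r) = w (False, q * (2*p))"
      if w: "w \<in> invariant_colourings (half_edges p N) d (boundary p N)" and "r < 2*p" and q: "q < N" for w q r
      using that(2)
    proof (induction r)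
      case (Suc r)
      have "(b, q * (2*p) + x) \<in> half_edges p N" if "x < 2*p" for b x
        using that q p by (simp add: half_edges_def block_lt_iff)
      then have "w (boundary p N (b, q * (2*p) + x)) = w (b, q * (2*p) + x)" if "x < 2*p" for b x
        using w that by (simp add: invariant_colourings_def)
      from this[of r "even r"] this[of "Suc r" "odd (Suc r)"] show ?case
        using Suc boundary_legs[OF p Suc.prems q] by simp
    qed simp
    show "v = v'"
    proof (rule PiE_ext[of v "half_edges p N" "\<lambda>_. {..<d}"])
      fix x assume "x \<in> half_edges p N"
      then obtain b a where x: "x = (b, a)" "a < 2*p*N" by (cases x) (auto simp: half_edges_def)
      obtain q r where a: "a = q * (2*p) + r" "r < 2*p" "a div (2*p) = q" using block_cases[OF p] by metis
      have q: "q < N" using x(2) a(3) block_lt_iff[OF p] by blast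
      then have "v (c, q * (2*p)) = v' (c, q * (2*p))" for c using R by simp
      then show "v x = v' x"
        using legs[OF v(1) a(2) q] legs[OF v(2) a(2) q] unfolding x a(1) by (cases b; cases "even r") auto
    qed (use v in \<open>auto simp: invariant_colourings_def\<close>)
  qed simp
  ultimately show ?thesis by simp
qed

text \<open>Euler's bound: the polygons contribute \<open>2 * N\<close> cycles, and each of the \<open>2 * p * N\<close>
  transpositions of the gluing adds at most one.\<close>

lemma card_row_col_le:
  assumes p: "p \<ge> 1" and d: "d \<ge> 1" and \<sigma>: "\<sigma> permutes {..<2*p*N}"
  shows "card_row_col p N d \<sigma>
    \<le> d ^ (2*p*N + 2*N)"
proof -
  note g = gluing_properties[OF \<sigma>]
  have "card (invariant_colourings (half_edges p N) d (boundary p N \<circ> gluing p N \<sigma>))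
    \<le> d ^ (2*p*N) * card (invariant_colourings (half_edges p N) d (boundary p N))"
    by (rule card_invariant_colourings_involution_le[OF finite_half_edges d boundary_permutes[OF p] g(1,2)])
       (simp add: g(4))
  also have "\<dots> \<le> d ^ (2*p*N) * d ^ (2*N)"
    by (intro mult_left_mono card_boundary_colourings_le p) simp
  finally show ?thesis using card_row_col_le_gluing[OF p \<sigma>, of d] by (simp add: power_add)
qed

lemma boundary_leg_closed:
  assumes p: "p \<ge> 1"
  shows "boundary p N ` {(b, x). x < 2*p*N \<and> x div (2*p) = q \<and> b = even x}
    \<subseteq> {(b, x). x < 2*p*N \<and> x div (2*p) = q \<and> b = even x}"
  by (auto simp: boundary_def row_partner_less[OF p] col_partner_less[OF p] partner_properties[OF p])

text \<open>The half edge of \<open>a\<close> on the first leg of its block is paired with one off this leg: with another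
  block, or, if the parity is kept, with the second leg.  Performed first, this transposition merges two
  polygons instead of splitting one.\<close>

lemma card_row_col_le_of_leg_change:
  assumes p: "p \<ge> 1" and d: "d \<ge> 1" and \<sigma>: "\<sigma> permutes {..<2*p*N}" 
    and inv: "\<And>x. \<sigma> (\<sigma> x) = x"
    and a: "a < 2*p*N" "a div (2*p) \<noteq> \<sigma> a div (2*p) \<or> even (\<sigma> a) = even a"
  shows "d * card_row_col p N d \<sigma>
    \<le> d ^ (2*p*N + 2*N)"
proof -
  let ?H = "half_edges p N" and ?\<phi> = "boundary p N" and ?\<tau> = "gluing p N \<sigma>"
  note g = gluing_properties[OF \<sigma>]
  define h where "h = (even a, a)"
  have hH: "h \<in> ?H" using a by (simp add: h_def half_edges_def)
  then have h: "?\<tau> h \<noteq> h" using g(3) by (simp add: h_def)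
  note dp = drop_pair[OF g(1,2) h finite_half_edges]
  let ?t = "Transposition.transpose h (?\<tau> h)"
  \<comment> \<open>the first leg of the block of \<open>a\<close>\<close>
  define S where "S = {(b, x). x < 2*p*N \<and> x div (2*p) = a div (2*p) \<and> b = even x}"
  have "inv_into UNIV \<sigma> a = \<sigma> a" using inv by (metis \<sigma> permutes_inverses(2))
  then have tau_h: "?\<tau> h = (odd a, \<sigma> a)" using a by (simp add: gluing_def h_def)
  have S: "S \<subseteq> ?H" "?\<phi> ` S \<subseteq> S" "h \<in> S" "?\<tau> h \<notin> S"
    using a boundary_leg_closed[OF p] unfolding S_def by (auto simp: half_edges_def tau_h) (auto simp: h_def)
  have "?\<phi> \<circ> ?t \<circ> drop_pair ?\<tau> h = ?\<phi> \<circ> ?\<tau>" by (simp only: comp_assoc dp(3))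
  moreover have "card (invariant_colourings ?H d (?\<phi> \<circ> ?t \<circ> drop_pair ?\<tau> h))
    \<le> d ^ (2*p*N - 1) * card (invariant_colourings ?H d (?\<phi> \<circ> ?t))"
  proof (rule card_invariant_colourings_involution_le[OF finite_half_edges d _ dp(1,2)])
    show "?\<phi> \<circ> ?t permutes ?H"
      by (intro permutes_compose boundary_permutes p permutes_swap_id dp)
    show "card {x. drop_pair ?\<tau> h x \<noteq> x} \<le> 2 * (2*p*N - 1)" using dp(5) g(4) by linarith
  qed
  ultimately have "card (invariant_colourings ?H d (?\<phi> \<circ> ?\<tau>)) 
    \<le> d ^ (2*p*N - 1) * card (invariant_colourings ?H d (?\<phi> \<circ> ?t))" by simp
  with card_row_col_le_gluing[OF p \<sigma>, of d]
  have "d * card_row_col p N d \<sigma>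
    \<le> d * (d ^ (2*p*N - 1) * card (invariant_colourings ?H d (?\<phi> \<circ> ?t)))"
    by (intro mult_left_mono) simp_all
  also have "\<dots> = d ^ (2*p*N - 1) * (d * card (invariant_colourings ?H d (?\<phi> \<circ> ?t)))" by simp
  also have "\<dots> \<le> d ^ (2*p*N - 1) * card (invariant_colourings ?H d ?\<phi>)"
    by (intro mult_left_mono card_invariant_colourings_merge[OF finite_half_edges boundary_permutes[OF p] S(1-3) dp(7) S(4) d]) simp
  also have "\<dots> \<le> d ^ (2*p*N) * d ^ (2*N)"
    using d by (intro mult_mono card_boundary_colourings_le[OF p] power_increasing) simp_all
  finally show ?thesis by (simp add: power_add)
qed

text \<open>Of two crossing chords of a polygon, the first splits it into two arcs, and the second joins points of
  different arcs and merges them again.\<close>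

lemma card_row_col_le_of_crossing:
  assumes p: "p \<ge> 1" and d: "d \<ge> 1" and \<sigma>: "\<sigma> permutes {..<2*p*N}"
    and inv: "\<And>x. \<sigma> (\<sigma> x) = x"
    and flip: "even (\<sigma> a) \<longleftrightarrow> odd a" "even (\<sigma> b) \<longleftrightarrow> odd b" 
    and block: "\<sigma> a div (2*p) = a div (2*p)"
    and cross: "a < b" "b < \<sigma> a" "\<sigma> a < \<sigma> b" "\<sigma> b < 2*p*N"
  shows "d * card_row_col p N d \<sigma>
    \<le> d ^ (2*p*N + 2*N)"
proof -
  let ?H = "half_edges p N" and ?\<phi> = "boundary p N" and ?\<tau> = "gluing p N \<sigma>"
  note g = gluing_properties[OF \<sigma>]
  have inv': "inv_into UNIV \<sigma> x = \<sigma> x" for x using inv by (metis \<sigma> permutes_inverses(2))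
  define h1 h2 where "h1 = (even a, a)" and "h2 = (even b, b)"
  have h12: "h1 \<in> ?H" "h2 \<in> ?H" using cross by (simp_all add: h1_def h2_def half_edges_def)
  have tau: "?\<tau> h1 = (odd a, \<sigma> a)" "?\<tau> h2 = (odd b, \<sigma> b)"
    using cross by (simp_all add: gluing_def h1_def h2_def inv')
  have ne1: "?\<tau> h1 \<noteq> h1" using g(3) h12 by (simp add: h1_def)
  note dp1 = drop_pair[OF g(1,2) ne1 finite_half_edges]
  let ?t1 = "Transposition.transpose h1 (?\<tau> h1)" and ?\<tau>1 = "drop_pair ?\<tau> h1"
  have t2: "?\<tau>1 h2 = ?\<tau> h2" using cross by (simp add: drop_pair_def tau) (simp add: h2_def h1_def)
  have ne2: "?\<tau>1 h2 \<noteq> h2" unfolding t2 using g(3) h12 by (simp add: h2_def)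
  note dp2 = drop_pair[OF dp1(1,2) ne2 finite_half_edges, unfolded t2]
  let ?t2 = "Transposition.transpose h2 (?\<tau> h2)" and ?\<tau>2 = "drop_pair ?\<tau>1 h2"
  \<comment> \<open>the arc of the first leg that the chord from \<open>a\<close> to \<open>\<sigma> a\<close> cuts off\<close>
  define S where "S = {(b, x). a < x \<and> x \<le> \<sigma> a \<and> b = even x}"
  have perm1: "?\<phi> \<circ> ?t1 permutes ?H"
    by (intro permutes_compose boundary_permutes p permutes_swap_id dp1)
  obtain q r where qr: "a = q * (2*p) + r" "r < 2*p" "a div (2*p) = q" using block_cases[OF p] by metis
  have q: "q < N" using qr(3) cross block_lt_iff[OF p, of a N] by simp
  \<comment> \<open>inside the block the boundary moves one step to the right\<close>
  have right: "?\<phi> (even x, x) = (even (Suc x), Suc x)" if "a \<le> x" "x < \<sigma> a" for x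
  proof -
    have sa: "\<sigma> a < q * (2*p) + 2*p"
      using block qr(3) p by (metis add.commute dividend_less_div_times mult_2 mult_pos_pos One_nat_def Suc_le_lessD zero_less_numeral)
    define r' where "r' = x - q * (2*p)"
    have "x = q * (2*p) + r'" "Suc r' < 2*p" using that sa qr(1) by (auto simp: r'_def)
    then show ?thesis using boundary_legs(1)[OF p _ q, of r'] by simp
  qed
  have "(?\<phi> \<circ> ?t1) (even x, x) \<in> S" if "a < x" "x \<le> \<sigma> a" for x
  proof (cases "x = \<sigma> a")
    case True
    then have "(even x, x) = ?\<tau> h1" using flip by (simp add: tau)
    then have "(?\<phi> \<circ> ?t1) (even x, x) = ?\<phi> h1" by simp
    then show ?thesis using right[of a] cross by (simp add: h1_def S_def)
  next
    case False
    then have "?t1 (even x, x) = (even x, x)"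
      using that by (intro transpose_apply_other) (auto simp: tau, auto simp: h1_def)
    then show ?thesis using right[of x] that False by (simp add: S_def)
  qed
  then have "(?\<phi> \<circ> ?t1) y \<in> S" if "y \<in> S" for y
    using that by (cases y) (simp add: S_def)
  then have "(?\<phi> \<circ> ?t1) ` S \<subseteq> S" by blast
  moreover have "S \<subseteq> ?H" "h2 \<in> S" "?\<tau> h2 \<notin> S"
    using cross by (auto simp: S_def half_edges_def tau) (auto simp: h2_def)
  ultimately have S: "d * card (invariant_colourings ?H d (?\<phi> \<circ> ?t1 \<circ> ?t2)) \<le> card (invariant_colourings ?H d (?\<phi> \<circ> ?t1))"
    using perm1 dp2(7) d by (intro card_invariant_colourings_merge[OF finite_half_edges]) 
  have "card (invariant_colourings ?H d (?\<phi> \<circ> ?t1)) \<le> d * card (invariant_colourings ?H d (?\<phi> \<circ> ?t1 \<circ> ?t1))"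
    using dp1 d perm1 by (intro card_invariant_colourings_transpose_le finite_half_edges)
  also have "?\<phi> \<circ> ?t1 \<circ> ?t1 = ?\<phi>" by (simp add: comp_assoc)
  finally have "d * card (invariant_colourings ?H d (?\<phi> \<circ> ?t1 \<circ> ?t2)) \<le> d * card (invariant_colourings ?H d ?\<phi>)"
    using S by linarith
  then have t12: "card (invariant_colourings ?H d (?\<phi> \<circ> ?t1 \<circ> ?t2)) \<le> d ^ (2*N)"
    using d card_boundary_colourings_le[OF p, of N d] by simp
  have "?\<phi> \<circ> ?t1 \<circ> ?t2 \<circ> ?\<tau>2 = ?\<phi> \<circ> ?\<tau>" by (simp only: comp_assoc dp2(3) dp1(3))
  moreover have "card (invariant_colourings ?H d (?\<phi> \<circ> ?t1 \<circ> ?t2 \<circ> ?\<tau>2))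
    \<le> d ^ (2*p*N - 2) * card (invariant_colourings ?H d (?\<phi> \<circ> ?t1 \<circ> ?t2))"
  proof (rule card_invariant_colourings_involution_le[OF finite_half_edges d _ dp2(1,2)])
    show "?\<phi> \<circ> ?t1 \<circ> ?t2 permutes ?H"
      by (intro permutes_compose[OF permutes_swap_id perm1] dp2)
    show "card {x. ?\<tau>2 x \<noteq> x} \<le> 2 * (2*p*N - 2)" using dp2(5) dp1(5) g(4) by linarith
  qed
  ultimately have "card (invariant_colourings ?H d (?\<phi> \<circ> ?\<tau>)) 
    \<le> d ^ (2*p*N - 2) * card (invariant_colourings ?H d (?\<phi> \<circ> ?t1 \<circ> ?t2))" by simp
  also have "\<dots> \<le> d ^ (2*p*N - 2) * d ^ (2*N)" by (intro mult_left_mono t12) simp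
  finally have "d * card_row_col p N d \<sigma>
    \<le> d * (d ^ (2*p*N - 2) * d ^ (2*N))"
    using card_row_col_le_gluing[OF p \<sigma>, of d] by (intro mult_left_mono) simp_all
  also have "\<dots> = d ^ (Suc (2*p*N - 2) + 2*N)" by (simp add: power_add)
  also have "\<dots> \<le> d ^ (2*p*N + 2*N)"
    using d cross by (intro power_increasing) simp_all
  finally show ?thesis .
qed

section \<open>Noncrossing matchings\<close>

definition join_at :: "nat \<Rightarrow> nat \<Rightarrow> (nat \<Rightarrow> nat) \<Rightarrow> (nat \<Rightarrow> nat) \<Rightarrow> nat \<Rightarrow> nat" where
  "join_at l k \<tau>1 \<tau>2 = (\<lambda>x. if x = l then l + 2*k + 1 else if x = l + 2*k + 1 then l
     else if x < l + 2*k + 1 then \<tau>1 x else \<tau>2 x)"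

text \<open>Noncrossing perfect matchings of the interval from \<open>l\<close> to \<open>l + 2 * p - 1\<close>, extended by the
  identity.  The partner \<open>l + 2 * k + 1\<close> of the left end point separates a matching inside from a
  matching beyond.\<close>

inductive nc_matching :: "nat \<Rightarrow> nat \<Rightarrow> (nat \<Rightarrow> nat) \<Rightarrow> bool" where
  nc_empty: "nc_matching l 0 id"
| nc_join: "nc_matching (l + 1) k \<tau>1 \<Longrightarrow> nc_matching (l + 2*k + 2) m \<tau>2 \<Longrightarrow>
     nc_matching l (Suc (k + m)) (join_at l k \<tau>1 \<tau>2)"

lemma nc_matching_matches:
  assumes "nc_matching l p \<tau>"
  shows "(x < l \<or> l + 2*p \<le> x \<longrightarrow> \<tau> x = x) \<and>
    (l \<le> x \<and> x < l + 2*p \<longrightarrow> l \<le> \<tau> x \<and> \<tau> x < l + 2*p \<and> \<tau> (\<tau> x) = x \<and> (even (\<tau> x) \<longleftrightarrow> odd x))"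
  using assms
proof (induction arbitrary: x)
  case (nc_join l k \<tau>1 m \<tau>2)
  let ?J = "join_at l k \<tau>1 \<tau>2"
  consider "x < l" | "x = l" | "l < x" "x < l + 2*k + 1" | "x = l + 2*k + 1"
    | "l + 2*k + 2 \<le> x" "x < l + 2*k + 2 + 2*m" | "l + 2*k + 2 + 2*m \<le> x" by linarith
  then show ?case
  proof cases
    case 1
    then show ?thesis using nc_join.IH(1)[of x] by (simp add: join_at_def)
  next
    case 3
    then have "l < \<tau>1 x" "\<tau>1 x < l + 2*k + 1" "\<tau>1 (\<tau>1 x) = x" "even (\<tau>1 x) \<longleftrightarrow> odd x"
      using nc_join.IH(1)[of x] by auto
    then show ?thesis using 3 by (auto simp: join_at_def)
  next
    case 5
    then have "l + 2*k + 2 \<le> \<tau>2 x" "\<tau>2 x < l + 2*k + 2 + 2*m" "\<tau>2 (\<tau>2 x) = x" "even (\<tau>2 x) \<longleftrightarrow> odd x"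
      using nc_join.IH(2)[of x] by auto
    then show ?thesis using 5 by (auto simp: join_at_def)
  next
    case 6
    then show ?thesis using nc_join.IH(2)[of x] by (simp add: join_at_def)
  qed (auto simp: join_at_def)
qed simp

lemma nc_matching_involution:
  assumes "nc_matching l p \<tau>"
  shows "\<tau> (\<tau> x) = x"
  using nc_matching_matches[OF assms, of x] by (cases "x < l \<or> l + 2*p \<le> x") auto

lemma nc_matching_permutes:
  assumes "nc_matching l p \<tau>"
  shows "\<tau> permutes {l..<l + 2*p}"
  by (rule involution_permutes[OF nc_matching_involution[OF assms]])
     (use nc_matching_matches[OF assms] in auto)

lemma nc_matching_Suc_image:
  "{\<tau>. nc_matching l (Suc p) \<tau>} = (\<Union>k\<in>{..p}. (\<lambda>(\<tau>1, \<tau>2). join_at l k \<tau>1 \<tau>2) `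
     ({\<tau>. nc_matching (l + 1) k \<tau>} \<times> {\<tau>. nc_matching (l + 2*k + 2) (p - k) \<tau>}))" (is "?L = ?R")
proof (intro equalityI subsetI)
  fix \<tau> assume "\<tau> \<in> ?L"
  then have "nc_matching l (Suc p) \<tau>" by simp
  then show "\<tau> \<in> ?R"
  proof cases
    case (nc_join k \<tau>1 m \<tau>2)
    then have "k \<in> {..p}" "p - k = m" by auto
    then show ?thesis using nc_join by blast
  qed
next
  fix \<tau> assume "\<tau> \<in> ?R"
  then obtain k \<tau>1 \<tau>2 where "k \<le> p" "nc_matching (l + 1) k \<tau>1" "nc_matching (l + 2*k + 2) (p - k) \<tau>2"
    "\<tau> = join_at l k \<tau>1 \<tau>2" by auto
  then show "\<tau> \<in> ?L" using nc_matching.nc_join[of l k \<tau>1 "p - k" \<tau>2] by simp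
qed

lemma join_at_inj:
  "inj_on (\<lambda>(\<tau>1, \<tau>2). join_at l k \<tau>1 \<tau>2) ({\<tau>. nc_matching (l + 1) k \<tau>} \<times> {\<tau>. nc_matching (l + 2*k + 2) m \<tau>})"
proof (rule inj_onI, clarify)
  fix \<tau>1 \<tau>2 \<tau>1' \<tau>2'
  assume 1: "nc_matching (l + 1) k \<tau>1" "nc_matching (l + 1) k \<tau>1'"
    and 2: "nc_matching (l + 2*k + 2) m \<tau>2" "nc_matching (l + 2*k + 2) m \<tau>2'"
    and eq: "join_at l k \<tau>1 \<tau>2 = join_at l k \<tau>1' \<tau>2'"
  have "\<tau>1 x = \<tau>1' x" for x
  proof (cases "l < x \<and> x < l + 2*k + 1")
    case True
    then show ?thesis using fun_cong[OF eq, of x] by (simp add: join_at_def)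
  next
    case False
    then have "x < l + 1 \<or> l + 1 + 2*k \<le> x" by linarith
    then have "\<tau>1 x = x" "\<tau>1' x = x"
      using nc_matching_matches[OF 1(1), of x] nc_matching_matches[OF 1(2), of x] by blast+
    then show ?thesis by simp
  qed
  moreover have "\<tau>2 x = \<tau>2' x" for x
  proof (cases "l + 2*k + 2 \<le> x")
    case True
    then show ?thesis using fun_cong[OF eq, of x] by (simp add: join_at_def)
  next
    case False
    then have "x < l + 2*k + 2" by linarith
    then have "\<tau>2 x = x" "\<tau>2' x = x"
      using nc_matching_matches[OF 2(1), of x] nc_matching_matches[OF 2(2), of x] by blast+
    then show ?thesis by simp
  qed
  ultimately show "\<tau>1 = \<tau>1' \<and> \<tau>2 = \<tau>2'" by auto
qed

lemma finite_nc_matching: "finite {\<tau>. nc_matching l p \<tau>}"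
  by (rule finite_subset[OF _ finite_permutations[of "{l..<l + 2*p}"]]) (auto intro: nc_matching_permutes)

lemma card_nc_matching_Suc:
  "card {\<tau>. nc_matching l (Suc p) \<tau>} =
    (\<Sum>k\<le>p. card {\<tau>. nc_matching (l + 1) k \<tau>} * card {\<tau>. nc_matching (l + 2*k + 2) (p - k) \<tau>})"
proof -
  have "join_at l k \<tau>1 \<tau>2 l = l + 2*k + 1" for k \<tau>1 \<tau>2 by (simp add: join_at_def)
  then have kk: "k = k'" if "join_at l k \<tau>1 \<tau>2 = join_at l k' \<tau>1' \<tau>2'" for k k' \<tau>1 \<tau>2 \<tau>1' \<tau>2'
    using that by (metis add_left_cancel add_right_cancel mult_cancel1 zero_neq_numeral)
  let ?F = "\<lambda>k. (\<lambda>(\<tau>1, \<tau>2). join_at l k \<tau>1 \<tau>2) `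
     ({\<tau>. nc_matching (l + 1) k \<tau>} \<times> {\<tau>. nc_matching (l + 2*k + 2) (p - k) \<tau>})"
  have "\<forall>i\<in>{..p}. \<forall>j\<in>{..p}. i \<noteq> j \<longrightarrow> ?F i \<inter> ?F j = {}"
    using kk by fast
  moreover have "\<forall>i\<in>{..p}. finite (?F i)"
    by (intro ballI finite_imageI finite_cartesian_product finite_nc_matching)
  ultimately have "card (\<Union>k\<in>{..p}. ?F k) = (\<Sum>k\<le>p. card (?F k))"
    by (intro card_UN_disjoint finite_atMost)
  then show ?thesis
    by (simp only: nc_matching_Suc_image card_image[OF join_at_inj] card_cartesian_product)
qed

text \<open>Without crossings an involution preserves the points strictly between the left end point and its
  partner, hence also those beyond the partner.\<close>

lemma noncrossing_imp_nc_matching: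
  assumes "\<And>x. l \<le> x \<Longrightarrow> x < l + m \<Longrightarrow> l \<le> \<tau> x \<and> \<tau> x < l + m \<and> \<tau> x \<noteq> x \<and> \<tau> (\<tau> x) = x"
    and "\<And>x. x < l \<or> l + m \<le> x \<Longrightarrow> \<tau> x = x"
    and "\<And>a b. l \<le> a \<Longrightarrow> a < b \<Longrightarrow> b < \<tau> a \<Longrightarrow> \<tau> a < \<tau> b \<Longrightarrow> \<tau> b < l + m \<Longrightarrow> False"
  shows "\<exists>p. m = 2*p \<and> nc_matching l p \<tau>"
  using assms
proof (induction m arbitrary: l \<tau> rule: less_induct)
  case (less m)
  show ?case
  proof (cases "m = 0")
    case True
    then have "\<tau> x = x" for x using less.prems(2)[of x] by (cases "x < l") auto
    then have "\<tau> = id" unfolding id_def by (rule ext)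
    then have "nc_matching l 0 \<tau>" by (simp only: nc_empty)
    moreover have "m = 2 * 0" using True by simp
    ultimately show ?thesis by blast
  next
    case False
    define b where "b = \<tau> l"
    have b: "l < b" "b < l + m" "\<tau> b = l" using less.prems(1)[of l] False by (auto simp: b_def)
    have in1: "l < \<tau> x \<and> \<tau> x < b \<and> \<tau> x \<noteq> x \<and> \<tau> (\<tau> x) = x" if "l < x" "x < b" for x
    proof -
      note x = less.prems(1)[of x]
      have ne: "\<tau> x \<noteq> l" "\<tau> x \<noteq> b" using x b that by (auto simp: b_def)
      moreover have "\<not> b < \<tau> x" using less.prems(3)[of l x] that b x unfolding b_def by auto
      ultimately show ?thesis using x that b by auto
    qed
    have in2: "b < \<tau> x \<and> \<tau> x < l + m \<and> \<tau> x \<noteq> x \<and> \<tau> (\<tau> x) = x" if "b < x" "x < l + m" for x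
    proof -
      note x = less.prems(1)[of x]
      have "\<tau> x \<noteq> l" "\<tau> x \<noteq> b" using x b that by (auto simp: b_def)
      moreover have "\<not> (l < \<tau> x \<and> \<tau> x < b)" using in1[of "\<tau> x"] x that b by auto
      ultimately show ?thesis using x that b by auto
    qed
    define \<tau>1 where "\<tau>1 = (\<lambda>x. if l < x \<and> x < b then \<tau> x else x)"
    define \<tau>2 where "\<tau>2 = (\<lambda>x. if b < x \<and> x < l + m then \<tau> x else x)"
    have "\<exists>p. b - l - 1 = 2*p \<and> nc_matching (l + 1) p \<tau>1"
    proof (rule less.IH)
      show "b - l - 1 < m" using b by simp
      fix x
      show "l + 1 \<le> x \<Longrightarrow> x < l + 1 + (b - l - 1) \<Longrightarrow>
        l + 1 \<le> \<tau>1 x \<and> \<tau>1 x < l + 1 + (b - l - 1) \<and> \<tau>1 x \<noteq> x \<and> \<tau>1 (\<tau>1 x) = x"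
        using in1[of x] b by (auto simp: \<tau>1_def)
      show "x < l + 1 \<or> l + 1 + (b - l - 1) \<le> x \<Longrightarrow> \<tau>1 x = x" using b by (auto simp: \<tau>1_def)
    next
      fix x y assume xy: "l + 1 \<le> x" "x < y" "y < \<tau>1 x" "\<tau>1 x < \<tau>1 y" "\<tau>1 y < l + 1 + (b - l - 1)"
      then have "x < b" by (auto simp: \<tau>1_def split: if_splits)
      then have "\<tau>1 x = \<tau> x" "\<tau> x < b" using in1[of x] xy by (auto simp: \<tau>1_def)
      then have "\<tau>1 y = \<tau> y" using xy by (auto simp: \<tau>1_def)
      then show False using less.prems(3)[of x y] xy b \<open>\<tau>1 x = \<tau> x\<close> by auto
    qed
    then obtain k where k: "b - l - 1 = 2*k" "nc_matching (l + 1) k \<tau>1" by blast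
    have b_eq: "b = l + 2*k + 1" using k b by simp
    have "\<exists>p. l + m - b - 1 = 2*p \<and> nc_matching (l + 2*k + 2) p \<tau>2"
    proof (rule less.IH)
      show "l + m - b - 1 < m" using b by simp
      have *: "l + 2*k + 2 + (l + m - b - 1) = l + m" using b b_eq by simp
      fix x
      show "l + 2*k + 2 \<le> x \<Longrightarrow> x < l + 2*k + 2 + (l + m - b - 1) \<Longrightarrow>
        l + 2*k + 2 \<le> \<tau>2 x \<and> \<tau>2 x < l + 2*k + 2 + (l + m - b - 1) \<and> \<tau>2 x \<noteq> x \<and> \<tau>2 (\<tau>2 x) = x"
        unfolding * using in2[of x] b_eq by (auto simp: \<tau>2_def)
      show "x < l + 2*k + 2 \<or> l + 2*k + 2 + (l + m - b - 1) \<le> x \<Longrightarrow> \<tau>2 x = x"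
        unfolding * using b_eq by (auto simp: \<tau>2_def)
    next
      have *: "l + 2*k + 2 + (l + m - b - 1) = l + m" using b b_eq by simp
      fix x y assume xy: "l + 2*k + 2 \<le> x" "x < y" "y < \<tau>2 x" "\<tau>2 x < \<tau>2 y" "\<tau>2 y < l + 2*k + 2 + (l + m - b - 1)"
      have "\<tau>2 x = \<tau> x" using xy by (auto simp: \<tau>2_def split: if_splits)
      moreover have "\<tau>2 y = \<tau> y" using xy by (auto simp: \<tau>2_def split: if_splits)
      ultimately show False using less.prems(3)[of x y] xy * by auto
    qed
    then obtain m' where m': "l + m - b - 1 = 2*m'" "nc_matching (l + 2*k + 2) m' \<tau>2" by blast
    have "\<tau> = join_at l k \<tau>1 \<tau>2"
    proof
      fix x
      show "\<tau> x = join_at l k \<tau>1 \<tau>2 x"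
        using b b_eq less.prems(2)[of x] by (auto simp: join_at_def \<tau>1_def \<tau>2_def b_def[symmetric])
    qed
    moreover have "m = 2 * Suc (k + m')" using m'(1) b_eq b by simp
    ultimately show ?thesis using nc_matching.nc_join[OF k(2) m'(2)] by metis
  qed
qed

text \<open>The indices along one leg, written as a path from \<open>l\<close> to \<open>l + 2 * p\<close> instead of a cycle so
  that the recursion for \<open>nc_matching\<close> applies.  Gluing identifies the start of each step with the
  end of its partner.\<close>

definition closed_path_colourings :: "nat \<Rightarrow> nat \<Rightarrow> nat \<Rightarrow> (nat \<Rightarrow> nat) \<Rightarrow> (nat \<Rightarrow> nat) set" where
  "closed_path_colourings d l p \<tau> = {x \<in> {l..l + 2*p} \<rightarrow>\<^sub>E {..<d}.
     x (l + 2*p) = x l \<and> (\<forall>a\<in>{l..<l + 2*p}. x (Suc (\<tau> a)) = x a)}"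

text \<open>The path inside and the path beyond the partner of the left end point can be chosen freely; the index
  at \<open>l\<close> is then the first index of the path beyond, and this path being closed makes the
  whole path closed.\<close>

lemma card_closed_path_colourings_ge:
  assumes "nc_matching l p \<tau>"
  shows "d ^ (p + 1) \<le> card (closed_path_colourings d l p \<tau>)"
  using assms
proof induction
  case (nc_empty l)
  have "closed_path_colourings d l 0 id = {l} \<rightarrow>\<^sub>E {..<d}" by (auto simp: closed_path_colourings_def)
  then have "card (closed_path_colourings d l 0 id) = d" by (simp only: card_PiE) (simp add: card_PiE)
  then show ?case by (simp only: add_0 power_one_right)
next
  case (nc_join l k \<tau>1 m \<tau>2)
  let ?b = "l + 2*k + 1" and ?J = "join_at l k \<tau>1 \<tau>2"
  let ?C1 = "closed_path_colourings d (l + 1) k \<tau>1" and ?C2 = "closed_path_colourings d (l + 2*k + 2) m \<tau>2"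
  let ?C = "closed_path_colourings d l (Suc (k + m)) ?J"
  define f where "f = (\<lambda>(x1, x2) v. if v = l then x2 (?b + 1) else if v \<le> ?b then x1 v else x2 v :: nat)"
  have "inj_on f (?C1 \<times> ?C2)"
  proof (rule inj_onI, clarify)
    fix x1 x2 y1 y2 assume x: "x1 \<in> ?C1" "y1 \<in> ?C1" "x2 \<in> ?C2" "y2 \<in> ?C2" and eq: "f (x1, x2) = f (y1, y2)"
    have "x1 v = y1 v" if "l + 1 \<le> v" "v \<le> l + 1 + 2*k" for v
      using fun_cong[OF eq, of v] that by (simp add: f_def)
    then have "x1 = y1"
      using x by (intro PiE_ext[of x1 "{l+1..l+1+2*k}" "\<lambda>_. {..<d}"])
        (auto simp: closed_path_colourings_def)
    moreover have "x2 v = y2 v" if "l + 2*k + 2 \<le> v" for v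
      using fun_cong[OF eq, of v] that by (simp add: f_def)
    then have "x2 = y2"
      using x by (intro PiE_ext[of x2 "{l+2*k+2..l+2*k+2+2*m}" "\<lambda>_. {..<d}"])
        (auto simp: closed_path_colourings_def)
    ultimately show "x1 = y1 \<and> x2 = y2" by simp
  qed
  moreover have "f ` (?C1 \<times> ?C2) \<subseteq> ?C"
  proof clarify
    fix x1 x2 assume x1: "x1 \<in> ?C1" and x2: "x2 \<in> ?C2"
    have r1: "x1 v < d" if "l + 1 \<le> v" "v \<le> ?b" for v 
      using x1 that by (auto simp: closed_path_colourings_def dest: PiE_mem[of _ _ _ v])
    have r2: "x2 v < d" if "?b + 1 \<le> v" "v \<le> l + 2 * Suc (k + m)" for v 
      using x2 that by (auto simp: closed_path_colourings_def dest: PiE_mem[of _ _ _ v])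
    have c1: "x1 ?b = x1 (l + 1)" and m1: "\<And>a. l + 1 \<le> a \<Longrightarrow> a < ?b \<Longrightarrow> x1 (Suc (\<tau>1 a)) = x1 a"
      using x1 by (simp_all add: closed_path_colourings_def add.commute)
    have c2: "x2 (l + 2 * Suc (k + m)) = x2 (?b + 1)"
      and m2: "\<And>a. ?b + 1 \<le> a \<Longrightarrow> a < l + 2 * Suc (k + m) \<Longrightarrow> x2 (Suc (\<tau>2 a)) = x2 a"
      and e2: "\<And>v. v > l + 2 * Suc (k + m) \<Longrightarrow> x2 v = undefined"
      using x2 by (simp_all add: closed_path_colourings_def add.commute add.left_commute PiE_def extensional_def)
    have ex: "x1 v = undefined" if "v < l" for v
      using x1 that by (simp add: closed_path_colourings_def PiE_def extensional_def)
    let ?x = "f (x1, x2)"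
    have "?x \<in> {l..l + 2 * Suc (k + m)} \<rightarrow>\<^sub>E {..<d}"
    proof (rule PiE_I)
      fix v assume v: "v \<in> {l..l + 2 * Suc (k + m)}"
      then show "?x v \<in> {..<d}" using r1[of v] r2[of v] r2[of "?b + 1"] by (auto simp: f_def)
    next
      fix v assume v: "v \<notin> {l..l + 2 * Suc (k + m)}"
      then show "?x v = undefined" using ex[of v] e2[of v] by (auto simp: f_def)
    qed
    moreover have "?x (l + 2 * Suc (k + m)) = ?x l" using c2 by (simp add: f_def)
    moreover have "?x (Suc (?J a)) = ?x a" if a: "a \<in> {l..<l + 2 * Suc (k + m)}" for a
    proof -
      consider "a = l" | "l < a" "a < ?b" | "a = ?b" | "?b < a"
        using a unfolding atLeastLessThan_iff by linarith
      then show ?thesis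
      proof cases
        case 1
        then show ?thesis by (simp add: f_def join_at_def)
      next
        case 2
        then have "l < \<tau>1 a" "\<tau>1 a < ?b" using nc_matching_matches[OF nc_join.hyps(1), of a] by auto
        then show ?thesis using 2 m1[of a] by (simp add: f_def join_at_def)
      next
        case 3
        then show ?thesis using c1 by (simp add: f_def join_at_def)
      next
        case 4
        then have "?b < \<tau>2 a" using a nc_matching_matches[OF nc_join.hyps(2), of a] by auto
        then show ?thesis using 4 a m2[of a] by (simp add: f_def join_at_def)
      qed
    qed
    ultimately show "?x \<in> ?C" by (simp add: closed_path_colourings_def)
  qed
  moreover have "finite ?C"
    unfolding closed_path_colourings_def by (simp add: finite_PiE)
  ultimately have "card (?C1 \<times> ?C2) \<le> card ?C" by (intro card_inj_on_le)
  moreover have "d ^ (k + 1) * d ^ (m + 1) \<le> card ?C1 * card ?C2"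
    by (intro mult_le_mono nc_join.IH)
  ultimately show ?case by (simp add: card_cartesian_product power_add mult.assoc mult.left_commute)
qed

text \<open>Partners in a noncrossing matching have different parity, so each leg is glued to itself, and the two
  legs can carry independent closed paths.\<close>

lemma card_row_col_ge_of_nc_matching:
  assumes p: "p \<ge> 1" and nc: "nc_matching 0 p \<tau>"
  shows "d ^ (2*p + 2) \<le> card (invariant_colourings {..<2*p} d (row_partner p \<circ> \<tau>)) *
    card (invariant_colourings {..<2*p} d (col_partner \<circ> \<tau>))"
proof -
  let ?C = "closed_path_colourings d 0 p \<tau>" and ?A = "{..<2*p}"
  let ?U = "invariant_colourings ?A d (row_partner p \<circ> \<tau>)" and ?T = "invariant_colourings ?A d (col_partner \<circ> \<tau>)"
  \<comment> \<open>the paths \<open>x\<close> and \<open>y\<close> live on the two legs; the unconjugated entry lies on the leg of \<open>x\<close> at even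
    positions and on the leg of \<open>y\<close>, traversed backwards, at odd ones\<close>
  define row where "row = (\<lambda>x y a. if a < 2*p then (if even a then x a else y (Suc a)) else undefined :: nat)"
  define col where "col = (\<lambda>x y a. if a < 2*p then (if even a then x (Suc a) else y a) else undefined :: nat)"
  define f where "f = (\<lambda>(x, y). (row x y, col x y))"
  have al: "row_partner p a = (if even a then if a = 0 then 2*p - 1 else a - 1 else if a = 2*p - 1 then 0 else Suc a)"
    if "a < 2*p" for a using row_partner_block[of a p 0] that by simp
  have be: "col_partner a = (if even a then Suc a else a - 1)" for a by (simp add: col_partner_def)
  have \<tau>: "\<tau> a < 2*p" "\<tau> (\<tau> a) = a" "even (\<tau> a) \<longleftrightarrow> odd a" if "a < 2*p" for a
    using nc_matching_matches[OF nc, of a] that by auto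
  have S2: "Suc a < 2*p" if "a < 2*p" "even a" for a
    using that by (metis Suc_lessI dvd_triv_left even_Suc)
  have C: "x (2*p) = x 0" "\<And>a. a < 2*p \<Longrightarrow> x (Suc (\<tau> a)) = x a" "\<And>a. a \<le> 2*p \<Longrightarrow> x a < d" if "x \<in> ?C" for x
    using that by (auto simp: closed_path_colourings_def)
  have C': "x (\<tau> a) = x (Suc a)" if "x \<in> ?C" "a < 2*p" for x a
    using C(2)[OF that(1), of "\<tau> a"] \<tau>[OF that(2)] by simp
  have "inj_on f (?C \<times> ?C)"
  proof (rule inj_onI, clarify)
    fix x y x' y' assume x: "x \<in> ?C" "x' \<in> ?C" and y: "y \<in> ?C" "y' \<in> ?C" and "f (x, y) = f (x', y')"
    then have eq: "row x y a = row x' y' a" "col x y a = col x' y' a" for a by (simp_all add: f_def)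
    have "x a = x' a \<and> y a = y' a" if a: "a < 2*p" for a
    proof (cases "even a")
      case True
      have "y a = y' a"
      proof (cases "a = 0")
        case True
        then show ?thesis using eq(1)[of "2*p - 1"] p C(1)[OF y(1)] C(1)[OF y(2)] by (simp add: row_def)
      next
        case False
        then obtain c where "a = Suc c" by (cases a) auto
        then show ?thesis using eq(1)[of c] True a by (simp add: row_def)
      qed
      then show ?thesis using eq(1)[of a] True a by (simp add: row_def)
    next
      case False
      then obtain c where "a = Suc c" by (cases a) auto
      then show ?thesis using eq(2)[of a] eq(2)[of c] False a by (simp add: col_def)
    qed
    moreover have "x (2*p) = x' (2*p) \<and> y (2*p) = y' (2*p)"
      using calculation[of 0] p C(1)[OF x(1)] C(1)[OF x(2)] C(1)[OF y(1)] C(1)[OF y(2)] by simp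
    ultimately have "x a = x' a \<and> y a = y' a" if "a \<le> 2*p" for a using that by (cases "a = 2*p") auto
    then show "x = x' \<and> y = y'"
      using x y by (auto simp: closed_path_colourings_def intro!: PiE_ext[of _ "{0..2*p}" "\<lambda>_. {..<d}"])
  qed
  moreover have "f ` (?C \<times> ?C) \<subseteq> ?U \<times> ?T"
  proof
    fix z assume "z \<in> f ` (?C \<times> ?C)"
    then obtain x y where z: "z = f (x, y)" and x: "x \<in> ?C" and y: "y \<in> ?C" by blast
    have "row x y (row_partner p (\<tau> a)) = row x y a \<and> col x y (col_partner (\<tau> a)) = col x y a" if a: "a < 2*p" for a
    proof -
      define b where "b = \<tau> a"
      have b: "b < 2*p" "even b \<longleftrightarrow> odd a" using \<tau>[OF a] by (simp_all add: b_def)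
      have xb: "x (Suc b) = x a" "y (Suc b) = y a" "x b = x (Suc a)" "y b = y (Suc a)"
        using C(2)[OF x a] C(2)[OF y a] C'[OF x a] C'[OF y a] by (simp_all add: b_def)
      show ?thesis
      proof (cases "even a")
        case True
        then obtain c where c: "b = Suc c" using b by (cases b) auto
        have "row x y (row_partner p b) = x (Suc b)"
        proof (cases "Suc b = 2*p")
          case True
          then have "b = 2*p - 1" by simp
          then have "row_partner p b = 0" using al[OF b(1)] b(2) \<open>even a\<close> c by auto
          then show ?thesis using True C(1)[OF x] p by (simp add: row_def)
        next
          case False
          then have "row_partner p b = Suc b" "Suc b < 2*p" using al[OF b(1)] b \<open>even a\<close> by auto
          then show ?thesis using b \<open>even a\<close> by (simp add: row_def)
        qed
        moreover have "col x y (col_partner b) = x b" using b c True by (simp add: col_def be)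
        ultimately show ?thesis using True a xb by (simp add: row_def col_def b_def)
      next
        case False
        have "row x y (row_partner p b) = y b"
        proof (cases b)
          case 0
          then show ?thesis using b p False C(1)[OF y] by (simp add: row_def al)
        next
          case (Suc c)
          then show ?thesis using b False by (simp add: row_def al)
        qed
        moreover have "col x y (col_partner b) = y (Suc b)"
          using b False S2[OF b(1)] by (simp add: col_def be)
        ultimately show ?thesis using False a xb by (simp add: row_def col_def b_def)
      qed
    qed
    moreover have "row x y \<in> ?A \<rightarrow>\<^sub>E {..<d}" "col x y \<in> ?A \<rightarrow>\<^sub>E {..<d}"
      using C(3)[OF x] C(3)[OF y] by (auto simp: row_def col_def PiE_def extensional_def)
    ultimately show "z \<in> ?U \<times> ?T" by (simp add: z f_def invariant_colourings_def)
  qed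
  ultimately have "card (?C \<times> ?C) \<le> card (?U \<times> ?T)"
    by (intro card_inj_on_le) (auto intro: finite_invariant_colourings)
  moreover have "d ^ (p + 1) * d ^ (p + 1) \<le> card ?C * card ?C"
    by (intro mult_le_mono card_closed_path_colourings_ge nc)
  moreover have "d ^ (p + 1) * d ^ (p + 1) = d ^ (2*p + 2)" by (simp flip: power_add) (simp add: mult_2)
  ultimately show ?thesis unfolding card_cartesian_product by linarith
qed

section \<open>Catalan numbers\<close>

lemma catalan_ratio: "real (n + 2) * catalan (Suc n) = real (4 * n + 2) * catalan n"
proof -
  have "Suc n * (Suc (Suc (2*n)) choose Suc n) = Suc (Suc (2*n)) * (Suc (2*n) choose n)"
    by (rule Suc_times_binomial)
  moreover have "Suc (2*n) choose n = (Suc (2*n) choose Suc n)"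
    using binomial_symmetric[of n "Suc (2*n)"] by simp
  ultimately have 1: "Suc n * (2 * Suc n choose Suc n) = 2 * Suc n * (Suc (2*n) choose Suc n)" by simp
  have 2: "Suc n * (Suc (2*n) choose Suc n) = Suc (2*n) * (2*n choose n)" by (rule Suc_times_binomial)
  define X B where "X = real (2 * Suc n choose Suc n)" and "B = real (2*n choose n)"
  have "Suc n * (2 * Suc n choose Suc n) = 2 * (Suc (2*n) * (2*n choose n))"
    unfolding 1 2[symmetric] by (simp only: mult.assoc)
  then have "real (Suc n) * X = 2 * (real (Suc (2*n)) * B)"
    unfolding X_def B_def by (metis of_nat_mult of_nat_numeral)
  then have X: "X = real (4*n+2) * B / real (n+1)" by (simp add: field_simps)
  have "real (n + 2) * (X / real (Suc n + 1)) = X"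
    using nonzero_mult_div_cancel_left[of "real (n + 2)" X] by simp
  then show ?thesis unfolding catalan_def X_def[symmetric] B_def[symmetric] X by simp
qed

text \<open>Weight the terms of the sum for \<open>n + 1\<close> by \<open>k + 1\<close>.  By symmetry the weighted sum is
  \<open>(n + 3) / 2\<close> times the sum itself, and by the ratio of consecutive Catalan numbers it is
  expressed through the sum for \<open>n\<close>.\<close>

lemma catalan_convolution: "(\<Sum>k\<le>n. catalan k * catalan (n - k)) = catalan (Suc n)"
proof (induction n)
  case 0
  show ?case by (simp add: catalan_def)
next
  case (Suc n)
  have flip: "(\<Sum>k\<le>m. real k * catalan k * catalan (m - k)) = real m / 2 * (\<Sum>k\<le>m. catalan k * catalan (m - k))" for m
  proof -
    have "(\<Sum>k\<le>m. real k * catalan k * catalan (m - k)) = (\<Sum>k\<le>m. real (m - k) * catalan (m - k) * catalan (m - (m - k)))"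
      by (rule sum.reindex_bij_witness[of _ "\<lambda>k. m - k" "\<lambda>k. m - k"]) auto
    also have "\<dots> = (\<Sum>k\<le>m. real m * (catalan k * catalan (m - k)) - real k * catalan k * catalan (m - k))"
      by (intro sum.cong) (auto simp: of_nat_diff algebra_simps)
    also have "\<dots> = real m * (\<Sum>k\<le>m. catalan k * catalan (m - k)) - (\<Sum>k\<le>m. real k * catalan k * catalan (m - k))"
      by (simp add: sum_subtractf sum_distrib_left)
    finally show ?thesis by simp
  qed
  let ?S = "\<lambda>m. \<Sum>k\<le>m. catalan k * catalan (m - k)"
  define C where "C = ?S (Suc n)"
  have "(\<Sum>k\<le>Suc n. (real k + 1) * catalan k * catalan (Suc n - k)) = real (n + 3) / 2 * ?S (Suc n)"
    unfolding distrib_right mult_1_left sum.distrib flip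
    by (simp add: field_simps del: sum.atMost_Suc)
  moreover have "(\<Sum>k\<le>Suc n. (real k + 1) * catalan k * catalan (Suc n - k)) =
      catalan (Suc n) + (\<Sum>k\<le>n. (real (k + 2) * catalan (Suc k)) * catalan (n - k))"
    by (subst sum.atMost_Suc_shift) (simp add: catalan_def)
  moreover have "(\<Sum>k\<le>n. (real (k + 2) * catalan (Suc k)) * catalan (n - k)) =
      (\<Sum>k\<le>n. 4 * (real k * catalan k * catalan (n - k)) + 2 * (catalan k * catalan (n - k)))"
    unfolding catalan_ratio by (intro sum.cong) (auto simp: algebra_simps)
  moreover have "\<dots> = 4 * (real n / 2 * ?S n) + 2 * ?S n"
    unfolding sum.distrib sum_distrib_left[symmetric] flip ..
  ultimately have "real (n + 3) / 2 * C = real (2 * n + 3) * catalan (Suc n)"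
    unfolding Suc C_def[symmetric] by (simp add: algebra_simps)
  moreover have "real (n + 3) * catalan (Suc (Suc n)) = real (4 * n + 6) * catalan (Suc n)"
    using catalan_ratio[of "Suc n"] by (simp add: algebra_simps)
  ultimately have "real (n + 3) * C = real (n + 3) * catalan (Suc (Suc n))"
    by (simp add: algebra_simps)
  then show ?case unfolding C_def by (simp only: mult_cancel_left of_nat_eq_0_iff) simp
qed

lemma card_nc_matching: "real (card {\<tau>. nc_matching l p \<tau>}) = catalan p"
proof (induction p arbitrary: l rule: less_induct)
  case (less p)
  show ?case
  proof (cases p)
    case 0
    have "{\<tau>. nc_matching l 0 \<tau>} = {id}"
      by (auto intro: nc_empty elim: nc_matching.cases)
    then have "card {\<tau>. nc_matching l 0 \<tau>} = 1" by (simp only: is_singletonI is_singleton_altdef[symmetric])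
    then show ?thesis by (simp add: 0 catalan_def)
  next
    case (Suc m)
    have "real (card {\<tau>. nc_matching l (Suc m) \<tau>}) = 
      (\<Sum>k\<le>m. real (card {\<tau>. nc_matching (l + 1) k \<tau>}) * real (card {\<tau>. nc_matching (l + 2*k + 2) (m - k) \<tau>}))"
      unfolding card_nc_matching_Suc by (simp only: of_nat_sum of_nat_mult)
    also have "\<dots> = (\<Sum>k\<le>m. catalan k * catalan (m - k))"
      using less Suc by (intro sum.cong refl arg_cong2[of _ _ _ _ "(*)"]) auto
    finally show ?thesis by (simp add: Suc catalan_convolution)
  qed
qed

section \<open>The sum over derangements\<close>

definition derangements :: "'a set \<Rightarrow> ('a \<Rightarrow> 'a) set" where
  "derangements A = {\<sigma>. \<sigma> permutes A \<and> (\<forall>a\<in>A. \<sigma> a \<noteq> a)}"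

text \<open>The number of choices of slices, rows and columns that are compatible with the pairing \<open>\<sigma>\<close>.\<close>

definition gluing_weight :: "nat \<Rightarrow> nat \<Rightarrow> nat \<Rightarrow> nat \<Rightarrow> (nat \<Rightarrow> nat) \<Rightarrow> nat" where
  "gluing_weight p N d s \<sigma> = card (invariant_colourings {..<2*p*N} s \<sigma>) *
    card_row_col p N d \<sigma>"

definition max_weight :: "nat \<Rightarrow> nat \<Rightarrow> nat \<Rightarrow> nat \<Rightarrow> nat" where
  "max_weight p N d s = s ^ (p * N) * d ^ (2*p*N + 2*N)"

definition noncrossing_gluings :: "nat \<Rightarrow> nat \<Rightarrow> (nat \<Rightarrow> nat) set" where
  "noncrossing_gluings p N = {\<sigma> \<in> derangements {..<2*p*N}.
     \<forall>q<N. nc_matching (q * (2*p)) p (\<lambda>x. if x div (2*p) = q then \<sigma> x else x)}"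

lemma finite_derangements: "finite A \<Longrightarrow> finite (derangements A)"
  unfolding derangements_def using finite_permutations[of A] by (rule rev_finite_subset) auto

lemma card_derangements_le: "finite A \<Longrightarrow> card (derangements A) \<le> fact (card A)"
  unfolding derangements_def
  by (subst card_permutations[OF refl, symmetric]) (auto intro!: card_mono finite_permutations)

lemma derangement_colourings:
  assumes s: "s \<ge> 1" and \<sigma>: "\<sigma> \<in> derangements {..<2*p*N}"
  shows "card (invariant_colourings {..<2*p*N} s \<sigma>) \<le> s ^ (p*N)"
    and "\<not> (\<forall>x. \<sigma> (\<sigma> x) = x) \<Longrightarrow> s * card (invariant_colourings {..<2*p*N} s \<sigma>) \<le> s ^ (p*N)"
proof -
  have s': "\<sigma> permutes {..<2*p*N}" "\<And>a. a \<in> {..<2*p*N} \<Longrightarrow> \<sigma> a \<noteq> a" using \<sigma> by (auto simp: derangements_def)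
  obtain R where R: "R \<subseteq> {..<2*p*N}" "2 * card R \<le> card {..<2*p*N}"
    "card (invariant_colourings {..<2*p*N} s \<sigma>) \<le> s ^ card R"
    "2 * card R = card {..<2*p*N} \<Longrightarrow> \<forall>a\<in>{..<2*p*N}. \<sigma> (\<sigma> a) = a"
    using card_invariant_colourings_derangement_le[OF finite_lessThan s'] by blast
  have le: "card R \<le> p * N" using R(2) by simp
  then have "s ^ card R \<le> s ^ (p*N)" using s by (intro power_increasing)
  then show "card (invariant_colourings {..<2*p*N} s \<sigma>) \<le> s ^ (p*N)" using R(3) by linarith
  show "s * card (invariant_colourings {..<2*p*N} s \<sigma>) \<le> s ^ (p*N)" if ninv: "\<not> (\<forall>x. \<sigma> (\<sigma> x) = x)"
  proof -
    have "card R \<noteq> p * N"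
    proof
      assume "card R = p * N"
      then have "\<forall>a\<in>{..<2*p*N}. \<sigma> (\<sigma> a) = a" by (intro R(4)) simp
      then have "\<sigma> (\<sigma> x) = x" for x using permutes_not_in[OF s'(1), of x] by (cases "x \<in> {..<2*p*N}") auto
      then show False using ninv by blast
    qed
    then have "s ^ Suc (card R) \<le> s ^ (p*N)" using le s by (intro power_increasing) auto
    then have "s * s ^ card R \<le> s ^ (p*N)" by simp
    with mult_le_mono2[OF R(3), of s] show ?thesis by (rule le_trans)
  qed
qed

lemma gluing_weight_le:
  assumes "p \<ge> 1" "d \<ge> 1" "s \<ge> 1" "\<sigma> \<in> derangements {..<2*p*N}"
  shows "gluing_weight p N d s \<sigma> \<le> max_weight p N d s"
  unfolding gluing_weight_def max_weight_def using assms
  by (intro mult_mono derangement_colourings card_row_col_le) (auto simp: derangements_def)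

lemma block_interval_iff:
  fixes p q x :: nat
  assumes "p \<ge> 1"
  shows "q * (2*p) \<le> x \<and> x < q * (2*p) + 2*p \<longleftrightarrow> x div (2*p) = q"
proof
  assume "q * (2*p) \<le> x \<and> x < q * (2*p) + 2*p"
  then show "x div (2*p) = q" by (intro div_nat_eqI) (simp_all add: mult.commute)
next
  assume "x div (2*p) = q"
  then show "q * (2*p) \<le> x \<and> x < q * (2*p) + 2*p"
    using assms div_times_less_eq_dividend[of x "2*p"] dividend_less_div_times[of "2*p" x] by simp
qed

text \<open>A derangement outside \<open>noncrossing_gluings\<close> is not an involution, which costs a factor \<open>s\<close>, or it
  joins different legs or has a crossing, which costs a factor \<open>d\<close>.\<close>

lemma gluing_weight_loss:
  assumes p: "p \<ge> 1" and d: "d \<ge> 1" and s: "s \<ge> 1" and \<sigma>: "\<sigma> \<in> derangements {..<2*p*N}" "\<sigma> \<notin> noncrossing_gluings p N"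
  shows "min d s * gluing_weight p N d s \<sigma> \<le> max_weight p N d s"
proof -
  let ?A = "{..<2*p*N}"
  let ?S = "card (invariant_colourings ?A s \<sigma>)"
  let ?D = "card (invariant_colourings ?A d (row_partner p \<circ> \<sigma>)) * card (invariant_colourings ?A d (col_partner \<circ> \<sigma>))"
  have perm: "\<sigma> permutes ?A" and ne: "\<And>a. a < 2*p*N \<Longrightarrow> \<sigma> a \<noteq> a" using \<sigma>(1) by (auto simp: derangements_def)
  consider (colour_s) "s * ?S \<le> s ^ (p*N)" | (colour_d) "d * ?D \<le> d ^ (2*p*N + 2*N)"
  proof (cases "\<forall>x. \<sigma> (\<sigma> x) = x")
    case False
    then show ?thesis using derangement_colourings(2)[OF s \<sigma>(1)] that(1) by blast
  next
    case True
    then have inv: "\<And>x. \<sigma> (\<sigma> x) = x" by blast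
    show ?thesis
    proof (cases "\<exists>a<2*p*N. a div (2*p) \<noteq> \<sigma> a div (2*p) \<or> even (\<sigma> a) = even a")
      case True
      then show ?thesis using card_row_col_le_of_leg_change[OF p d perm inv] that(2) by blast
    next
      case False
      then have ok: "\<sigma> a div (2*p) = a div (2*p)" "even (\<sigma> a) \<longleftrightarrow> odd a" if "a < 2*p*N" for a using that by auto
      obtain q where q: "q < N" and nnc: "\<not> nc_matching (q * (2*p)) p (\<lambda>x. if x div (2*p) = q then \<sigma> x else x)"
        using \<sigma> by (auto simp: noncrossing_gluings_def)
      let ?l = "q * (2*p)" and ?\<tau> = "\<lambda>x. if x div (2*p) = q then \<sigma> x else x"
      have blk: "?l \<le> x \<and> x < ?l + 2*p \<longleftrightarrow> x div (2*p) = q" for x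
        by (rule block_interval_iff[OF p])
      have blkA: "x < 2*p*N" if "x div (2*p) = q" for x using that q block_lt_iff[OF p] by simp
      have "\<exists>a b. ?l \<le> a \<and> a < b \<and> b < ?\<tau> a \<and> ?\<tau> a < ?\<tau> b \<and> ?\<tau> b < ?l + 2*p"
      proof (rule ccontr)
        assume nocross: "\<not> ?thesis"
        have "\<exists>p'. 2*p = 2*p' \<and> nc_matching ?l p' ?\<tau>"
        proof (rule noncrossing_imp_nc_matching)
          fix x assume "?l \<le> x" "x < ?l + 2*p"
          then have x: "x div (2*p) = q" using blk by blast
          then have "\<sigma> x div (2*p) = q" using ok(1)[of x] blkA by simp
          then show "?l \<le> ?\<tau> x \<and> ?\<tau> x < ?l + 2*p \<and> ?\<tau> x \<noteq> x \<and> ?\<tau> (?\<tau> x) = x"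
            using x inv ne blkA blk[of "\<sigma> x"] by auto
        next
          fix x assume "x < ?l \<or> ?l + 2*p \<le> x"
          then have "x div (2*p) \<noteq> q" using blk[of x] by linarith
          then show "?\<tau> x = x" by simp
        qed (use nocross in blast)
        then show False using nnc by auto
      qed
      then obtain a b where ab: "?l \<le> a" "a < b" "b < ?\<tau> a" "?\<tau> a < ?\<tau> b" "?\<tau> b < ?l + 2*p" by blast
      then have a: "a div (2*p) = q" by (auto split: if_splits)
      then have ta: "?\<tau> a = \<sigma> a" by simp
      then have "?l \<le> b" "b < ?l + 2*p" using ab by linarith+
      then have b: "b div (2*p) = q" using blk by blast
      then have tb: "?\<tau> b = \<sigma> b" by simp
      have "\<sigma> b < 2*p*N" using ok(1)[of b] blkA b by simp
      then show ?thesis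
        using card_row_col_le_of_crossing[OF p d perm inv _ _ _ ab(2)] ok[of a] ok[of b] a b blkA ab that(2) unfolding ta tb
        by blast
    qed
  qed
  then show ?thesis
  proof cases
    case colour_s
    have "min d s * gluing_weight p N d s \<sigma> \<le> (s * ?S) * ?D"
      unfolding gluing_weight_def by (simp add: mult.assoc[symmetric])
    also have "\<dots> \<le> s ^ (p*N) * d ^ (2*p*N + 2*N)"
      by (intro mult_mono colour_s card_row_col_le[OF p d perm]) simp_all
    finally show ?thesis by (simp add: max_weight_def)
  next
    case colour_d
    have "min d s * gluing_weight p N d s \<sigma> \<le> ?S * (d * ?D)"
      unfolding gluing_weight_def by (simp add: mult.left_commute[of d])
    also have "\<dots> \<le> s ^ (p*N) * d ^ (2*p*N + 2*N)"
      by (intro mult_mono colour_d derangement_colourings[OF s \<sigma>(1)]) simp_all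
    finally show ?thesis by (simp add: max_weight_def)
  qed
qed

lemma card_noncrossing_gluings_le:
  assumes "p \<ge> 1"
  shows "real (card (noncrossing_gluings p N)) \<le> catalan p ^ N"
proof -
  let ?r = "\<lambda>\<sigma> q x. if x div (2*p) = q then \<sigma> x else x"
  let ?P = "PiE {..<N} (\<lambda>q. {\<tau>. nc_matching (q * (2*p)) p \<tau>})"
  have "inj_on (\<lambda>\<sigma>. restrict (?r \<sigma>) {..<N}) (noncrossing_gluings p N)"
  proof (rule inj_onI, rule ext)
    fix \<sigma> \<sigma>' x assume *: "\<sigma> \<in> noncrossing_gluings p N" "\<sigma>' \<in> noncrossing_gluings p N"
      and eq: "restrict (?r \<sigma>) {..<N} = restrict (?r \<sigma>') {..<N}"
    show "\<sigma> x = \<sigma>' x"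
    proof (cases "x < 2*p*N")
      case True
      then have "x div (2*p) < N" using block_lt_iff[OF assms] by blast
      then show ?thesis using fun_cong[OF fun_cong[OF eq], of "x div (2*p)" x] by simp
    next
      case False
      then show ?thesis using * by (auto simp: noncrossing_gluings_def derangements_def permutes_def)
    qed
  qed
  moreover have "(\<lambda>\<sigma>. restrict (?r \<sigma>) {..<N}) ` noncrossing_gluings p N \<subseteq> ?P"
    by (auto simp: noncrossing_gluings_def)
  moreover have "finite ?P" by (intro finite_PiE finite_nc_matching) simp_all
  ultimately have "card (noncrossing_gluings p N) \<le> card ?P" by (intro card_inj_on_le)
  then have "real (card (noncrossing_gluings p N)) \<le> real (card ?P)" by simp
  also have "real (card ?P) = (\<Prod>q<N. real (card {\<tau>. nc_matching (q * (2*p)) p \<tau>}))"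
    by (simp add: card_PiE)
  also have "\<dots> = catalan p ^ N" by (simp only: card_nc_matching) simp
  finally show ?thesis .
qed

lemma noncrossing_gluings_1:
  assumes "p \<ge> 1"
  shows "noncrossing_gluings p 1 = {\<tau>. nc_matching 0 p \<tau>}"
proof (intro equalityI subsetI)
  fix \<sigma> assume \<sigma>: "\<sigma> \<in> noncrossing_gluings p 1"
  have "\<sigma> x = x" if "x div (2*p) \<noteq> 0" for x
  proof -
    have "\<not> x < 2*p" using that by (metis div_less)
    then show ?thesis using \<sigma> by (auto simp: noncrossing_gluings_def derangements_def permutes_def)
  qed
  then have "(\<lambda>x. if x div (2*p) = 0 then \<sigma> x else x) = \<sigma>" by auto
  moreover have "nc_matching (0 * (2*p)) p (\<lambda>x. if x div (2*p) = 0 then \<sigma> x else x)"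
    using \<sigma> unfolding noncrossing_gluings_def by blast
  ultimately show "\<sigma> \<in> {\<tau>. nc_matching 0 p \<tau>}" by simp
next
  fix \<tau> assume "\<tau> \<in> {\<tau>. nc_matching 0 p \<tau>}"
  then have nc: "nc_matching 0 p \<tau>" by simp
  have perm: "\<tau> permutes {..<2*p}" using nc_matching_permutes[OF nc] by (simp add: atLeast0LessThan)
  then have "(\<lambda>x. if x div (2*p) = 0 then \<tau> x else x) = \<tau>"
    using assms by (auto simp: fun_eq_iff permutes_def div_eq_0_iff)
  moreover have "\<tau> a \<noteq> a" if "a < 2*p" for a using nc_matching_matches[OF nc, of a] that by auto
  ultimately show "\<tau> \<in> noncrossing_gluings p 1" using perm nc by (auto simp: noncrossing_gluings_def derangements_def)
qed

text \<open>The number of slices is bounded below by the transposition bound read backwards: composing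
  \<open>\<tau>\<close> with itself gives the identity, for which all colourings are invariant.\<close>

lemma gluing_weight_nc_matching:
  assumes p: "p \<ge> 1" and d: "d \<ge> 1" and s: "s \<ge> 1" and nc: "nc_matching 0 p \<tau>"
  shows "gluing_weight p 1 d s \<tau> = max_weight p 1 d s"
proof (rule antisym)
  have \<tau>: "\<tau> \<in> noncrossing_gluings p 1" using nc noncrossing_gluings_1[OF p] by simp
  then have der: "\<tau> \<in> derangements {..<2*p*1}" unfolding noncrossing_gluings_def by blast
  show "gluing_weight p 1 d s \<tau> \<le> max_weight p 1 d s"
    by (rule gluing_weight_le[OF p d s der])
  have perm: "\<tau> permutes {..<2*p}" using der by (simp add: derangements_def)
  have inv: "\<tau> \<circ> \<tau> = id" using nc_matching_involution[OF nc] by auto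
  have "{x. \<tau> x \<noteq> x} \<subseteq> {..<2*p}" using perm by (auto simp: permutes_def)
  then have "card {x. \<tau> x \<noteq> x} \<le> 2 * p" using card_mono[of "{..<2*p}"] by simp
  then have "card (invariant_colourings {..<2*p} s (\<tau> \<circ> \<tau>)) \<le> s ^ p * card (invariant_colourings {..<2*p} s \<tau>)"
    by (intro card_invariant_colourings_involution_le finite_lessThan s perm nc_matching_involution[OF nc])
  moreover have "invariant_colourings {..<2*p} s (\<tau> \<circ> \<tau>) = {..<2*p} \<rightarrow>\<^sub>E {..<s}"
    unfolding inv by (auto simp: invariant_colourings_def)
  ultimately have "s ^ p * s ^ p \<le> s ^ p * card (invariant_colourings {..<2*p} s \<tau>)"
    by (simp add: card_PiE power_add[symmetric] mult_2)
  then have "s ^ p \<le> card (invariant_colourings {..<2*p} s \<tau>)" using s by simp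
  then have "s ^ p * d ^ (2*p + 2) \<le> card (invariant_colourings {..<2*p} s \<tau>) *
      (card (invariant_colourings {..<2*p} d (row_partner p \<circ> \<tau>)) * card (invariant_colourings {..<2*p} d (col_partner \<circ> \<tau>)))"
    by (intro mult_mono card_row_col_ge_of_nc_matching p nc) simp_all
  then show "max_weight p 1 d s \<le> gluing_weight p 1 d s \<tau>"
    by (simp only: max_weight_def gluing_weight_def mult_1_right)
qed

definition gluing_sum :: "nat \<Rightarrow> nat \<Rightarrow> nat \<Rightarrow> nat \<Rightarrow> real" where
  "gluing_sum p N d s = (\<Sum>\<sigma>\<in>derangements {..<2*p*N}. real (gluing_weight p N d s \<sigma>)) / real (max_weight p N d s)"

lemma noncrossing_gluings_subset: "noncrossing_gluings p N \<subseteq> derangements {..<2*p*N}"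
  by (auto simp: noncrossing_gluings_def)

text \<open>Each of the at most \<open>fact (2 * p * N)\<close> derangements outside \<open>noncrossing_gluings\<close> contributes at most
  \<open>1 / min d s\<close> to the remainder.\<close>

lemma gluing_sum_split:
  assumes p: "p \<ge> 1" and d: "d \<ge> 1" and s: "s \<ge> 1"
  obtains r where "gluing_sum p N d s = (\<Sum>\<sigma>\<in>noncrossing_gluings p N. real (gluing_weight p N d s \<sigma>) / real (max_weight p N d s)) + r"
    "0 \<le> r" "r \<le> fact (2*p*N) / real (min d s)"
proof
  let ?D = "derangements {..<2*p*N}" and ?w = "\<lambda>\<sigma>. real (gluing_weight p N d s \<sigma>) / real (max_weight p N d s)"
  let ?r = "\<Sum>\<sigma>\<in>?D - noncrossing_gluings p N. ?w \<sigma>"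
  have fin: "finite ?D" by (simp add: finite_derangements)
  show "gluing_sum p N d s = (\<Sum>\<sigma>\<in>noncrossing_gluings p N. ?w \<sigma>) + ?r"
    unfolding gluing_sum_def sum_divide_distrib
    using sum.subset_diff[OF noncrossing_gluings_subset fin, of ?w] by (simp add: add.commute)
  show "0 \<le> ?r" by (intro sum_nonneg) simp
  have m: "0 < real (max_weight p N d s)" "0 < real (min d s)" using d s by (simp_all add: max_weight_def)
  have "?r \<le> (\<Sum>\<sigma>\<in>?D - noncrossing_gluings p N. 1 / real (min d s))"
  proof (rule sum_mono)
    fix \<sigma> assume "\<sigma> \<in> ?D - noncrossing_gluings p N"
    then have "min d s * gluing_weight p N d s \<sigma> \<le> max_weight p N d s"
      by (intro gluing_weight_loss p d s) auto
    then have "real (min d s) * real (gluing_weight p N d s \<sigma>) \<le> real (max_weight p N d s)"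
      by (metis of_nat_le_iff of_nat_mult)
    then show "?w \<sigma> \<le> 1 / real (min d s)" using m by (simp add: divide_simps mult.commute)
  qed
  also have "\<dots> = real (card (?D - noncrossing_gluings p N)) / real (min d s)" by simp
  also have "\<dots> \<le> fact (2*p*N) / real (min d s)"
  proof (rule divide_right_mono)
    have "card (?D - noncrossing_gluings p N) \<le> card ?D" using fin by (intro card_mono) auto
    also have "\<dots> \<le> fact (2*p*N)" using card_derangements_le[of "{..<2*p*N}"] by simp
    finally have "real (card (?D - noncrossing_gluings p N)) \<le> real (fact (2*p*N))" by (rule of_nat_mono)
    then show "real (card (?D - noncrossing_gluings p N)) \<le> fact (2*p*N)" by simp
  qed simp
  finally show "?r \<le> fact (2*p*N) / real (min d s)" .
qed

lemma gluing_sum_1: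
  assumes "p \<ge> 1" "d \<ge> 1" "s \<ge> 1"
  shows "\<bar>gluing_sum p 1 d s - catalan p\<bar> \<le> fact (2*p) / real (min d s)"
proof -
  obtain r where r: "gluing_sum p 1 d s = (\<Sum>\<sigma>\<in>noncrossing_gluings p 1. real (gluing_weight p 1 d s \<sigma>) / real (max_weight p 1 d s)) + r"
    "0 \<le> r" "r \<le> fact (2*p*1) / real (min d s)" using gluing_sum_split[OF assms] .
  have "max_weight p 1 d s \<noteq> 0" using assms by (simp add: max_weight_def)
  then have "(\<Sum>\<sigma>\<in>noncrossing_gluings p 1. real (gluing_weight p 1 d s \<sigma>) / real (max_weight p 1 d s)) = (\<Sum>\<sigma>\<in>noncrossing_gluings p 1. 1)"
    using gluing_weight_nc_matching[OF assms] noncrossing_gluings_1[OF assms(1)] by (intro sum.cong) auto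
  also have "\<dots> = real (card (noncrossing_gluings p 1))" by simp
  also have "\<dots> = catalan p" unfolding noncrossing_gluings_1[OF assms(1)] by (rule card_nc_matching)
  finally show ?thesis using r by simp
qed

lemma gluing_sum_le:
  assumes "p \<ge> 1" "d \<ge> 1" "s \<ge> 1"
  shows "gluing_sum p N d s \<le> catalan p ^ N + fact (2*p*N) / real (min d s)"
proof -
  obtain r where r: "gluing_sum p N d s = (\<Sum>\<sigma>\<in>noncrossing_gluings p N. real (gluing_weight p N d s \<sigma>) / real (max_weight p N d s)) + r"
    "0 \<le> r" "r \<le> fact (2*p*N) / real (min d s)" using gluing_sum_split[OF assms] .
  have m: "0 < real (max_weight p N d s)" using assms by (simp add: max_weight_def)
  have "(\<Sum>\<sigma>\<in>noncrossing_gluings p N. real (gluing_weight p N d s \<sigma>) / real (max_weight p N d s)) \<le> (\<Sum>\<sigma>\<in>noncrossing_gluings p N. 1)"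
  proof (rule sum_mono)
    fix \<sigma> assume "\<sigma> \<in> noncrossing_gluings p N"
    then have "gluing_weight p N d s \<sigma> \<le> max_weight p N d s"
      using noncrossing_gluings_subset by (intro gluing_weight_le assms) blast
    then show "real (gluing_weight p N d s \<sigma>) / real (max_weight p N d s) \<le> 1" using m by simp
  qed
  also have "\<dots> \<le> catalan p ^ N" using card_noncrossing_gluings_le[OF assms(1)] by simp
  finally show ?thesis using r by simp
qed

section \<open>Matchings of equal values\<close>

text \<open>The permutations that match equal values of \<open>e\<close> and \<open>f\<close> factor over the level sets.  The
  induction on \<open>A\<close> chooses the image \<open>b\<close> of the new point \<open>a\<close> and removes it from the
  level set of \<open>f\<close>; this is the same recursion that governs Gaussian moments.\<close>

lemma card_matching_permutations:
  assumes "finite A" "finite I" "e ` A \<subseteq> I" "f ` A \<subseteq> I"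
  shows "card {\<sigma>. \<sigma> permutes A \<and> (\<forall>a\<in>A. e a = f (\<sigma> a))} =
    (\<Prod>x\<in>I. if card {a\<in>A. e a = x} = card {a\<in>A. f a = x} then fact (card {a\<in>A. e a = x}) else 0)"
  using assms(1,3,4)
proof (induction A arbitrary: f rule: finite_induct)
  case empty
  have "{\<sigma>. \<sigma> permutes {} \<and> (\<forall>a\<in>{}. e a = f (\<sigma> a))} = {id}" by auto
  then have "card {\<sigma>. \<sigma> permutes {} \<and> (\<forall>a\<in>{}. e a = f (\<sigma> a))} = 1"
    by (simp only: is_singletonI is_singleton_altdef[symmetric])
  then show ?case by (simp only: empty_iff simp_thms Collect_empty_eq) simp
next
  case (insert a A)
  define c where "c = e a"
  define m where "m x = card {y\<in>A. e y = x}" for x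
  define n where "n x = card {y\<in>insert a A. f y = x}" for x
  define B where "B = {b\<in>insert a A. f b = c}"
  let ?P = "\<lambda>b. {\<sigma>. \<sigma> permutes A \<and> (\<forall>y\<in>A. e y = (f \<circ> Transposition.transpose a b) (\<sigma> y))}"
  let ?g = "\<lambda>k x. if m x = k then fact (m x) else (0::nat)"
  have finB: "finite B" using insert(1) by (simp add: B_def)
  have "bij_betw (\<lambda>(b, \<sigma>). Transposition.transpose a b \<circ> \<sigma>) (Sigma B ?P)
      {\<sigma>. \<sigma> permutes insert a A \<and> (\<forall>y\<in>insert a A. e y = f (\<sigma> y))}"
  proof (rule bij_betw_byWitness[where f' = "\<lambda>\<sigma>. (\<sigma> a, Transposition.transpose a (\<sigma> a) \<circ> \<sigma>)"])
    show "\<forall>x\<in>Sigma B ?P. (\<lambda>\<sigma>. (\<sigma> a, Transposition.transpose a (\<sigma> a) \<circ> \<sigma>)) ((\<lambda>(b, \<sigma>). Transposition.transpose a b \<circ> \<sigma>) x) = x"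
      using insert(2) by (auto simp: permutes_not_in fun_eq_iff)
    show "\<forall>x\<in>{\<sigma>. \<sigma> permutes insert a A \<and> (\<forall>y\<in>insert a A. e y = f (\<sigma> y))}.
       (\<lambda>(b, \<sigma>). Transposition.transpose a b \<circ> \<sigma>) ((\<lambda>\<sigma>. (\<sigma> a, Transposition.transpose a (\<sigma> a) \<circ> \<sigma>)) x) = x"
      by (auto simp: fun_eq_iff)
    show "(\<lambda>(b, \<sigma>). Transposition.transpose a b \<circ> \<sigma>) ` Sigma B ?P \<subseteq>
       {\<sigma>. \<sigma> permutes insert a A \<and> (\<forall>y\<in>insert a A. e y = f (\<sigma> y))}"
    proof (rule image_subsetI)
      fix x assume "x \<in> Sigma B ?P"
      then obtain b \<sigma> where x: "x = (b, \<sigma>)" and b: "b \<in> B" and \<sigma>: "\<sigma> permutes A"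
        and eq: "\<forall>y\<in>A. e y = (f \<circ> Transposition.transpose a b) (\<sigma> y)" by blast
      have "\<sigma> a = a" using insert(2) \<sigma> by (simp add: permutes_not_in)
      moreover have "Transposition.transpose a b \<circ> \<sigma> permutes insert a A"
        using b \<sigma> by (intro permutes_compose[of _ "insert a A"] permutes_swap_id)
          (auto simp: B_def intro: permutes_subset)
      ultimately show "(\<lambda>(b, \<sigma>). Transposition.transpose a b \<circ> \<sigma>) x \<in>
          {\<sigma>. \<sigma> permutes insert a A \<and> (\<forall>y\<in>insert a A. e y = f (\<sigma> y))}"
        using b eq by (auto simp: x B_def c_def)
    qed
    show "(\<lambda>\<sigma>. (\<sigma> a, Transposition.transpose a (\<sigma> a) \<circ> \<sigma>)) ` {\<sigma>. \<sigma> permutes insert a A \<and> (\<forall>y\<in>insert a A. e y = f (\<sigma> y))}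
      \<subseteq> Sigma B ?P"
    proof (rule image_subsetI)
      fix \<sigma> assume "\<sigma> \<in> {\<sigma>. \<sigma> permutes insert a A \<and> (\<forall>y\<in>insert a A. e y = f (\<sigma> y))}"
      then have \<sigma>: "\<sigma> permutes insert a A" and eq: "\<forall>y\<in>insert a A. e y = f (\<sigma> y)" by simp_all
      have "\<sigma> a \<in> insert a A" using permutes_in_image[OF \<sigma>, of a] by blast
      then show "(\<sigma> a, Transposition.transpose a (\<sigma> a) \<circ> \<sigma>) \<in> Sigma B ?P"
        using permutes_insert_lemma[OF \<sigma>] eq by (auto simp: B_def c_def)
    qed
  qed
  then have "card {\<sigma>. \<sigma> permutes insert a A \<and> (\<forall>y\<in>insert a A. e y = f (\<sigma> y))} = card (Sigma B ?P)"
    by (rule bij_betw_same_card[symmetric])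
  also have "\<dots> = (\<Sum>b\<in>B. card (?P b))"
    using finB finite_permutations[OF insert(1)]
    by (intro card_SigmaI) (auto intro: finite_subset[of _ "{\<sigma>. \<sigma> permutes A}"])
  also have "\<dots> = (\<Sum>b\<in>B. \<Prod>x\<in>I. ?g (if x = c then n x - 1 else n x) x)"
  proof (rule sum.cong)
    fix b assume b: "b \<in> B"
    let ?t = "Transposition.transpose a b"
    have "?t ` insert a A = insert a A" using b by (intro transpose_image_eq) (auto simp: B_def)
    moreover have "?t ` (insert a A - {a}) = ?t ` insert a A - ?t ` {a}"
      by (rule image_set_diff[OF inj_transpose])
    ultimately have tA: "?t ` A = insert a A - {b}" using insert(2) by simp
    have "(f \<circ> ?t) ` A \<subseteq> I" unfolding image_comp[symmetric] tA using insert.prems(2) by auto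
    then have "card (?P b) = (\<Prod>x\<in>I. if m x = card {y\<in>A. (f \<circ> ?t) y = x} then fact (m x) else 0)"
      unfolding m_def using insert.prems(1) by (intro insert.IH) auto
    also have "\<dots> = (\<Prod>x\<in>I. ?g (if x = c then n x - 1 else n x) x)"
    proof (rule prod.cong)
      fix x assume "x \<in> I"
      have "{y\<in>insert a A - {b}. f y = x} = ?t ` {y\<in>A. (f \<circ> ?t) y = x}"
        unfolding tA[symmetric] by auto
      then have "card {y\<in>A. (f \<circ> ?t) y = x} = card {y\<in>insert a A - {b}. f y = x}"
        using card_image[OF inj_on_subset[OF inj_transpose]] by (metis subset_UNIV)
      also have "{y\<in>insert a A - {b}. f y = x} = {y\<in>insert a A. f y = x} - {b}" by auto
      also have "card \<dots> = (if x = c then n x - 1 else n x)"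
        using b insert(1) by (auto simp: n_def B_def card_Diff_singleton_if)
      finally show "(if m x = card {y\<in>A. (f \<circ> ?t) y = x} then fact (m x) else 0) = ?g (if x = c then n x - 1 else n x) x"
        by simp
    qed simp
    finally show "card (?P b) = (\<Prod>x\<in>I. ?g (if x = c then n x - 1 else n x) x)" .
  qed simp
  also have "\<dots> = n c * (\<Prod>x\<in>I. ?g (if x = c then n x - 1 else n x) x)"
    by (simp add: B_def n_def)
  also have "\<dots> = n c * (?g (n c - 1) c * (\<Prod>x\<in>I-{c}. ?g (n x) x))"
  proof -
    let ?h = "\<lambda>x. ?g (if x = c then n x - 1 else n x) x"
    have "c \<in> I" using insert.prems(1) by (simp add: c_def)
    then have e1: "prod ?h I = ?h c * prod ?h (I - {c})" by (rule prod.remove[OF assms(2)])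
    have e2: "prod ?h (I - {c}) = (\<Prod>x\<in>I-{c}. ?g (n x) x)"
      by (rule prod.cong[OF refl]) (simp only: if_False Diff_iff singleton_iff)
    have e3: "?h c = ?g (n c - 1) c" by (simp only: if_True simp_thms)
    show ?thesis unfolding e1 e2 e3 by (rule refl)
  qed
  also have "\<dots> = (if Suc (m c) = n c then fact (Suc (m c)) else 0) * (\<Prod>x\<in>I-{c}. ?g (n x) x)"
    by (cases "n c") (auto simp: algebra_simps)
  also have "\<dots> = (\<Prod>x\<in>I. if card {y\<in>insert a A. e y = x} = n x then fact (card {y\<in>insert a A. e y = x}) else 0)"
  proof -
    have "{y\<in>insert a A. e y = x} = (if x = c then insert a {y\<in>A. e y = x} else {y\<in>A. e y = x})" for x
      by (auto simp: c_def)
    then have card_eq: "card {y\<in>insert a A. e y = x} = (if x = c then Suc (m x) else m x)" for x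
      using insert(1,2) by (simp add: m_def)
    let ?h = "\<lambda>x. if card {y\<in>insert a A. e y = x} = n x then fact (card {y\<in>insert a A. e y = x}) else 0"
    have "c \<in> I" using insert.prems(1) by (simp add: c_def)
    then have e1: "prod ?h I = ?h c * prod ?h (I - {c})" by (rule prod.remove[OF assms(2)])
    have e2: "prod ?h (I - {c}) = (\<Prod>x\<in>I-{c}. ?g (n x) x)"
      by (rule prod.cong[OF refl]) (simp only: card_eq DiffE singletonI if_False Diff_iff singleton_iff)
    have e3: "?h c = (if Suc (m c) = n c then fact (Suc (m c)) else 0)" by (simp only: card_eq if_True simp_thms)
    show ?thesis unfolding e1 e2 e3 by (rule refl)
  qed
  finally show ?case by (simp add: n_def)
qed

section \<open>Moments of a complex Gaussian variable\<close>

text \<open>The moments of the real normal law with mean \<open>0\<close> and variance \<open>1 / 2\<close>.\<close>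

definition half_normal_moment :: "nat \<Rightarrow> real" where
  "half_normal_moment k = (if even k then fact k / (4 ^ (k div 2) * fact (k div 2)) else 0)"

lemma half_normal_moment_Suc:
  "half_normal_moment (Suc k) = real k / 2 * half_normal_moment (k - 1)"
proof (cases "even k")
  case True
  then show ?thesis by (cases k) (simp_all add: half_normal_moment_def)
next
  case False
  then obtain j where k: "k = 2 * j + 1" by (auto elim: oddE)
  have "(fact (2 * Suc j) :: real) = 2 * real (Suc j) * real k * fact (2 * j)" by (simp add: k algebra_simps)
  moreover have "(fact (Suc j) :: real) = real (Suc j) * fact j" by simp
  moreover have "(4 :: real) ^ Suc j = 4 * 4 ^ j" by simp
  moreover have "half_normal_moment (Suc k) = fact (2 * Suc j) / (4 ^ Suc j * fact (Suc j))"
    by (simp add: k half_normal_moment_def del: fact_Suc)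
  ultimately have "half_normal_moment (Suc k) = 2 * real (Suc j) * real k * fact (2 * j) / (4 * 4 ^ j * (real (Suc j) * fact j))"
    by (simp only:)
  also have "\<dots> = real k / 2 * (fact (2 * j) / (4 ^ j * fact j))"
    by (simp add: divide_simps del: of_nat_Suc)
  finally show ?thesis by (simp add: k half_normal_moment_def)
qed

lemma has_bochner_integral_half_normal_moment:
  fixes X :: "'w \<Rightarrow> real"
  assumes "distributed M lborel X (\<lambda>x. ennreal (normal_density 0 (1 / sqrt 2) x))"
  shows "has_bochner_integral M (\<lambda>w. X w ^ k) (half_normal_moment k)"
proof -
  have hb: "has_bochner_integral lborel (\<lambda>x. normal_density 0 (1 / sqrt 2) x * x ^ k) (half_normal_moment k)"
  proof (cases "even k")
    case True
    then obtain j where k: "k = 2 * j" by (auto elim: evenE)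
    have "2 / (1 / sqrt 2)\<^sup>2 = (4 :: real)" by (simp add: power_divide)
    moreover have "has_bochner_integral lborel (\<lambda>x. normal_density 0 (1 / sqrt 2) x * (x - 0) ^ (2 * j))
        (fact (2 * j) / ((2 / (1 / sqrt 2)\<^sup>2) ^ j * fact j))" by (rule normal_moment_even) simp
    ultimately show ?thesis by (simp only: k half_normal_moment_def) simp
  next
    case False
    then obtain j where k: "k = 2 * j + 1" by (auto elim: oddE)
    have "has_bochner_integral lborel (\<lambda>x. normal_density 0 (1 / sqrt 2) x * (x - 0) ^ (2 * j + 1)) 0"
      by (rule normal_moment_odd) simp
    then show ?thesis by (simp add: k half_normal_moment_def)
  qed
  have "integrable M (\<lambda>w. X w ^ k)"
    using distributed_integrable[OF assms, of "\<lambda>x. x ^ k"] hb by (simp add: has_bochner_integral_iff)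
  moreover have "(\<integral>w. X w ^ k \<partial>M) = half_normal_moment k"
    using distributed_integral[OF assms, of "\<lambda>x. x ^ k"] hb by (simp add: has_bochner_integral_iff)
  ultimately show ?thesis by (simp add: has_bochner_integral_iff)
qed

text \<open>The expectation of \<open>x ^ m * y ^ n * z ^ a * cnj z ^ b\<close> for \<open>z = x + \<i> y\<close> with independent
  \<open>x\<close> and \<open>y\<close> of the law above, computed by expanding the powers of \<open>z\<close> and \<open>cnj z\<close> one at a time.
  The powers of \<open>x\<close> and \<open>y\<close> are carried along because integration by parts concerns the real
  variables.\<close>

fun mixed_moment :: "nat \<Rightarrow> nat \<Rightarrow> nat \<Rightarrow> nat \<Rightarrow> complex" where
  "mixed_moment m n 0 0 = complex_of_real (half_normal_moment m * half_normal_moment n)"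
| "mixed_moment m n 0 (Suc b) = mixed_moment (Suc m) n 0 b - \<i> * mixed_moment m (Suc n) 0 b"
| "mixed_moment m n (Suc a) b = mixed_moment (Suc m) n a b + \<i> * mixed_moment m (Suc n) a b"

text \<open>Gaussian integration by parts in \<open>x\<close> and in \<open>y\<close>: the expectation of \<open>x * F\<close> is half that
  of the partial derivative of \<open>F\<close> in \<open>x\<close>.\<close>

lemma mixed_moment_by_parts:
  "2 * mixed_moment (Suc m) n a b = of_nat m * mixed_moment (m - 1) n a b
     + of_nat a * mixed_moment m n (a - 1) b + of_nat b * mixed_moment m n a (b - 1)"
  "2 * mixed_moment m (Suc n) a b = of_nat n * mixed_moment m (n - 1) a b
     + \<i> * of_nat a * mixed_moment m n (a - 1) b - \<i> * of_nat b * mixed_moment m n a (b - 1)"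
proof (induction m n a b rule: mixed_moment.induct)
  case (1 m n)
  {
    case 1
    show ?case by (simp add: half_normal_moment_Suc)
  next
    case 2
    show ?case by (simp add: half_normal_moment_Suc)
  }
next
  case (2 m n b)
  note IH = this
  {
    case 1
    have "2 * mixed_moment (Suc m) n 0 (Suc b) =
        2 * mixed_moment (Suc (Suc m)) n 0 b - \<i> * (2 * mixed_moment (Suc m) (Suc n) 0 b)"
      by (simp add: algebra_simps)
    then show ?case unfolding IH(1,3) by (cases m; cases b) (simp_all add: algebra_simps)
  next
    case 2
    have "2 * mixed_moment m (Suc n) 0 (Suc b) =
        2 * mixed_moment (Suc m) (Suc n) 0 b - \<i> * (2 * mixed_moment m (Suc (Suc n)) 0 b)"
      by (simp add: algebra_simps)
    then show ?case unfolding IH(2,4) by (cases n; cases b) (simp_all add: algebra_simps)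
  }
next
  case (3 m n a b)
  note IH = this
  {
    case 1
    have "2 * mixed_moment (Suc m) n (Suc a) b =
        2 * mixed_moment (Suc (Suc m)) n a b + \<i> * (2 * mixed_moment (Suc m) (Suc n) a b)"
      by (simp add: algebra_simps)
    then show ?case unfolding IH(1,3) by (cases m; cases a) (simp_all add: algebra_simps)
  next
    case 2
    have "2 * mixed_moment m (Suc n) (Suc a) b =
        2 * mixed_moment (Suc m) (Suc n) a b + \<i> * (2 * mixed_moment m (Suc (Suc n)) a b)"
      by (simp add: algebra_simps)
    then show ?case unfolding IH(2,4) by (cases n; cases a) (simp_all add: algebra_simps)
  }
qed

text \<open>Combining the two integrations by parts, the expectation of \<open>z * F\<close> is that of the derivative of
  \<open>F\<close> with respect to \<open>cnj z\<close>, which lowers both exponents by one.\<close>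

lemma mixed_moment_00: "mixed_moment 0 0 a b = (if a = b then fact a else 0)"
proof (induction a arbitrary: b)
  case 0
  show ?case
  proof (cases b)
    case 0
    then show ?thesis by (simp add: half_normal_moment_def)
  next
    case (Suc c)
    have "2 * mixed_moment 0 0 0 b = 2 * mixed_moment (Suc 0) 0 0 c - \<i> * (2 * mixed_moment 0 (Suc 0) 0 c)"
      by (simp add: Suc algebra_simps)
    also have "\<dots> = 0" unfolding mixed_moment_by_parts by (simp add: algebra_simps flip: mult.assoc)
    finally show ?thesis using Suc by simp
  qed
next
  case (Suc a)
  have "2 * mixed_moment 0 0 (Suc a) b = 2 * mixed_moment (Suc 0) 0 a b + \<i> * (2 * mixed_moment 0 (Suc 0) a b)"
    by (simp add: algebra_simps)
  also have "\<dots> = 2 * (of_nat b * mixed_moment 0 0 a (b - 1))"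
    unfolding mixed_moment_by_parts by (simp add: algebra_simps flip: mult.assoc)
  finally have "mixed_moment 0 0 (Suc a) b = of_nat b * mixed_moment 0 0 a (b - 1)"
    by (simp only: mult_cancel_left) simp
  then show ?case using Suc[of "b - 1"] by (cases b) auto
qed

lemma has_bochner_integral_mixed_moment:
  assumes "prob_space M" "std_complex_gaussian M Z"
  shows "has_bochner_integral M (\<lambda>w. complex_of_real (Re (Z w) ^ m * Im (Z w) ^ n) * Z w ^ a * cnj (Z w) ^ b)
    (mixed_moment m n a b)"
proof (induction m n a b rule: mixed_moment.induct)
  case (1 m n)
  interpret prob_space M by fact
  note d = assms(2)[unfolded std_complex_gaussian_def]
  note hb = has_bochner_integral_half_normal_moment[OF d[THEN conjunct1], of m]
     has_bochner_integral_half_normal_moment[OF d[THEN conjunct2, THEN conjunct1], of n]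
  have ind: "indep_var borel (\<lambda>w. Re (Z w) ^ m) borel (\<lambda>w. Im (Z w) ^ n)"
    using indep_var_compose[of borel "\<lambda>w. Re (Z w)" borel "\<lambda>w. Im (Z w)" "\<lambda>x. x ^ m" borel "\<lambda>x. x ^ n" borel] d
    by (simp add: comp_def)
  have "has_bochner_integral M (\<lambda>w. Re (Z w) ^ m * Im (Z w) ^ n) (half_normal_moment m * half_normal_moment n)"
    using hb indep_var_integrable[OF ind] indep_var_lebesgue_integral[OF ind] by (simp add: has_bochner_integral_iff)
  then show ?case by (simp add: has_bochner_integral_of_real del: of_real_mult)
next
  case (2 m n b)
  have "complex_of_real (Re z ^ m * Im z ^ n) * z ^ 0 * cnj z ^ Suc b =
    complex_of_real (Re z ^ Suc m * Im z ^ n) * z ^ 0 * cnj z ^ b - \<i> * (complex_of_real (Re z ^ m * Im z ^ Suc n) * z ^ 0 * cnj z ^ b)" for z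
  proof -
    have "cnj z = complex_of_real (Re z) - \<i> * complex_of_real (Im z)" by (simp add: complex_eq_iff)
    then have "cnj z ^ Suc b = (complex_of_real (Re z) - \<i> * complex_of_real (Im z)) * cnj z ^ b" by simp
    then show ?thesis by (simp only:) (simp add: algebra_simps)
  qed
  then show ?case
    using has_bochner_integral_diff[OF 2(1) has_bochner_integral_mult_right[OF 2(2), of "\<i>"]] by simp
next
  case (3 m n a b)
  have "complex_of_real (Re z ^ m * Im z ^ n) * z ^ Suc a * cnj z ^ b =
    complex_of_real (Re z ^ Suc m * Im z ^ n) * z ^ a * cnj z ^ b + \<i> * (complex_of_real (Re z ^ m * Im z ^ Suc n) * z ^ a * cnj z ^ b)" for z
  proof -
    have "z ^ Suc a = (complex_of_real (Re z) + \<i> * complex_of_real (Im z)) * z ^ a" using complex_eq[of z] by simp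
    then show ?thesis by (simp only:) (simp add: algebra_simps)
  qed
  then show ?case
    using has_bochner_integral_add[OF 3(1) has_bochner_integral_mult_right[OF 3(2), of "\<i>"]] by simp
qed

lemma std_complex_gaussian_moment:
  assumes "prob_space M" "std_complex_gaussian M Z"
  shows "has_bochner_integral M (\<lambda>w. Z w ^ a * cnj (Z w) ^ b) (if a = b then fact a else 0)"
  using has_bochner_integral_mixed_moment[OF assms, of 0 0 a b] by (simp add: mixed_moment_00)

section \<open>The Wick formula\<close>

text \<open>Collecting equal variables turns the product into independent factors \<open>z ^ m * cnj z ^ n\<close>, whose
  moments multiply to the number of matchings.\<close>

lemma (in prob_space) gaussian_wick:
  fixes e f :: "'k \<Rightarrow> 'i" and Z :: "'i \<Rightarrow> _ \<Rightarrow> complex"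
  assumes A: "finite A" and I: "finite I" and ef: "e ` A \<subseteq> I" "f ` A \<subseteq> I"
    and ind: "indep_vars (\<lambda>_. borel) Z I" and g: "\<And>x. x \<in> I \<Longrightarrow> std_complex_gaussian M (Z x)"
  shows "has_bochner_integral M (\<lambda>w. \<Prod>a\<in>A. Z (e a) w * cnj (Z (f a) w))
    (of_nat (card {\<sigma>. \<sigma> permutes A \<and> (\<forall>a\<in>A. e a = f (\<sigma> a))}))"
proof -
  define m n where "m x = card {a\<in>A. e a = x}" and "n x = card {a\<in>A. f a = x}" for x
  have eq: "(\<Prod>a\<in>A. Z (e a) w * cnj (Z (f a) w)) = (\<Prod>x\<in>I. Z x w ^ m x * cnj (Z x w) ^ n x)" for w
  proof -
    have "(\<Prod>a\<in>A. Z (e a) w) = (\<Prod>x\<in>I. Z x w ^ m x)"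
      by (subst prod.group[OF A I ef(1), symmetric]) (simp add: m_def)
    moreover have "(\<Prod>a\<in>A. cnj (Z (f a) w)) = (\<Prod>x\<in>I. cnj (Z x w) ^ n x)"
      by (subst prod.group[OF A I ef(2), symmetric]) (simp add: n_def)
    ultimately show ?thesis by (simp add: prod.distrib)
  qed
  have hb: "has_bochner_integral M (\<lambda>w. Z x w ^ m x * cnj (Z x w) ^ n x) (if m x = n x then fact (m x) else 0)"
    if "x \<in> I" for x
    by (rule std_complex_gaussian_moment[OF prob_space_axioms g[OF that]])
  have ind': "indep_vars (\<lambda>_. borel) (\<lambda>x w. Z x w ^ m x * cnj (Z x w) ^ n x) I"
    by (rule indep_vars_compose2[OF ind, where Y = "\<lambda>x z. z ^ m x * cnj z ^ n x"])
       (intro borel_measurable_continuous_onI continuous_intros)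
  have "has_bochner_integral M (\<lambda>w. \<Prod>x\<in>I. Z x w ^ m x * cnj (Z x w) ^ n x)
    (\<Prod>x\<in>I. if m x = n x then fact (m x) else 0)"
    using indep_vars_integrable[OF I ind'] indep_vars_lebesgue_integral[OF I ind'] hb
    by (simp add: has_bochner_integral_iff)
  moreover have "(\<Prod>x\<in>I. if m x = n x then fact (m x) else 0) =
      (of_nat (card {\<sigma>. \<sigma> permutes A \<and> (\<forall>a\<in>A. e a = f (\<sigma> a))}) :: complex)"
    unfolding card_matching_permutations[OF A I ef] m_def n_def
    by (simp add: of_nat_prod if_distrib[of of_nat] cong: if_cong)
  ultimately show ?thesis by (simp only: eq)
qed

lemma prod_of_bool:
  "finite A \<Longrightarrow> (\<Prod>a\<in>A. of_bool (P a)) = (of_bool (\<forall>a\<in>A. P a) :: 'b :: comm_semiring_1)"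
  by (induction A rule: finite_induct) auto

text \<open>Expanding the differences leaves, for each permutation \<open>\<sigma>\<close>, the signed sum over all
  \<open>B \<subseteq> A\<close> that contain the points moved by \<open>\<sigma>\<close>.  It cancels as soon as \<open>\<sigma>\<close> has
  a fixed point.\<close>

lemma (in prob_space) gaussian_wick_centred:
  fixes e f :: "'k \<Rightarrow> 'i" and Z :: "'i \<Rightarrow> _ \<Rightarrow> complex"
  assumes A: "finite A" and I: "finite I" and ef: "e ` A \<subseteq> I" "f ` A \<subseteq> I"
    and ind: "indep_vars (\<lambda>_. borel) Z I" and g: "\<And>x. x \<in> I \<Longrightarrow> std_complex_gaussian M (Z x)"
  shows "has_bochner_integral M (\<lambda>w. \<Prod>a\<in>A. Z (e a) w * cnj (Z (f a) w) - of_bool (e a = f a))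
    (\<Sum>\<sigma>\<in>derangements A. of_bool (\<forall>a\<in>A. e a = f (\<sigma> a)))"
proof -
  let ?S = "{\<sigma>. \<sigma> permutes A}"
  let ?P = "\<lambda>B. {\<sigma>. \<sigma> permutes B \<and> (\<forall>a\<in>B. e a = f (\<sigma> a))}"
  let ?c = "\<lambda>B. \<Prod>a\<in>A-B. - of_bool (e a = f a) :: complex"
  have finS: "finite ?S" by (rule finite_permutations[OF A])
  have expand: "(\<Prod>a\<in>A. Z (e a) w * cnj (Z (f a) w) - of_bool (e a = f a)) =
      (\<Sum>B\<in>Pow A. (\<Prod>a\<in>B. Z (e a) w * cnj (Z (f a) w)) * ?c B)" for w
    using prod_add[OF A, of "\<lambda>a. Z (e a) w * cnj (Z (f a) w)" "\<lambda>a. - of_bool (e a = f a)"] by simp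
  have hb: "has_bochner_integral M (\<lambda>w. \<Sum>B\<in>Pow A. (\<Prod>a\<in>B. Z (e a) w * cnj (Z (f a) w)) * ?c B)
      (\<Sum>B\<in>Pow A. of_nat (card (?P B)) * ?c B)"
  proof (intro has_bochner_integral_sum has_bochner_integral_mult_left)
    fix B assume "B \<in> Pow A"
    then show "has_bochner_integral M (\<lambda>w. \<Prod>a\<in>B. Z (e a) w * cnj (Z (f a) w)) (of_nat (card (?P B)))"
      using A ef by (intro gaussian_wick[OF _ I _ _ ind g]) (auto intro: finite_subset)
  qed
  have "(\<Sum>B\<in>Pow A. of_nat (card (?P B)) * ?c B) =
      (\<Sum>B\<in>Pow A. \<Sum>\<sigma>\<in>?S. (\<Prod>a\<in>B. of_bool (e a = f (\<sigma> a))) * (\<Prod>a\<in>A-B. - of_bool (\<sigma> a = a \<and> e a = f (\<sigma> a))))"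
  proof (rule sum.cong)
    fix B assume B: "B \<in> Pow A"
    then have finB: "finite B" using A finite_subset by auto
    have "?P B = {\<sigma>\<in>?S. \<sigma> permutes B \<and> (\<forall>a\<in>B. e a = f (\<sigma> a))}"
      using B by (auto intro: permutes_subset)
    then have "of_nat (card (?P B)) = (\<Sum>\<sigma>\<in>?S. of_bool (\<sigma> permutes B \<and> (\<forall>a\<in>B. e a = f (\<sigma> a))) :: complex)"
      using finS by (simp add: Int_def sum.If_cases of_bool_def)
    then have "of_nat (card (?P B)) * ?c B = (\<Sum>\<sigma>\<in>?S. of_bool (\<sigma> permutes B \<and> (\<forall>a\<in>B. e a = f (\<sigma> a))) * ?c B)"
      by (simp add: sum_distrib_right)
    also have "\<dots> = (\<Sum>\<sigma>\<in>?S. (\<Prod>a\<in>B. of_bool (e a = f (\<sigma> a))) * (\<Prod>a\<in>A-B. - of_bool (\<sigma> a = a \<and> e a = f (\<sigma> a))))"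
    proof (rule sum.cong)
      fix \<sigma> assume "\<sigma> \<in> ?S"
      then have \<sigma>: "\<sigma> permutes A" by simp
      have B_iff: "\<sigma> permutes B \<longleftrightarrow> (\<forall>a\<in>A-B. \<sigma> a = a)"
        using permutes_superset[OF \<sigma>] by (auto simp: permutes_not_in)
      have pB: "(\<Prod>a\<in>B. of_bool (e a = f (\<sigma> a)) :: complex) = of_bool (\<forall>a\<in>B. e a = f (\<sigma> a))"
        by (rule prod_of_bool[OF finB])
      show "of_bool (\<sigma> permutes B \<and> (\<forall>a\<in>B. e a = f (\<sigma> a))) * ?c B =
        (\<Prod>a\<in>B. of_bool (e a = f (\<sigma> a))) * (\<Prod>a\<in>A-B. - of_bool (\<sigma> a = a \<and> e a = f (\<sigma> a)))"
      proof (cases "\<sigma> permutes B")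
        case True
        then have "(\<Prod>a\<in>A-B. - of_bool (\<sigma> a = a \<and> e a = f (\<sigma> a))) = ?c B"
          by (intro prod.cong) (auto simp: permutes_not_in)
        then show ?thesis using True pB by simp
      next
        case False
        then have "(\<Prod>a\<in>A-B. - of_bool (\<sigma> a = a \<and> e a = f (\<sigma> a)) :: complex) = 0"
          using A B_iff by (intro prod_zero) auto
        then show ?thesis using False by simp
      qed
    qed simp
    finally show "of_nat (card (?P B)) * ?c B =
      (\<Sum>\<sigma>\<in>?S. (\<Prod>a\<in>B. of_bool (e a = f (\<sigma> a))) * (\<Prod>a\<in>A-B. - of_bool (\<sigma> a = a \<and> e a = f (\<sigma> a))))" .
  qed simp
  \<comment> \<open>for fixed \<open>\<sigma>\<close>, the sum over \<open>B\<close> is again an expanded product\<close>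
  also have "\<dots> = (\<Sum>\<sigma>\<in>?S. \<Prod>a\<in>A. of_bool (e a = f (\<sigma> a)) - of_bool (\<sigma> a = a \<and> e a = f (\<sigma> a)))"
  proof (subst sum.swap, intro sum.cong refl)
    fix \<sigma>
    show "(\<Sum>B\<in>Pow A. (\<Prod>a\<in>B. of_bool (e a = f (\<sigma> a))) * (\<Prod>a\<in>A-B. - of_bool (\<sigma> a = a \<and> e a = f (\<sigma> a)))) =
      (\<Prod>a\<in>A. of_bool (e a = f (\<sigma> a)) - of_bool (\<sigma> a = a \<and> e a = f (\<sigma> a)) :: complex)"
      using prod_add[OF A, of "\<lambda>a. of_bool (e a = f (\<sigma> a)) :: complex" "\<lambda>a. - of_bool (\<sigma> a = a \<and> e a = f (\<sigma> a))"] by simp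
  qed
  also have "\<dots> = (\<Sum>\<sigma>\<in>?S. if \<forall>a\<in>A. \<sigma> a \<noteq> a then of_bool (\<forall>a\<in>A. e a = f (\<sigma> a)) else 0)"
  proof (intro sum.cong refl)
    fix \<sigma>
    have "(\<Prod>a\<in>A. of_bool (e a = f (\<sigma> a)) - of_bool (\<sigma> a = a \<and> e a = f (\<sigma> a)) :: complex) =
      (\<Prod>a\<in>A. of_bool (e a = f (\<sigma> a) \<and> \<sigma> a \<noteq> a))"
      by (intro prod.cong) (auto simp: of_bool_def)
    also have "\<dots> = of_bool (\<forall>a\<in>A. e a = f (\<sigma> a) \<and> \<sigma> a \<noteq> a)" by (rule prod_of_bool[OF A])
    also have "\<dots> = (if \<forall>a\<in>A. \<sigma> a \<noteq> a then of_bool (\<forall>a\<in>A. e a = f (\<sigma> a)) else 0)"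
      by (cases "\<forall>a\<in>A. \<sigma> a \<noteq> a") (auto simp: of_bool_def)
    finally show "(\<Prod>a\<in>A. of_bool (e a = f (\<sigma> a)) - of_bool (\<sigma> a = a \<and> e a = f (\<sigma> a)) :: complex) =
      (if \<forall>a\<in>A. \<sigma> a \<noteq> a then of_bool (\<forall>a\<in>A. e a = f (\<sigma> a)) else 0)" .
  qed
  also have "\<dots> = (\<Sum>\<sigma>\<in>derangements A. of_bool (\<forall>a\<in>A. e a = f (\<sigma> a)))"
    using finS by (simp add: derangements_def sum.inter_filter[symmetric])
  finally show ?thesis using hb by (simp only: expand)
qed

section \<open>Traces as sums over closed index paths\<close>

primrec word_prod :: "nat \<Rightarrow> (nat \<Rightarrow> 'a :: semiring_1 mat) \<Rightarrow> nat \<Rightarrow> 'a mat" where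
  "word_prod k M 0 = 1\<^sub>m k"
| "word_prod k M (Suc n) = word_prod k M n * M n"

lemma word_prod_carrier:
  assumes "\<And>a. M a \<in> carrier_mat k k"
  shows "word_prod k M n \<in> carrier_mat k k"
  by (induction n) (use assms in \<open>auto intro!: mult_carrier_mat\<close>)

lemma sum_PiE_lessThan_Suc:
  "(\<Sum>r\<in>{..<Suc n} \<rightarrow>\<^sub>E K. g r) = (\<Sum>r\<in>{..<n} \<rightarrow>\<^sub>E K. \<Sum>k\<in>K. g (r(n := k)))"
proof -
  have "(\<Sum>r\<in>{..<Suc n} \<rightarrow>\<^sub>E K. g r) = (\<Sum>(r, k)\<in>({..<n} \<rightarrow>\<^sub>E K) \<times> K. g (r(n := k)))"
  proof (rule sum.reindex_bij_witness[of _ "\<lambda>(r, k). r(n := k)" "\<lambda>r. (restrict r {..<n}, r n)"])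
    fix r assume r: "r \<in> {..<Suc n} \<rightarrow>\<^sub>E K"
    have eq: "(restrict r {..<n})(n := r n) = r"
    proof
      fix x show "((restrict r {..<n})(n := r n)) x = r x"
        using r by (cases "x = n"; cases "x < n") (simp_all add: PiE_def extensional_def)
    qed
    show "(\<lambda>(r, k). r(n := k)) (restrict r {..<n}, r n) = r"
      unfolding prod.case by (rule eq)
    show "(case (restrict r {..<n}, r n) of (r, k) \<Rightarrow> g (r(n := k))) = g r"
      unfolding prod.case eq by (rule refl)
    have "r i \<in> K" if "i < Suc n" for i using PiE_mem[OF r, of i] that by simp
    then show "(restrict r {..<n}, r n) \<in> ({..<n} \<rightarrow>\<^sub>E K) \<times> K"
      by (simp add: restrict_PiE_iff)
  next
    fix b assume "b \<in> ({..<n} \<rightarrow>\<^sub>E K) \<times> K"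
    then obtain r k where b: "b = (r, k)" "r \<in> {..<n} \<rightarrow>\<^sub>E K" "k \<in> K" by auto
    then show "(restrict ((\<lambda>(r, k). r(n := k)) b) {..<n}, (\<lambda>(r, k). r(n := k)) b n) = b"
      by (auto simp: fun_eq_iff PiE_def extensional_def)
    show "(\<lambda>(r, k). r(n := k)) b \<in> {..<Suc n} \<rightarrow>\<^sub>E K"
      using b by (auto simp: PiE_def extensional_def Pi_def less_Suc_eq)
  qed
  then show ?thesis by (simp add: sum.cartesian_product)
qed

text \<open>The weight \<open>f\<close> of the two end points makes the induction work: the last factor is absorbed into it.\<close>

lemma sum_word_prod:
  fixes M :: "nat \<Rightarrow> 'a :: comm_semiring_1 mat"
  assumes M: "\<And>a. M a \<in> carrier_mat k k"
  shows "(\<Sum>i<k. \<Sum>j<k. f i j * word_prod k M n $$ (i, j)) =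
    (\<Sum>r\<in>{..<Suc n} \<rightarrow>\<^sub>E {..<k}. f (r 0) (r n) * (\<Prod>a<n. M a $$ (r a, r (Suc a))))"
proof (induction n arbitrary: f)
  case 0
  have "(\<Sum>r\<in>{..<Suc 0} \<rightarrow>\<^sub>E {..<k}. f (r 0) (r 0)) = (\<Sum>i<k. f i i)"
    by (simp only: sum_PiE_lessThan_Suc) simp
  moreover have "(\<Sum>j<k. f i j * 1\<^sub>m k $$ (i, j)) = f i i" if "i < k" for i
  proof -
    have "(\<Sum>j<k. f i j * 1\<^sub>m k $$ (i, j)) = (\<Sum>j<k. if i = j then f i j else 0)"
      using that by (intro sum.cong) auto
    then show ?thesis using that by simp
  qed
  ultimately show ?case by simp
next
  case (Suc n)
  have "(\<Sum>i<k. \<Sum>j<k. f i j * word_prod k M (Suc n) $$ (i, j)) =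
    (\<Sum>i<k. \<Sum>j<k. \<Sum>l<k. f i j * M n $$ (l, j) * word_prod k M n $$ (i, l))"
    using M[of n] word_prod_carrier[of M k n, OF M]
    by (intro sum.cong) (auto simp: scalar_prod_def sum_distrib_left atLeast0LessThan ac_simps intro!: sum.cong)
  also have "\<dots> = (\<Sum>i<k. \<Sum>l<k. (\<Sum>j<k. f i j * M n $$ (l, j)) * word_prod k M n $$ (i, l))"
  proof (rule sum.cong[OF refl])
    fix i
    show "(\<Sum>j<k. \<Sum>l<k. f i j * M n $$ (l, j) * word_prod k M n $$ (i, l)) =
      (\<Sum>l<k. (\<Sum>j<k. f i j * M n $$ (l, j)) * word_prod k M n $$ (i, l))"
      by (subst sum.swap) (simp add: sum_distrib_right)
  qed
  also have "\<dots> = (\<Sum>r\<in>{..<Suc n} \<rightarrow>\<^sub>E {..<k}. (\<Sum>j<k. f (r 0) j * M n $$ (r n, j)) * (\<Prod>a<n. M a $$ (r a, r (Suc a))))"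
    by (rule Suc.IH)
  also have "\<dots> = (\<Sum>r\<in>{..<Suc (Suc n)} \<rightarrow>\<^sub>E {..<k}. f (r 0) (r (Suc n)) * (\<Prod>a<Suc n. M a $$ (r a, r (Suc a))))"
    unfolding sum_PiE_lessThan_Suc[of _ "Suc n"]
  proof (rule sum.cong[OF refl])
    fix r
    have "(\<Prod>a<n. M a $$ ((r(Suc n := j)) a, (r(Suc n := j)) (Suc a))) = (\<Prod>a<n. M a $$ (r a, r (Suc a)))" for j
      by (rule prod.cong) auto
    then show "(\<Sum>j<k. f (r 0) j * M n $$ (r n, j)) * (\<Prod>a<n. M a $$ (r a, r (Suc a))) =
      (\<Sum>j<k. f ((r(Suc n := j)) 0) ((r(Suc n := j)) (Suc n)) *
         (\<Prod>a<Suc n. M a $$ ((r(Suc n := j)) a, (r(Suc n := j)) (Suc a))))"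
      by (simp add: sum_distrib_left ac_simps)
  qed
  finally show ?case .
qed

lemma mat_trace_word_prod:
  fixes M :: "nat \<Rightarrow> 'a :: comm_semiring_1 mat"
  assumes M: "\<And>a. M a \<in> carrier_mat k k" and n: "n \<ge> 1"
  shows "mat_trace (word_prod k M n) =
    (\<Sum>r\<in>{..<n} \<rightarrow>\<^sub>E {..<k}. \<Prod>a<n. M a $$ (r a, r (Suc a mod n)))"
proof -
  obtain m where m: "n = Suc m" using n by (cases n) auto
  have "mat_trace (word_prod k M n) = (\<Sum>i<k. \<Sum>j<k. M m $$ (j, i) * word_prod k M m $$ (i, j))"
    using M[of m] word_prod_carrier[of M k m, OF M]
    by (auto simp: m mat_trace_def scalar_prod_def atLeast0LessThan ac_simps intro!: sum.cong)
  also have "\<dots> = (\<Sum>r\<in>{..<Suc m} \<rightarrow>\<^sub>E {..<k}. M m $$ (r m, r 0) * (\<Prod>a<m. M a $$ (r a, r (Suc a))))"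
    by (rule sum_word_prod[OF M])
  also have "\<dots> = (\<Sum>r\<in>{..<n} \<rightarrow>\<^sub>E {..<k}. \<Prod>a<n. M a $$ (r a, r (Suc a mod n)))"
    by (simp add: m mult.commute)
  finally show ?thesis .
qed

lemma pow_mat_eq_word_prod:
  fixes A B :: "'a :: semiring_1 mat"
  assumes A: "A \<in> carrier_mat k k" and B: "B \<in> carrier_mat k k"
  shows "(A * B) ^\<^sub>m p = word_prod k (\<lambda>a. if even a then A else B) (2 * p)"
proof (induction p)
  case (Suc p)
  have "word_prod k (\<lambda>a. if even a then A else B) (2 * p) \<in> carrier_mat k k"
    by (rule word_prod_carrier) (use A B in auto)
  then show ?case using Suc A B by (simp add: assoc_mult_mat[of _ k k A k B k])
qed (use A in simp)

lemma mat_trace_gram_power: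
  fixes A :: "complex mat"
  assumes A: "A \<in> carrier_mat k k" and p: "p \<ge> 1"
  shows "mat_trace ((A * mat_adjoint A) ^\<^sub>m p) =
    (\<Sum>r\<in>{..<2*p} \<rightarrow>\<^sub>E {..<k}. \<Prod>a<2*p. if even a then A $$ (r a, r (cyclic_next p a))
       else cnj (A $$ (r (cyclic_next p a), r a)))"
proof -
  have B: "mat_adjoint A \<in> carrier_mat k k" using A by (intro carrier_matI) (simp_all add: dim_mat_adjoint)
  have next_eq: "Suc a mod (2*p) = cyclic_next p a" if "a < 2*p" for a
  proof (cases "even a")
    case True
    then have "Suc a < 2*p" using that by (metis Suc_lessI dvd_triv_left even_Suc)
    then show ?thesis using True by (simp add: cyclic_next_def col_partner_def)
  next
    case False
    then have "a \<noteq> 0" by (cases a) auto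
    then show ?thesis using False that row_partner_block[of a p 0]
      by (cases "a = 2*p - 1") (auto simp: cyclic_next_def)
  qed
  have lt: "cyclic_next p a < 2*p" if "a < 2*p" for a using next_eq[OF that] p mod_less_divisor[of "2*p" "Suc a"] by simp
  have "mat_trace ((A * mat_adjoint A) ^\<^sub>m p) = mat_trace (word_prod k (\<lambda>a. if even a then A else mat_adjoint A) (2*p))"
    by (simp only: pow_mat_eq_word_prod[OF A B])
  also have "\<dots> = (\<Sum>r\<in>{..<2*p} \<rightarrow>\<^sub>E {..<k}. \<Prod>a<2*p. (if even a then A else mat_adjoint A) $$ (r a, r (Suc a mod (2*p))))"
    by (rule mat_trace_word_prod) (use A B p in auto)
  also have "\<dots> = (\<Sum>r\<in>{..<2*p} \<rightarrow>\<^sub>E {..<k}. \<Prod>a<2*p. if even a then A $$ (r a, r (cyclic_next p a))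
       else cnj (A $$ (r (cyclic_next p a), r a)))"
  proof (intro sum.cong prod.cong refl)
    fix r a assume r: "r \<in> {..<2*p} \<rightarrow>\<^sub>E {..<k}" and a: "a \<in> {..<2*p}"
    then have "r a < k" "r (cyclic_next p a) < k" using lt[of a] by auto
    then show "(if even a then A else mat_adjoint A) $$ (r a, r (Suc a mod (2*p))) =
      (if even a then A $$ (r a, r (cyclic_next p a)) else cnj (A $$ (r (cyclic_next p a), r a)))"
      using A a next_eq[of a] by (simp add: mat_adjoint_index)
  qed
  finally show ?thesis .
qed

lemma sum_PiE_power_blocks:
  fixes h :: "(nat \<Rightarrow> 'b) \<Rightarrow> 'c :: comm_semiring_1"
  assumes K: "finite K" and L: "L \<ge> 1"
  shows "(\<Sum>r\<in>{..<L} \<rightarrow>\<^sub>E K. h r) ^ N =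
    (\<Sum>r\<in>{..<L*N} \<rightarrow>\<^sub>E K. \<Prod>q<N. h (\<lambda>a\<in>{..<L}. r (q * L + a)))"
proof -
  let ?S = "{..<L} \<rightarrow>\<^sub>E K"
  have "(\<Sum>r\<in>?S. h r) ^ N = (\<Prod>q<N. \<Sum>r\<in>?S. h r)" by simp
  also have "\<dots> = (\<Sum>R\<in>{..<N} \<rightarrow>\<^sub>E ?S. \<Prod>q<N. h (R q))"
    using K by (intro prod_sum_PiE) (auto intro: finite_PiE)
  also have "\<dots> = (\<Sum>r\<in>{..<L*N} \<rightarrow>\<^sub>E K. \<Prod>q<N. h (\<lambda>a\<in>{..<L}. r (q * L + a)))"
  proof (rule sum.reindex_bij_witness[of _ "\<lambda>r. \<lambda>q\<in>{..<N}. \<lambda>a\<in>{..<L}. r (q * L + a)"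
      "\<lambda>R. \<lambda>a\<in>{..<L*N}. R (a div L) (a mod L)"])
    have lt: "q * L + a < L * N" if "q < N" "a < L" for q a
    proof -
      have "q * L + a < Suc q * L" using that by simp
      also have "\<dots> \<le> N * L" using that by (intro mult_le_mono1) simp
      finally show ?thesis by (simp add: mult.commute)
    qed
    have dv: "a div L < N" "a mod L < L" if "a < L * N" for a
      using that L by (simp_all add: div_less_iff_less_mult mult.commute)
    {
      fix R assume R: "R \<in> {..<N} \<rightarrow>\<^sub>E ?S"
      have Rq: "(\<lambda>a\<in>{..<L}. R q a) = R q" if "q < N" for q
        using R that by (intro PiE_restrict[of _ _ "\<lambda>_. K"]) auto
      have in_eq: "(\<lambda>a\<in>{..<L}. (\<lambda>a\<in>{..<L*N}. R (a div L) (a mod L)) (q * L + a)) = R q" if "q < N" for q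
      proof -
        have "(\<lambda>a\<in>{..<L}. (\<lambda>a\<in>{..<L*N}. R (a div L) (a mod L)) (q * L + a)) = (\<lambda>a\<in>{..<L}. R q a)"
          using lt[OF that] L by (intro restrict_ext) auto
        then show ?thesis using Rq[OF that] by simp
      qed
      show "(\<lambda>q\<in>{..<N}. \<lambda>a\<in>{..<L}. (\<lambda>a\<in>{..<L*N}. R (a div L) (a mod L)) (q * L + a)) = R"
        using R in_eq by (auto simp: fun_eq_iff restrict_def PiE_def extensional_def)
      show "(\<lambda>a\<in>{..<L*N}. R (a div L) (a mod L)) \<in> {..<L*N} \<rightarrow>\<^sub>E K"
        using R dv by (auto simp: PiE_def Pi_def)
      show "(\<Prod>q<N. h (\<lambda>a\<in>{..<L}. (\<lambda>a\<in>{..<L*N}. R (a div L) (a mod L)) (q * L + a))) = (\<Prod>q<N. h (R q))"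
        using in_eq by (intro prod.cong) auto
    next
      fix r assume r: "r \<in> {..<L*N} \<rightarrow>\<^sub>E K"
      show "(\<lambda>a\<in>{..<L*N}. (\<lambda>q\<in>{..<N}. \<lambda>a\<in>{..<L}. r (q * L + a)) (a div L) (a mod L)) = r"
        using r dv by (auto simp: fun_eq_iff PiE_def extensional_def)
      show "(\<lambda>q\<in>{..<N}. \<lambda>a\<in>{..<L}. r (q * L + a)) \<in> {..<N} \<rightarrow>\<^sub>E ?S"
        using r lt by (auto simp: PiE_def Pi_def)
    }
  qed
  finally show ?thesis .
qed

lemma cyclic_next_block:
  assumes "r < 2*p"
  shows "cyclic_next p (q * (2*p) + r) = q * (2*p) + cyclic_next p r" "cyclic_next p r < 2*p"
proof -
  have "r \<noteq> 0" if "odd r" using that by (cases r) auto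
  moreover have "Suc r < 2*p" if "even r" using that assms by (metis Suc_lessI dvd_triv_left even_Suc)
  ultimately show "cyclic_next p (q * (2*p) + r) = q * (2*p) + cyclic_next p r" "cyclic_next p r < 2*p"
    using row_partner_block[OF assms, of q] row_partner_block[OF assms, of 0] col_partner_block[OF assms, of q] col_partner_block[OF assms, of 0] assms
    by (auto simp: cyclic_next_def)
qed

lemma mat_trace_gram_power_power:
  fixes A :: "complex mat"
  assumes A: "A \<in> carrier_mat k k" and p: "p \<ge> 1"
  shows "mat_trace ((A * mat_adjoint A) ^\<^sub>m p) ^ N =
    (\<Sum>r\<in>{..<2*p*N} \<rightarrow>\<^sub>E {..<k}. \<Prod>a<2*p*N. if even a then A $$ (r a, r (cyclic_next p a))
       else cnj (A $$ (r (cyclic_next p a), r a)))"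
proof -
  define F where "F = (\<lambda>a i j. if even (a::nat) then A $$ (i, j) else cnj (A $$ (j, i)))"
  have "mat_trace ((A * mat_adjoint A) ^\<^sub>m p) ^ N =
    (\<Sum>r\<in>{..<2*p} \<rightarrow>\<^sub>E {..<k}. \<Prod>a<2*p. F a (r a) (r (cyclic_next p a))) ^ N"
    unfolding mat_trace_gram_power[OF A p] F_def by simp
  also have "\<dots> = (\<Sum>r\<in>{..<2*p*N} \<rightarrow>\<^sub>E {..<k}. \<Prod>q<N. \<Prod>a<2*p.
      F a ((\<lambda>a\<in>{..<2*p}. r (q * (2*p) + a)) a) ((\<lambda>a\<in>{..<2*p}. r (q * (2*p) + a)) (cyclic_next p a)))"
    using p by (intro sum_PiE_power_blocks) auto
  also have "\<dots> = (\<Sum>r\<in>{..<2*p*N} \<rightarrow>\<^sub>E {..<k}. \<Prod>a<2*p*N. F a (r a) (r (cyclic_next p a)))"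
  proof (intro sum.cong refl)
    fix r
    have "(\<Prod>q<N. \<Prod>a<2*p. F a ((\<lambda>a\<in>{..<2*p}. r (q * (2*p) + a)) a) ((\<lambda>a\<in>{..<2*p}. r (q * (2*p) + a)) (cyclic_next p a))) =
      (\<Prod>q<N. \<Prod>a<2*p. F (q * (2*p) + a) (r (q * (2*p) + a)) (r (cyclic_next p (q * (2*p) + a))))"
      by (intro prod.cong refl) (simp add: cyclic_next_block F_def)
    also have "\<dots> = (\<Prod>q<N. \<Prod>a\<in>{q*(2*p)..<q*(2*p)+2*p}. F a (r a) (r (cyclic_next p a)))"
    proof (rule prod.cong[OF refl])
      fix q
      show "(\<Prod>a<2*p. F (q * (2*p) + a) (r (q * (2*p) + a)) (r (cyclic_next p (q * (2*p) + a)))) =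
        (\<Prod>a\<in>{q*(2*p)..<q*(2*p)+2*p}. F a (r a) (r (cyclic_next p a)))"
        by (rule prod.reindex_bij_witness[of _ "\<lambda>a. a - q*(2*p)" "\<lambda>a. q*(2*p) + a"]) auto
    qed
    also have "\<dots> = (\<Prod>a<2*p*N. F a (r a) (r (cyclic_next p a)))"
      using prod.nat_group[of "\<lambda>a. F a (r a) (r (cyclic_next p a))" "2*p" N] by (simp add: mult.commute)
    finally show "(\<Prod>q<N. \<Prod>a<2*p. F a ((\<lambda>a\<in>{..<2*p}. r (q * (2*p) + a)) a) ((\<lambda>a\<in>{..<2*p}. r (q * (2*p) + a)) (cyclic_next p a))) =
      (\<Prod>a<2*p*N. F a (r a) (r (cyclic_next p a)))" .
  qed
  finally show ?thesis unfolding F_def .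
qed

section \<open>Moments of the realigned Wishart matrix\<close>

lemma max_entangled_vec_index:
  assumes "a < d\<^sup>2"
  shows "vec_index (max_entangled_vec d) a = complex_of_real (1 / sqrt (real d)) * of_bool (a div d = a mod d)"
proof -
  have d: "d > 0" using assms by (cases d) auto
  have a: "a div d < d" using assms by (simp add: power2_eq_square less_mult_imp_div_less)
  have "(\<Sum>i<d. vec_index (unit_vec (d\<^sup>2) (tensor_index d i i)) a) =
      (\<Sum>i<d. if i = a div d then of_bool (a div d = a mod d) else (0::complex))"
  proof (rule sum.cong[OF refl])
    fix i assume i: "i \<in> {..<d}"
    then have "tensor_index d i i = a \<longleftrightarrow> i = a div d \<and> a div d = a mod d"
      using tensor_index_div_mod[of i d i] div_mult_mod_eq[of a d] by (metis lessThan_iff tensor_index_def)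
    then show "vec_index (unit_vec (d\<^sup>2) (tensor_index d i i)) a =
        (if i = a div d then of_bool (a div d = a mod d) else (0::complex))"
      using assms i tensor_index_less[of i d i] by (auto simp: unit_vec_def)
  qed
  also have "\<dots> = of_bool (a div d = a mod d)" using a by simp
  finally show ?thesis using assms by (simp add: max_entangled_vec_def)
qed

text \<open>The entries of \<open>d s E\<close> are \<open>0\<close> or \<open>s\<close>, hence \<open>d s E\<close> can be distributed over the
  \<open>s\<close> summands of the Wishart matrix, where it centres each of them.\<close>

lemma Q_matrix_entry:
  assumes X: "X \<in> carrier_mat (d\<^sup>2) s" and d: "d \<ge> 1" and ij: "i < d\<^sup>2" "j < d\<^sup>2"
  shows "Q_matrix d s (X * mat_adjoint X) $$ (i, j) = complex_of_real (1 / (real d * sqrt (real s))) *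
    (\<Sum>c<s. X $$ (i div d * d + j div d, c) * cnj (X $$ (i mod d * d + j mod d, c))
       - of_bool (i div d = i mod d \<and> j div d = j mod d))"
proof -
  have dv: "i div d < d" "j div d < d" "i mod d < d" "j mod d < d"
    using ij d by (simp_all add: power2_eq_square less_mult_imp_div_less)
  have r: "i div d * d + j div d < d\<^sup>2" "i mod d * d + j mod d < d\<^sup>2"
    using tensor_index_less[of "i div d" d "j div d"] tensor_index_less[of "i mod d" d "j mod d"] dv
    by (simp_all add: tensor_index_def)
  have adj: "mat_adjoint X \<in> carrier_mat s (d\<^sup>2)" using X by (intro carrier_matI) (simp_all add: dim_mat_adjoint)
  have W: "realign d (X * mat_adjoint X) $$ (i, j) =
      (\<Sum>c<s. X $$ (i div d * d + j div d, c) * cnj (X $$ (i mod d * d + j mod d, c)))"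
    using X adj ij r by (simp add: realign_def tensor_index_def scalar_prod_def mat_adjoint_index atLeast0LessThan)
  have "complex_of_real (1 / sqrt (real d)) * cnj (complex_of_real (1 / sqrt (real d))) = 1 / of_nat d"
    using d by (simp add: of_real_mult[symmetric] del: of_real_mult)
  then have "max_entangled_state d $$ (i, j) = 1 / of_nat d * of_bool (i div d = i mod d \<and> j div d = j mod d)"
    using ij by (simp add: max_entangled_state_def max_entangled_vec_index of_bool_conj)
  then have E: "of_nat d * of_nat s * max_entangled_state d $$ (i, j) =
      (\<Sum>c<s. of_bool (i div d = i mod d \<and> j div d = j mod d))"
    using d by simp
  have dims: "realign d (X * mat_adjoint X) \<in> carrier_mat (d\<^sup>2) (d\<^sup>2)" "max_entangled_state d \<in> carrier_mat (d\<^sup>2) (d\<^sup>2)"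
    by (simp_all add: realign_def max_entangled_state_def)
  have "Q_matrix d s (X * mat_adjoint X) $$ (i, j) = complex_of_real (1 / (real d * sqrt (real s))) *
    (realign d (X * mat_adjoint X) $$ (i, j) - of_nat d * of_nat s * max_entangled_state d $$ (i, j))"
    using dims ij unfolding Q_matrix_def by simp
  then show ?thesis unfolding W E by (simp add: sum_subtractf)
qed

text \<open>A summation index \<open>r a\<close> of the trace is the pair \<open>(r a div d, r a mod d)\<close>.  The components are
  regrouped as the row and the column of the unconjugated entry at each position.\<close>

lemma sum_tensor_colourings:
  fixes H :: "(nat \<Rightarrow> nat) \<Rightarrow> (nat \<Rightarrow> nat) \<Rightarrow> 'b :: comm_monoid_add" and N :: nat
  assumes p: "p \<ge> 1" and d: "d \<ge> 1"
  defines "A \<equiv> {..<2*p*N}"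
  shows "(\<Sum>r\<in>A \<rightarrow>\<^sub>E {..<d\<^sup>2}.
      H (\<lambda>a\<in>A. if even a then r a div d else r (cyclic_next p a) mod d)
        (\<lambda>a\<in>A. if even a then r (cyclic_next p a) div d else r a mod d)) =
    (\<Sum>u\<in>A \<rightarrow>\<^sub>E {..<d}. \<Sum>t\<in>A \<rightarrow>\<^sub>E {..<d}. H u t)"
proof -
  \<comment> \<open>at an odd position the factor is an entry of \<open>Q\<^sup>*\<close>, so the roles of the two indices and of their
    components are exchanged\<close>
  define row where "row r = (\<lambda>a\<in>A. if even a then r a div d else r (cyclic_next p a) mod d)" for r :: "nat \<Rightarrow> nat"
  define col where "col r = (\<lambda>a\<in>A. if even a then r (cyclic_next p a) div d else r a mod d)" for r :: "nat \<Rightarrow> nat"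
  define tensor where "tensor = (\<lambda>(u, t). \<lambda>a\<in>A. if even a then u a * d + u (row_partner p a) else t (col_partner a) * d + t a)"
  note ab = partner_properties[OF p]
  have inA: "row_partner p a \<in> A" "col_partner a \<in> A" "cyclic_next p a \<in> A" if "a \<in> A" for a
    using that by (simp_all add: A_def cyclic_next_def row_partner_less[OF p] col_partner_less[OF p])
  note dm = tensor_index_div_mod[unfolded tensor_index_def]
  have nx: "cyclic_next p a = (if even a then col_partner a else row_partner p a)" for a by (simp add: cyclic_next_def)
  have "(\<Sum>r\<in>A \<rightarrow>\<^sub>E {..<d\<^sup>2}. H (row r) (col r)) = (\<Sum>(u, t)\<in>(A \<rightarrow>\<^sub>E {..<d}) \<times> (A \<rightarrow>\<^sub>E {..<d}). H u t)"
  proof (rule sum.reindex_bij_witness[of _ tensor "\<lambda>r. (row r, col r)"])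
    fix r assume r: "r \<in> A \<rightarrow>\<^sub>E {..<d\<^sup>2}"
    have rlt: "r a div d < d" "r a mod d < d" if "a \<in> A" for a
      using PiE_mem[OF r that] d by (simp_all add: power2_eq_square less_mult_imp_div_less)
    show "tensor (row r, col r) = r"
    proof
      fix a show "tensor (row r, col r) a = r a"
      proof (cases "a \<in> A")
        case True
        then show ?thesis using inA[OF True] ab(1,3,4,6)[of a] by (auto simp: tensor_def row_def col_def nx)
      next
        case False
        then show ?thesis using r by (simp add: tensor_def PiE_def extensional_def)
      qed
    qed
    show "(row r, col r) \<in> (A \<rightarrow>\<^sub>E {..<d}) \<times> (A \<rightarrow>\<^sub>E {..<d})"
      using rlt inA by (simp add: row_def col_def restrict_PiE_iff)
  next
    fix x assume "x \<in> (A \<rightarrow>\<^sub>E {..<d}) \<times> (A \<rightarrow>\<^sub>E {..<d})"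
    then obtain u t where x: "x = (u, t)" and u: "u \<in> A \<rightarrow>\<^sub>E {..<d}" and t: "t \<in> A \<rightarrow>\<^sub>E {..<d}" by blast
    have lt: "u a < d" "t a < d" if "a \<in> A" for a using PiE_mem[OF u that] PiE_mem[OF t that] by simp_all
    have "tensor x a < d\<^sup>2" if "a \<in> A" for a
      using that lt inA[OF that] tensor_index_less[of "u a" d "u (row_partner p a)"] tensor_index_less[of "t (col_partner a)" d "t a"]
      by (simp add: x tensor_def tensor_index_def)
    then show "tensor x \<in> A \<rightarrow>\<^sub>E {..<d\<^sup>2}" by (simp add: x tensor_def restrict_PiE_iff)
    have "row (tensor x) a = u a" for a
    proof (cases "a \<in> A")
      case True
      then show ?thesis using inA[OF True] ab(1,3)[of a] lt by (auto simp: x tensor_def row_def nx dm)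
    next
      case False
      then show ?thesis using u by (simp add: row_def PiE_def extensional_def)
    qed
    moreover have "col (tensor x) a = t a" for a
    proof (cases "a \<in> A")
      case True
      then show ?thesis using inA[OF True] ab(4,6)[of a] lt by (auto simp: x tensor_def col_def nx dm)
    next
      case False
      then show ?thesis using t by (simp add: col_def PiE_def extensional_def)
    qed
    ultimately show "(row (tensor x), col (tensor x)) = x" unfolding x by (auto simp: fun_eq_iff)
  qed simp
  then show ?thesis by (simp add: row_def col_def sum.cartesian_product)
qed

lemma mat_trace_Q_power_expansion:
  fixes N :: nat
  assumes X: "X \<in> carrier_mat (d\<^sup>2) s" and p: "p \<ge> 1" and d: "d \<ge> 1"
  defines "A \<equiv> {..<2*p*N}" and "Q \<equiv> Q_matrix d s (X * mat_adjoint X)"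
  shows "mat_trace ((Q * mat_adjoint Q) ^\<^sub>m p) ^ N =
    complex_of_real (1 / (real d * sqrt (real s))) ^ (2*p*N) *
    (\<Sum>u\<in>A \<rightarrow>\<^sub>E {..<d}. \<Sum>t\<in>A \<rightarrow>\<^sub>E {..<d}. \<Sum>c\<in>A \<rightarrow>\<^sub>E {..<s}.
      \<Prod>a\<in>A. X $$ (u a * d + t a, c a) * cnj (X $$ (u (row_partner p a) * d + t (col_partner a), c a))
        - of_bool (u a = u (row_partner p a) \<and> t a = t (col_partner a)))"
proof -
  define k where "k = complex_of_real (1 / (real d * sqrt (real s)))"
  define F where "F = (\<lambda>u t a c. X $$ (u a * d + t a, c) * cnj (X $$ (u (row_partner p a) * d + t (col_partner a), c))
        - of_bool (u a = u (row_partner p a) \<and> t a = t (col_partner a)))"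
  note ab = partner_properties[OF p]
  have Q: "Q \<in> carrier_mat (d\<^sup>2) (d\<^sup>2)"
    unfolding Q_def Q_matrix_def
    by (intro smult_carrier_mat minus_carrier_mat) (simp add: max_entangled_state_def)
  let ?row = "\<lambda>r. \<lambda>a\<in>A. if even a then r a div d else r (cyclic_next p a) mod d"
  let ?col = "\<lambda>r. \<lambda>a\<in>A. if even a then r (cyclic_next p a) div d else r a mod d"
  have "mat_trace ((Q * mat_adjoint Q) ^\<^sub>m p) ^ N =
    (\<Sum>r\<in>A \<rightarrow>\<^sub>E {..<d\<^sup>2}. \<Prod>a\<in>A. if even a then Q $$ (r a, r (cyclic_next p a))
       else cnj (Q $$ (r (cyclic_next p a), r a)))"
    unfolding A_def by (rule mat_trace_gram_power_power[OF Q p])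
  also have "\<dots> = (\<Sum>r\<in>A \<rightarrow>\<^sub>E {..<d\<^sup>2}. \<Prod>a\<in>A. k * (\<Sum>c<s. F (?row r) (?col r) a c))"
  proof (rule sum.cong[OF refl], rule prod.cong[OF refl])
    fix r a assume r: "r \<in> A \<rightarrow>\<^sub>E {..<d\<^sup>2}" and a: "a \<in> A"
    have inA: "row_partner p a \<in> A" "col_partner a \<in> A" "cyclic_next p a \<in> A"
      using a by (simp_all add: A_def cyclic_next_def row_partner_less[OF p] col_partner_less[OF p])
    have lt: "r a < d\<^sup>2" "r (cyclic_next p a) < d\<^sup>2" using PiE_mem[OF r] a inA by auto
    note entry = Q_matrix_entry[OF X d lt, folded Q_def k_def] Q_matrix_entry[OF X d lt(2,1), folded Q_def k_def]
    show "(if even a then Q $$ (r a, r (cyclic_next p a)) else cnj (Q $$ (r (cyclic_next p a), r a))) =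
      k * (\<Sum>c<s. F (?row r) (?col r) a c)"
    proof (cases "even a")
      case True
      then have "?row r a = r a div d" "?row r (row_partner p a) = r a mod d"
        "?col r a = r (cyclic_next p a) div d" "?col r (col_partner a) = r (cyclic_next p a) mod d"
        using a inA ab(1,3,4,6)[of a] by (simp_all add: cyclic_next_def)
      then show ?thesis using True by (simp only: entry F_def if_True)
    next
      case False
      have rc: "?row r a = r (cyclic_next p a) mod d" "?row r (row_partner p a) = r (cyclic_next p a) div d"
        "?col r a = r a mod d" "?col r (col_partner a) = r a div d"
        using False a inA ab(1,3,4,6)[of a] by (simp_all add: cyclic_next_def)
      have k: "cnj k = k" by (simp add: k_def)
      have "cnj (Q $$ (r (cyclic_next p a), r a)) = k * (\<Sum>c<s. F (?row r) (?col r) a c)"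
        unfolding entry F_def rc by (simp add: k mult.commute)
      then show ?thesis using False by (simp only: if_False)
    qed
  qed
  also have "\<dots> = (\<Sum>u\<in>A \<rightarrow>\<^sub>E {..<d}. \<Sum>t\<in>A \<rightarrow>\<^sub>E {..<d}. \<Prod>a\<in>A. k * (\<Sum>c<s. F u t a c))"
    unfolding A_def by (rule sum_tensor_colourings[OF p d])
  also have "\<dots> = (\<Sum>u\<in>A \<rightarrow>\<^sub>E {..<d}. \<Sum>t\<in>A \<rightarrow>\<^sub>E {..<d}. k ^ (2*p*N) * (\<Sum>c\<in>A \<rightarrow>\<^sub>E {..<s}. \<Prod>a\<in>A. F u t a (c a)))"
  proof (rule sum.cong[OF refl], rule sum.cong[OF refl])
    fix u t
    have "(\<Prod>a\<in>A. k * (\<Sum>c<s. F u t a c)) = k ^ (2*p*N) * (\<Prod>a\<in>A. \<Sum>c<s. F u t a c)"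
      by (simp add: prod.distrib A_def)
    also have "(\<Prod>a\<in>A. \<Sum>c<s. F u t a c) = (\<Sum>c\<in>A \<rightarrow>\<^sub>E {..<s}. \<Prod>a\<in>A. F u t a (c a))"
      by (rule prod_sum_PiE) (simp_all add: A_def)
    finally show "(\<Prod>a\<in>A. k * (\<Sum>c<s. F u t a c)) = k ^ (2*p*N) * (\<Sum>c\<in>A \<rightarrow>\<^sub>E {..<s}. \<Prod>a\<in>A. F u t a (c a))" .
  qed
  finally show ?thesis unfolding k_def F_def sum_distrib_left .
qed

lemma tensor_eq_iff:
  fixes u t u' t' d :: nat
  assumes "t < d" "t' < d"
  shows "u * d + t = u' * d + t' \<longleftrightarrow> u = u' \<and> t = t'"
  using assms by (metis tensor_index_div_mod tensor_index_def)

lemma card_invariant_colourings_sum: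
  assumes "finite A"
  shows "of_nat (card (invariant_colourings A k \<pi>)) =
    (\<Sum>v\<in>A \<rightarrow>\<^sub>E {..<k}. of_bool (\<forall>a\<in>A. v a = v (\<pi> a)) :: 'b :: semiring_1)"
proof -
  have "finite (A \<rightarrow>\<^sub>E {..<k})" using assms by (simp add: finite_PiE)
  moreover have "invariant_colourings A k \<pi> = {v \<in> A \<rightarrow>\<^sub>E {..<k}. \<forall>a\<in>A. v a = v (\<pi> a)}"
    by (auto simp: invariant_colourings_def)
  ultimately show ?thesis by (simp add: of_bool_def sum.If_cases Int_def)
qed

lemma sum_product_three:
  fixes f :: "'a \<Rightarrow> 'd :: semiring_0" and g :: "'b \<Rightarrow> 'd" and h :: "'c \<Rightarrow> 'd"
  shows "(\<Sum>c\<in>C. f c) * ((\<Sum>u\<in>U. g u) * (\<Sum>t\<in>V. h t)) = (\<Sum>u\<in>U. \<Sum>t\<in>V. \<Sum>c\<in>C. f c * (g u * h t))"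
proof -
  have "(\<Sum>c\<in>C. f c) * ((\<Sum>u\<in>U. g u) * (\<Sum>t\<in>V. h t)) = (\<Sum>c\<in>C. f c) * (\<Sum>u\<in>U. \<Sum>t\<in>V. g u * h t)"
    by (simp only: sum_product)
  also have "\<dots> = (\<Sum>u\<in>U. \<Sum>t\<in>V. (\<Sum>c\<in>C. f c) * (g u * h t))"
    by (simp only: sum_distrib_left)
  finally show ?thesis by (simp only: sum_distrib_right)
qed

lemma trace_moment:
  assumes X: "complex_gaussian_matrix M (d\<^sup>2) s X" and p: "p \<ge> 1" and d: "d \<ge> 1" and s: "s \<ge> 1"
  defines "Q \<equiv> \<lambda>w. Q_matrix d s (X w * mat_adjoint (X w))"
  shows "has_bochner_integral M (\<lambda>w. mat_trace ((Q w * mat_adjoint (Q w)) ^\<^sub>m p) ^ N)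
    (complex_of_real (1 / (real d * sqrt (real s))) ^ (2*p*N) *
      (\<Sum>\<sigma>\<in>derangements {..<2*p*N}. of_nat (gluing_weight p N d s \<sigma>)))"
proof -
  interpret prob_space M using X by (simp add: complex_gaussian_matrix_def)
  define A where "A = {..<2*p*N}"
  define I where "I = {..<d\<^sup>2} \<times> {..<s}"
  define Z where "Z = (\<lambda>(i, j) w. X w $$ (i, j))"
  have ind: "indep_vars (\<lambda>_. borel) Z I" and g: "\<And>x. x \<in> I \<Longrightarrow> std_complex_gaussian M (Z x)"
    and car: "\<And>w. w \<in> space M \<Longrightarrow> X w \<in> carrier_mat (d\<^sup>2) s"
    using X by (auto simp: complex_gaussian_matrix_def Z_def I_def)
  let ?k = "complex_of_real (1 / (real d * sqrt (real s)))"
  let ?U = "A \<rightarrow>\<^sub>E {..<d}" and ?C = "A \<rightarrow>\<^sub>E {..<s}"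
  let ?t = "\<lambda>u t c w. \<Prod>a\<in>A. X w $$ (u a * d + t a, c a) * cnj (X w $$ (u (row_partner p a) * d + t (col_partner a), c a))
        - of_bool (u a = u (row_partner p a) \<and> t a = t (col_partner a))"
  let ?b = "\<lambda>v \<pi>. of_bool (\<forall>a\<in>A. v a = v (\<pi> a)) :: complex"
  have inA: "row_partner p a \<in> A" "col_partner a \<in> A" if "a \<in> A" for a
    using that by (simp_all add: A_def row_partner_less[OF p] col_partner_less[OF p])
  have word: "has_bochner_integral M (?t u t c)
      (\<Sum>\<sigma>\<in>derangements A. ?b c \<sigma> * (?b u (row_partner p \<circ> \<sigma>) * ?b t (col_partner \<circ> \<sigma>)))"
    if u: "u \<in> ?U" and t: "t \<in> ?U" and c: "c \<in> ?C" for u t c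
  proof -
    define e where "e a = (u a * d + t a, c a)" for a
    define f where "f a = (u (row_partner p a) * d + t (col_partner a), c a)" for a
    have lt: "u a < d" "t a < d" "c a < s" if "a \<in> A" for a
      using PiE_mem[OF u that] PiE_mem[OF t that] PiE_mem[OF c that] by simp_all
    have "e ` A \<subseteq> I" "f ` A \<subseteq> I"
      using lt inA tensor_index_less unfolding e_def f_def I_def tensor_index_def by auto
    then have "has_bochner_integral M (\<lambda>w. \<Prod>a\<in>A. Z (e a) w * cnj (Z (f a) w) - of_bool (e a = f a))
        (\<Sum>\<sigma>\<in>derangements A. of_bool (\<forall>a\<in>A. e a = f (\<sigma> a)))"
      using gaussian_wick_centred[of A I e f Z, OF _ _ _ _ ind g] by (simp add: A_def I_def)
    moreover have "(\<lambda>w. \<Prod>a\<in>A. Z (e a) w * cnj (Z (f a) w) - of_bool (e a = f a)) = ?t u t c"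
    proof (rule ext, rule prod.cong[OF refl])
      fix w a assume "a \<in> A"
      then have "e a = f a \<longleftrightarrow> u a = u (row_partner p a) \<and> t a = t (col_partner a)"
        using lt inA by (simp add: e_def f_def tensor_eq_iff)
      then show "Z (e a) w * cnj (Z (f a) w) - of_bool (e a = f a) =
        X w $$ (u a * d + t a, c a) * cnj (X w $$ (u (row_partner p a) * d + t (col_partner a), c a))
        - of_bool (u a = u (row_partner p a) \<and> t a = t (col_partner a))"
        by (simp only:) (simp add: Z_def e_def f_def)
    qed
    moreover have "(\<Sum>\<sigma>\<in>derangements A. of_bool (\<forall>a\<in>A. e a = f (\<sigma> a))) =
      (\<Sum>\<sigma>\<in>derangements A. ?b c \<sigma> * (?b u (row_partner p \<circ> \<sigma>) * ?b t (col_partner \<circ> \<sigma>)))"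
    proof (rule sum.cong[OF refl])
      fix \<sigma> assume "\<sigma> \<in> derangements A"
      then have "\<sigma> a \<in> A" if "a \<in> A" for a using that by (simp add: derangements_def permutes_in_image)
      then have "e a = f (\<sigma> a) \<longleftrightarrow> c a = c (\<sigma> a) \<and> u a = u ((row_partner p \<circ> \<sigma>) a) \<and> t a = t ((col_partner \<circ> \<sigma>) a)"
        if "a \<in> A" for a using that lt inA by (auto simp: e_def f_def tensor_eq_iff)
      then have "(\<forall>a\<in>A. e a = f (\<sigma> a)) \<longleftrightarrow>
        (\<forall>a\<in>A. c a = c (\<sigma> a)) \<and> (\<forall>a\<in>A. u a = u ((row_partner p \<circ> \<sigma>) a)) \<and> (\<forall>a\<in>A. t a = t ((col_partner \<circ> \<sigma>) a))"
        by blast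
      then show "of_bool (\<forall>a\<in>A. e a = f (\<sigma> a)) = ?b c \<sigma> * (?b u (row_partner p \<circ> \<sigma>) * ?b t (col_partner \<circ> \<sigma>))"
        by (simp only: of_bool_conj)
    qed
    ultimately show ?thesis by (simp only:)
  qed
  have "has_bochner_integral M (\<lambda>w. ?k ^ (2*p*N) * (\<Sum>u\<in>?U. \<Sum>t\<in>?U. \<Sum>c\<in>?C. ?t u t c w))
    (?k ^ (2*p*N) * (\<Sum>u\<in>?U. \<Sum>t\<in>?U. \<Sum>c\<in>?C. \<Sum>\<sigma>\<in>derangements A.
       ?b c \<sigma> * (?b u (row_partner p \<circ> \<sigma>) * ?b t (col_partner \<circ> \<sigma>))))"
    by (intro has_bochner_integral_mult_right has_bochner_integral_sum word)
  also have "(\<Sum>u\<in>?U. \<Sum>t\<in>?U. \<Sum>c\<in>?C. \<Sum>\<sigma>\<in>derangements A. ?b c \<sigma> * (?b u (row_partner p \<circ> \<sigma>) * ?b t (col_partner \<circ> \<sigma>))) =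
    (\<Sum>\<sigma>\<in>derangements A. \<Sum>u\<in>?U. \<Sum>t\<in>?U. \<Sum>c\<in>?C. ?b c \<sigma> * (?b u (row_partner p \<circ> \<sigma>) * ?b t (col_partner \<circ> \<sigma>)))"
    by (simp only: sum.swap[of _ "derangements A"])
  also have "\<dots> = (\<Sum>\<sigma>\<in>derangements A. of_nat (gluing_weight p N d s \<sigma>))"
  proof (rule sum.cong[OF refl])
    fix \<sigma>
    have "of_nat (gluing_weight p N d s \<sigma>) =
      (\<Sum>c\<in>?C. ?b c \<sigma>) * ((\<Sum>u\<in>?U. ?b u (row_partner p \<circ> \<sigma>)) * (\<Sum>t\<in>?U. ?b t (col_partner \<circ> \<sigma>)))"
      by (simp only: gluing_weight_def of_nat_mult card_invariant_colourings_sum[OF finite_lessThan] A_def)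
    also have "\<dots> = (\<Sum>u\<in>?U. \<Sum>t\<in>?U. \<Sum>c\<in>?C. ?b c \<sigma> * (?b u (row_partner p \<circ> \<sigma>) * ?b t (col_partner \<circ> \<sigma>)))"
      by (rule sum_product_three)
    finally show "(\<Sum>u\<in>?U. \<Sum>t\<in>?U. \<Sum>c\<in>?C. ?b c \<sigma> * (?b u (row_partner p \<circ> \<sigma>) * ?b t (col_partner \<circ> \<sigma>))) =
      of_nat (gluing_weight p N d s \<sigma>)" by (rule sym)
  qed
  finally have hb: "has_bochner_integral M (\<lambda>w. ?k ^ (2*p*N) * (\<Sum>u\<in>?U. \<Sum>t\<in>?U. \<Sum>c\<in>?C. ?t u t c w))
    (?k ^ (2*p*N) * (\<Sum>\<sigma>\<in>derangements A. of_nat (gluing_weight p N d s \<sigma>)))" .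
  have "mat_trace ((Q w * mat_adjoint (Q w)) ^\<^sub>m p) ^ N = ?k ^ (2*p*N) * (\<Sum>u\<in>?U. \<Sum>t\<in>?U. \<Sum>c\<in>?C. ?t u t c w)"
    if "w \<in> space M" for w
    unfolding Q_def A_def by (rule mat_trace_Q_power_expansion[OF car[OF that] p d])
  then show ?thesis using hb unfolding A_def[symmetric]
    by (subst has_bochner_integral_cong[OF refl _ refl]) simp_all
qed

text \<open>The normalisations combine: \<open>1 / (d \<surd>s)\<close> to the power \<open>2pN\<close> and \<open>1 / d\<^sup>2\<close> to the power
  \<open>N\<close> multiply to \<open>1 / max_weight p N d s\<close>.\<close>

lemma normalized_moment_power:
  assumes X: "complex_gaussian_matrix M (d\<^sup>2) s X" and p: "p \<ge> 1" and d: "d \<ge> 1" and s: "s \<ge> 1"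
  shows "has_bochner_integral M (\<lambda>w. normalized_moment d p (Q_matrix d s (X w * mat_adjoint (X w))) ^ N)
    (gluing_sum p N d s)"
proof -
  let ?Q = "\<lambda>w. Q_matrix d s (X w * mat_adjoint (X w))"
  let ?Tr = "\<lambda>w. mat_trace ((?Q w * mat_adjoint (?Q w)) ^\<^sub>m p)"
  let ?k = "1 / (real d * sqrt (real s))"
  let ?S = "\<Sum>\<sigma>\<in>derangements {..<2*p*N}. real (gluing_weight p N d s \<sigma>)"
  have re: "Re (?Tr w ^ N) = Re (?Tr w) ^ N" for w
  proof -
    have "?Tr w = complex_of_real (Re (?Tr w))" using Im_mat_trace_moment[of "?Q w" p] by (simp add: complex_eq_iff)
    then show ?thesis by (metis Re_complex_of_real of_real_power)
  qed
  have "has_bochner_integral M (\<lambda>w. Re (?Tr w ^ N)) (Re (complex_of_real ?k ^ (2*p*N) *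
      (\<Sum>\<sigma>\<in>derangements {..<2*p*N}. of_nat (gluing_weight p N d s \<sigma>))))"
    by (intro has_bochner_integral_bounded_linear[OF bounded_linear_Re] trace_moment[OF X p d s])
  also have "complex_of_real ?k ^ (2*p*N) * (\<Sum>\<sigma>\<in>derangements {..<2*p*N}. of_nat (gluing_weight p N d s \<sigma>)) =
      complex_of_real (?k ^ (2*p*N) * ?S)"
    by (simp only: of_real_mult of_real_power of_real_sum of_real_of_nat_eq)
  finally have "has_bochner_integral M (\<lambda>w. Re (?Tr w) ^ N / (real d)\<^sup>2 ^ N) (?k ^ (2*p*N) * ?S / (real d)\<^sup>2 ^ N)"
    unfolding re by (intro has_bochner_integral_divide_zero) simp
  moreover have "?k ^ (2*p*N) * ?S / (real d)\<^sup>2 ^ N = gluing_sum p N d s"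
  proof -
    have "(real d * sqrt (real s)) ^ (2*p*N) = real d ^ (2*p*N) * (sqrt (real s) ^ 2) ^ (p*N)"
      by (simp only: power_mult_distrib power_mult[symmetric] mult.assoc)
    also have "\<dots> = real d ^ (2*p*N) * real s ^ (p*N)" by simp
    finally have "(real d * sqrt (real s)) ^ (2*p*N) = real d ^ (2*p*N) * real s ^ (p*N)" .
    moreover have "(real d)\<^sup>2 ^ N = real d ^ (2*N)" by (simp only: power_mult)
    moreover have "real (max_weight p N d s) = real s ^ (p*N) * (real d ^ (2*p*N) * real d ^ (2*N))"
      by (simp only: max_weight_def of_nat_mult of_nat_power power_add)
    ultimately have "?k ^ (2*p*N) / (real d)\<^sup>2 ^ N = 1 / real (max_weight p N d s)"
      by (simp only: power_one_over divide_divide_eq_left ac_simps)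
    then show ?thesis by (simp add: gluing_sum_def field_simps)
  qed
  ultimately show ?thesis by (simp add: normalized_moment_def power_divide)
qed

section \<open>The limit\<close>

lemma const_over_min_tendsto_0:
  "((\<lambda>(d, s). C / real (min d s)) \<longlongrightarrow> 0) (sequentially \<times>\<^sub>F sequentially)"
proof -
  have "filterlim (\<lambda>(d, s). min d s) sequentially (sequentially \<times>\<^sub>F sequentially)"
    by (auto simp: filterlim_at_top eventually_prod_sequentially)
  from filterlim_compose[OF lim_const_over_n[of C] this] show ?thesis
    by (simp add: case_prod_unfold)
qed

theorem theorem2p1:
  fixes M :: "nat \<Rightarrow> nat \<Rightarrow> 'w measure"
    and W :: "nat \<Rightarrow> nat \<Rightarrow> 'w \<Rightarrow> complex mat"
    and T :: "nat \<Rightarrow> nat \<Rightarrow> 'w \<Rightarrow> real"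
    and p :: nat
  assumes wishart: "\<And>d s. d \<ge> 1 \<Longrightarrow> s \<ge> 1 \<Longrightarrow> wishart_matrix (M d s) (d\<^sup>2) s (W d s)"
    and T_def: "\<And>d s w. T d s w = normalized_moment d p (Q_matrix d s (W d s w))"
    and p: "p \<ge> 1"
  shows "(\<forall>d\<ge>1. \<forall>s\<ge>1. integrable (M d s) (T d s) \<and> integrable (M d s) (\<lambda>w. (T d s w)\<^sup>2)) \<and>
    ((\<lambda>(d, s). prob_space.expectation (M d s) (T d s)) \<longlongrightarrow> catalan p)
      (sequentially \<times>\<^sub>F sequentially) \<and>
    ((\<lambda>(d, s). prob_space.variance (M d s) (T d s)) \<longlongrightarrow> 0)
      (sequentially \<times>\<^sub>F sequentially)"
proof -
  let ?F = "sequentially \<times>\<^sub>F sequentially"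
  have moments: "prob_space (M d s) \<and> has_bochner_integral (M d s) (\<lambda>w. T d s w ^ N) (gluing_sum p N d s)"
    if ds: "d \<ge> 1" "s \<ge> 1" for d s N
  proof -
    obtain X where X: "complex_gaussian_matrix (M d s) (d\<^sup>2) s X"
      and W: "\<And>w. w \<in> space (M d s) \<Longrightarrow> W d s w = X w * mat_adjoint (X w)"
      using wishart[OF ds] unfolding wishart_matrix_def by blast
    have "has_bochner_integral (M d s) (\<lambda>w. T d s w ^ N) (gluing_sum p N d s)"
      using normalized_moment_power[OF X p ds, of N] W
      by (subst has_bochner_integral_cong[OF refl _ refl]) (simp_all add: T_def)
    then show ?thesis using X by (simp add: complex_gaussian_matrix_def)
  qed
  have int: "integrable (M d s) (T d s)" "integrable (M d s) (\<lambda>w. (T d s w)\<^sup>2)"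
    and mean: "prob_space.expectation (M d s) (T d s) = gluing_sum p 1 d s"
    and var: "prob_space.variance (M d s) (T d s) = gluing_sum p 2 d s - (gluing_sum p 1 d s)\<^sup>2"
    if "d \<ge> 1" "s \<ge> 1" for d s
  proof -
    interpret prob_space "M d s" using moments[OF that] by blast
    have 1: "has_bochner_integral (M d s) (T d s) (gluing_sum p 1 d s)"
      and 2: "has_bochner_integral (M d s) (\<lambda>w. (T d s w)\<^sup>2) (gluing_sum p 2 d s)"
      using moments[OF that, of 1] moments[OF that, of 2] by simp_all
    show int: "integrable (M d s) (T d s)" "integrable (M d s) (\<lambda>w. (T d s w)\<^sup>2)"
      using 1 2 by (auto simp: has_bochner_integral_iff)
    show "expectation (T d s) = gluing_sum p 1 d s" using 1 by (simp add: has_bochner_integral_iff)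
    then show "variance (T d s) = gluing_sum p 2 d s - (gluing_sum p 1 d s)\<^sup>2"
      using 2 variance_eq[OF int] by (simp add: has_bochner_integral_iff)
  qed
  have ev: "\<forall>\<^sub>F (d, s) in ?F. d \<ge> 1 \<and> s \<ge> 1"
    by (auto simp: eventually_prod_sequentially intro: exI[of _ 1])
  have mean_lim: "((\<lambda>(d, s). gluing_sum p 1 d s) \<longlongrightarrow> catalan p) ?F"
  proof (rule LIM_zero_cancel, rule Lim_null_comparison)
    show "\<forall>\<^sub>F x in ?F. norm ((case x of (d, s) \<Rightarrow> gluing_sum p 1 d s) - catalan p) \<le> (case x of (d, s) \<Rightarrow> fact (2*p) / real (min d s))"
      using ev by eventually_elim (use gluing_sum_1[OF p] in auto)
  qed (rule const_over_min_tendsto_0)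
  have "((\<lambda>(d, s). prob_space.expectation (M d s) (T d s)) \<longlongrightarrow> catalan p) ?F"
    by (rule Lim_transform_eventually[OF mean_lim]) (use ev in eventually_elim, auto simp: mean)
  moreover have "((\<lambda>(d, s). prob_space.variance (M d s) (T d s)) \<longlongrightarrow> 0) ?F"
  proof (rule tendsto_sandwich)
    show "\<forall>\<^sub>F x in ?F. 0 \<le> (case x of (d, s) \<Rightarrow> prob_space.variance (M d s) (T d s))"
      by (rule always_eventually) (auto intro!: integral_nonneg_AE)
    show "\<forall>\<^sub>F x in ?F. (case x of (d, s) \<Rightarrow> prob_space.variance (M d s) (T d s)) \<le>
        (catalan p)\<^sup>2 + (case x of (d, s) \<Rightarrow> fact (2*p*2) / real (min d s)) - (case x of (d, s) \<Rightarrow> gluing_sum p 1 d s)\<^sup>2"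
      using ev
    proof eventually_elim
      case (elim x)
      then show ?case using gluing_sum_le[OF p, of "fst x" "snd x" 2] by (cases x) (simp add: var)
    qed
    have "((\<lambda>x. (catalan p)\<^sup>2 + (case x of (d, s) \<Rightarrow> fact (2*p*2) / real (min d s)) - (case x of (d, s) \<Rightarrow> gluing_sum p 1 d s)\<^sup>2)
        \<longlongrightarrow> (catalan p)\<^sup>2 + 0 - (catalan p)\<^sup>2) ?F"
      by (intro tendsto_intros const_over_min_tendsto_0 mean_lim)
    then show "((\<lambda>x. (catalan p)\<^sup>2 + (case x of (d, s) \<Rightarrow> fact (2*p*2) / real (min d s)) - (case x of (d, s) \<Rightarrow> gluing_sum p 1 d s)\<^sup>2)
        \<longlongrightarrow> 0) ?F" by simp
  qed simp
  ultimately show ?thesis using int by blast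
qed

end
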